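(* Let $\mathbb{F}$ be a field of characteristic $3$ and let $n>1$ be an integer. Then the outer derivation algebra of the Lie algebra $H(2;(1,n))^{(2)}$ over $\mathbb{F}$ is isomorphic, as a Lie algebra, to $$\big(\mathfrak{sl}_2(\mathbb{F})\ltimes V(2)\big)\oplus \mathbb{F}^{n-1},$$ where $V(2)$ is the natural representation of $\mathfrak{sl}_2(\mathbb{F})$ and $\mathbb{F}^{n-1}$ is the abelian Lie algebra of dimension $n-1$.
   Context: For a finite-dimensional Lie algebra $\mathfrak{g}$ over a field $\mathbb{F}$, $\mathrm{Der}(\mathfrak{g})$ is the Lie algebra of $\mathbb{F}$-linear derivations of $\mathfrak{g}$, $\mathrm{ad}(\mathfrak{g})$ is its ideal of inner derivations, and $\mathrm{Out}(\mathfrak{g})=\mathrm{Der}(\mathfrak{g})/\mathrm{ad}(\mathfrak{g})$ is the outer derivation algebra. In $\mathfrak{sl}_2(\mathbb{F})\ltimes V(2)$, the space $V(2)$ is the natural $2$-dimensional representation, regarded as an abelian ideal. In characteristic $3$ this Lie algebra has a basis $(e_1,\ldots,e_5)$ with Lie brackets $[e_1,e_2]=e_3$, $[e_1,e_3]=e_1$, $[e_1,e_5]=e_4$, $[e_2,e_3]=2e_2$, $[e_2,e_4]=e_5$, $[e_3,e_4]=e_4$, $[e_3,e_5]=2e_5$ (the other brackets of basis vectors being zero or determined by antisymmetry). The symbol $\oplus$ denotes the direct sum of Lie algebras. Hamiltonian algebras. Let $\mathbb{F}$ have characteristic $p>2$, let $m=2r$ with $r\ge 1$, and let $\underline{n}=(n_1,\ldots,n_m)$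 be a tuple of positive integers with $|\underline{n}|=n_1+\cdots+n_m$. The divided power algebra $\mathcal{O}(m;\underline{n})$ is the commutative associative unital $\mathbb{F}$-algebra with basis $\{x^{(a)} : a=(a_1,\ldots,a_m),\ a_i\in\mathbb{Z},\ 0\le a_i<p^{n_i}\}$ and product $x^{(a)}x^{(b)}=\binom{a+b}{b}x^{(a+b)}$, where $\binom{a}{b}=\prod_{i=1}^m\binom{a_i}{b_i}$ and $x^{(c)}=0$ if $c_i\ge p^{n_i}$ for some $i$. Let $\varepsilon_i=(\delta_{i,1},\ldots,\delta_{i,m})$, and let $\partial_i$ be the derivation of $\mathcal{O}(m;\underline{n})$ with $\partial_i(x^{(a)})=x^{(a-\varepsilon_i)}$ (which is $0$ if $a_i=0$). The generalized Jacobson-Witt algebra is $W(m;\underline{n})=\sum_{i=1}^m\mathcal{O}(m;\underline{n})\partial_i$, with the commutator bracket of derivations. Put $\sigma(i)=1$ and $i'=i+r$ for $1\le i\le r$, and $\sigma(i)=-1$ and $i'=i-r$ for $r+1\le i\le 2r$. Define the linear map $D_H\colon\mathcal{O}(2r;\underline{n})\to W(2r;\underline{n})$ by $D_H(x^{(a)})=\sum_{i=1}^{2r}\sigma(i)\,\partial_i(x^{(a)})\,\partial_{i'}$. Let $\tau(\underline{n})=(p^{n_1}-1,\ldots,p^{n_m}-1)$. The Hamiltonian algebra is $$H(2r;\underline{n})^{(2)}=\mathrm{span}\{D_H(x^{(a)}) : 0<a<\tau(\underline{n})\},$$ where $0<a<\tau(\underline{n})$ means $0\le a_i\le p^{n_i}-1$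 for all $i$, with $a\ne 0$ and $a\neq\tau(\underline{n})$. It is a Lie subalgebra of $W(2r;\underline{n})$ of dimension $p^{|\underline{n}|}-2$, with bracket $[D_H(x^{(a)}),D_H(x^{(b)})]=D_H\big(D_H(x^{(a)})(x^{(b)})\big)$. The case needed here is $p=3$, $r=1$, $\underline{n}=(1,n)$. *)

theory Defs
  imports "HOL-Analysis.Analysis" "HOL-Algebra.Algebraic_Closure_Type"
begin

section \<open>Lie algebras over a field\<close>

text \<open>
  The ground field is a type \<^typ>\<open>'f\<close> of class \<^class>\<open>field\<close>; \<^const>\<open>ring_of_type_algebra\<close>
  is the corresponding HOL-Algebra ring. Underlying vector spaces are HOL-Algebra modules over
  it. The ring multiplication and unit that the record type \<^typ>\<open>('f, 'v) module\<close> inherits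
  play no role for modules and are left \<^const>\<open>undefined\<close>.
\<close>

record ('f, 'v) lie_algebra = "('f, 'v) module" +
  lie_bracket :: "'v \<Rightarrow> 'v \<Rightarrow> 'v" (\<open>\<lbrakk>_, _\<rbrakk>\<index>\<close>)

locale lie_algebra = Module.module "ring_of_type_algebra :: 'f::field ring" L
  for L :: "('f::field, 'v, 'm) lie_algebra_scheme" (structure) +
  assumes bracket_closed:
      "\<lbrakk>x \<in> carrier L; y \<in> carrier L\<rbrakk> \<Longrightarrow> \<lbrakk>x, y\<rbrakk> \<in> carrier L"
    and bracket_add_left:
      "\<lbrakk>x \<in> carrier L; y \<in> carrier L; z \<in> carrier L\<rbrakk> \<Longrightarrow> \<lbrakk>x \<oplus> y, z\<rbrakk> = \<lbrakk>x, z\<rbrakk> \<oplus> \<lbrakk>y, z\<rbrakk>"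
    and bracket_add_right:
      "\<lbrakk>x \<in> carrier L; y \<in> carrier L; z \<in> carrier L\<rbrakk> \<Longrightarrow> \<lbrakk>x, y \<oplus> z\<rbrakk> = \<lbrakk>x, y\<rbrakk> \<oplus> \<lbrakk>x, z\<rbrakk>"
    and bracket_smult_left:
      "\<lbrakk>x \<in> carrier L; y \<in> carrier L\<rbrakk> \<Longrightarrow> \<lbrakk>c \<odot> x, y\<rbrakk> = c \<odot> \<lbrakk>x, y\<rbrakk>"
    and bracket_smult_right:
      "\<lbrakk>x \<in> carrier L; y \<in> carrier L\<rbrakk> \<Longrightarrow> \<lbrakk>x, c \<odot> y\<rbrakk> = c \<odot> \<lbrakk>x, y\<rbrakk>"
    and bracket_alternating:
      "x \<in> carrier L \<Longrightarrow> \<lbrakk>x, x\<rbrakk> = \<zero>"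
    and jacobi:
      "\<lbrakk>x \<in> carrier L; y \<in> carrier L; z \<in> carrier L\<rbrakk> \<Longrightarrow>
        \<lbrakk>x, \<lbrakk>y, z\<rbrakk>\<rbrakk> \<oplus> \<lbrakk>y, \<lbrakk>z, x\<rbrakk>\<rbrakk> \<oplus> \<lbrakk>z, \<lbrakk>x, y\<rbrakk>\<rbrakk> = \<zero>"

definition lie_hom ::
  "('f::field, 'v, 'm) lie_algebra_scheme \<Rightarrow> ('f, 'w, 'k) lie_algebra_scheme \<Rightarrow> ('v \<Rightarrow> 'w) set"
  where "lie_hom L M = {\<phi> \<in> carrier L \<rightarrow> carrier M.
    (\<forall>x\<in>carrier L. \<forall>y\<in>carrier L. \<phi> (x \<oplus>\<^bsub>L\<^esub> y) = \<phi> x \<oplus>\<^bsub>M\<^esub> \<phi> y) \<and>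
    (\<forall>c. \<forall>x\<in>carrier L. \<phi> (c \<odot>\<^bsub>L\<^esub> x) = c \<odot>\<^bsub>M\<^esub> \<phi> x) \<and>
    (\<forall>x\<in>carrier L. \<forall>y\<in>carrier L. \<phi> (\<lbrakk>x, y\<rbrakk>\<^bsub>L\<^esub>) = \<lbrakk>\<phi> x, \<phi> y\<rbrakk>\<^bsub>M\<^esub>)}"

definition lie_isomorphic ::
  "('f::field, 'v, 'm) lie_algebra_scheme \<Rightarrow> ('f, 'w, 'k) lie_algebra_scheme \<Rightarrow> bool"
  where "lie_isomorphic L M \<longleftrightarrow> lie_algebra L \<and> lie_algebra M \<and>
    (\<exists>\<phi> \<in> lie_hom L M. bij_betw \<phi> (carrier L) (carrier M))"


section \<open>Derivations and outer derivations\<close>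

text \<open>
  Operators on a module are functions on its carrier made extensional by \<^const>\<open>restrict\<close>,
  so that equality of operators is equality of functions.
\<close>

definition general_linear ::
  "('f::field, 'v, 'm) module_scheme \<Rightarrow> ('f, 'v \<Rightarrow> 'v) lie_algebra"
  where "general_linear M = \<lparr>
    carrier = {D \<in> carrier M \<rightarrow>\<^sub>E carrier M.
      (\<forall>x\<in>carrier M. \<forall>y\<in>carrier M. D (x \<oplus>\<^bsub>M\<^esub> y) = D x \<oplus>\<^bsub>M\<^esub> D y) \<and>
      (\<forall>c. \<forall>x\<in>carrier M. D (c \<odot>\<^bsub>M\<^esub> x) = c \<odot>\<^bsub>M\<^esub> D x)},
    mult = undefined,
    one = undefined,
    zero = (\<lambda>x\<in>carrier M. \<zero>\<^bsub>M\<^esub>),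
    add = (\<lambda>D E. \<lambda>x\<in>carrier M. D x \<oplus>\<^bsub>M\<^esub> E x),
    smult = (\<lambda>c D. \<lambda>x\<in>carrier M. c \<odot>\<^bsub>M\<^esub> D x),
    lie_bracket = (\<lambda>D E. \<lambda>x\<in>carrier M. D (E x) \<ominus>\<^bsub>M\<^esub> E (D x))\<rparr>"

definition Der :: "('f::field, 'v, 'm) lie_algebra_scheme \<Rightarrow> ('f, 'v \<Rightarrow> 'v) lie_algebra"
  where "Der L = (general_linear L)\<lparr>carrier := {D \<in> carrier (general_linear L).
    \<forall>x\<in>carrier L. \<forall>y\<in>carrier L. D (\<lbrakk>x, y\<rbrakk>\<^bsub>L\<^esub>) = \<lbrakk>D x, y\<rbrakk>\<^bsub>L\<^esub> \<oplus>\<^bsub>L\<^esub> \<lbrakk>x, D y\<rbrakk>\<^bsub>L\<^esub>}\<rparr>"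

definition ad :: "('f::field, 'v, 'm) lie_algebra_scheme \<Rightarrow> 'v \<Rightarrow> ('v \<Rightarrow> 'v)"
  where "ad L x = (\<lambda>y\<in>carrier L. \<lbrakk>x, y\<rbrakk>\<^bsub>L\<^esub>)"

definition lie_quotient ::
  "('f::field, 'v, 'm) lie_algebra_scheme \<Rightarrow> 'v set \<Rightarrow> ('f, 'v set) lie_algebra"
  where "lie_quotient L I = \<lparr>
    carrier = a_rcosets\<^bsub>L\<^esub> I,
    mult = undefined,
    one = undefined,
    zero = I,
    add = set_add L,
    smult = (\<lambda>c A. \<Union>x\<in>A. I +>\<^bsub>L\<^esub> (c \<odot>\<^bsub>L\<^esub> x)),
    lie_bracket = (\<lambda>A B. \<Union>x\<in>A. \<Union>y\<in>B. I +>\<^bsub>L\<^esub> \<lbrakk>x, y\<rbrakk>\<^bsub>L\<^esub>)\<rparr>"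

definition Out :: "('f::field, 'v, 'm) lie_algebra_scheme \<Rightarrow> ('f, ('v \<Rightarrow> 'v) set) lie_algebra"
  where "Out L = lie_quotient (Der L) (ad L ` carrier L)"


section \<open>Direct sums, semidirect products, and the classical examples\<close>

definition lie_direct_sum ::
  "('f::field, 'v, 'm) lie_algebra_scheme \<Rightarrow> ('f, 'w, 'k) lie_algebra_scheme \<Rightarrow>
    ('f, 'v \<times> 'w) lie_algebra"
  where "lie_direct_sum L M = \<lparr>
    carrier = carrier L \<times> carrier M,
    mult = undefined,
    one = undefined,
    zero = (\<zero>\<^bsub>L\<^esub>, \<zero>\<^bsub>M\<^esub>),
    add = (\<lambda>(x, v) (y, w). (x \<oplus>\<^bsub>L\<^esub> y, v \<oplus>\<^bsub>M\<^esub> w)),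
    smult = (\<lambda>c (x, v). (c \<odot>\<^bsub>L\<^esub> x, c \<odot>\<^bsub>M\<^esub> v)),
    lie_bracket = (\<lambda>(x, v) (y, w). (\<lbrakk>x, y\<rbrakk>\<^bsub>L\<^esub>, \<lbrakk>v, w\<rbrakk>\<^bsub>M\<^esub>))\<rparr>"

text \<open>
  The semidirect product of a Lie algebra with a module on which it acts by \<open>\<rho>\<close>,
  the module being regarded as an abelian ideal.
\<close>

definition lie_semidirect ::
  "('f::field, 'v, 'm) lie_algebra_scheme \<Rightarrow> ('v \<Rightarrow> 'w \<Rightarrow> 'w) \<Rightarrow> ('f, 'w, 'k) module_scheme \<Rightarrow>
    ('f, 'v \<times> 'w) lie_algebra"
  where "lie_semidirect L \<rho> V = \<lparr>
    carrier = carrier L \<times> carrier V,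
    mult = undefined,
    one = undefined,
    zero = (\<zero>\<^bsub>L\<^esub>, \<zero>\<^bsub>V\<^esub>),
    add = (\<lambda>(x, v) (y, w). (x \<oplus>\<^bsub>L\<^esub> y, v \<oplus>\<^bsub>V\<^esub> w)),
    smult = (\<lambda>c (x, v). (c \<odot>\<^bsub>L\<^esub> x, c \<odot>\<^bsub>V\<^esub> v)),
    lie_bracket = (\<lambda>(x, v) (y, w). (\<lbrakk>x, y\<rbrakk>\<^bsub>L\<^esub>, \<rho> x w \<ominus>\<^bsub>V\<^esub> \<rho> y v))\<rparr>"

definition special_linear :: "('f::field, 'f ^ 'n ^ 'n) lie_algebra"
  where "special_linear = \<lparr>
    carrier = {A. trace A = 0},
    mult = undefined,
    one = undefined,
    zero = 0,
    add = (+),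
    smult = (\<lambda>c A. \<chi> i j. c * A $ i $ j),
    lie_bracket = (\<lambda>A B. A ** B - B ** A)\<rparr>"

definition column_space :: "('f::field, 'f ^ 'n) module"
  where "column_space = \<lparr>
    carrier = UNIV,
    mult = undefined,
    one = undefined,
    zero = 0,
    add = (+),
    smult = (*s)\<rparr>"

definition sl2_semidirect_V2 :: "('f::field, ('f ^ 2 ^ 2) \<times> ('f ^ 2)) lie_algebra"
  where "sl2_semidirect_V2 = lie_semidirect special_linear (*v) column_space"

text \<open>The abelian Lie algebra of dimension \<open>k\<close>, on the vectors \<open>(v 0, \<dots>, v (k - 1))\<close>.\<close>

definition abelian_lie_algebra :: "nat \<Rightarrow> ('f::field, nat \<Rightarrow> 'f) lie_algebra"
  where "abelian_lie_algebra k = \<lparr>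
    carrier = {v. \<forall>i\<ge>k. v i = 0},
    mult = undefined,
    one = undefined,
    zero = (\<lambda>_. 0),
    add = (\<lambda>v w i. v i + w i),
    smult = (\<lambda>c v i. c * v i),
    lie_bracket = (\<lambda>v w i. 0)\<rparr>"


section \<open>Divided power algebras\<close>

text \<open>
  Multi-indices are functions on \<^typ>\<open>nat\<close> that vanish outside \<open>{1..m}\<close>. An element of the
  divided power algebra is its family of coefficients with respect to the basis of the
  \<open>x^(a)\<close>, a function on multi-indices that vanishes outside \<open>dp_index p m n\<close>. The prime \<open>p\<close>
  is the characteristic of the coefficient type.
\<close>

definition dp_index :: "nat \<Rightarrow> nat \<Rightarrow> (nat \<Rightarrow> nat) \<Rightarrow> (nat \<Rightarrow> nat) set"
  where "dp_index p m n =
    {a. (\<forall>i\<in>{1..m}. a i < p ^ n i) \<and> (\<forall>i. i \<notin> {1..m} \<longrightarrow> a i = 0)}"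

definition dp_monomial :: "nat \<Rightarrow> (nat \<Rightarrow> nat) \<Rightarrow> (nat \<Rightarrow> nat) \<Rightarrow> ((nat \<Rightarrow> nat) \<Rightarrow> 'f::field)"
  where "dp_monomial m n a = (\<lambda>b. if a \<in> dp_index CHAR('f) m n \<and> b = a then 1 else 0)"

definition divided_power_algebra ::
  "nat \<Rightarrow> (nat \<Rightarrow> nat) \<Rightarrow> ('f::field, (nat \<Rightarrow> nat) \<Rightarrow> 'f) module"
  where "divided_power_algebra m n = \<lparr>
    carrier = {f. \<forall>a. a \<notin> dp_index CHAR('f) m n \<longrightarrow> f a = 0},
    mult = (\<lambda>f g c. if c \<in> dp_index CHAR('f) m n
      then \<Sum>(a, b) \<in> {(a, b). a \<in> dp_index CHAR('f) m n \<and> b \<in> dp_index CHAR('f) m n \<and>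
                             (\<lambda>i. a i + b i) = c}.
             of_nat (\<Prod>i=1..m. (a i + b i) choose b i) * (f a * g b)
      else 0),
    one = dp_monomial m n (\<lambda>_. 0),
    zero = (\<lambda>_. 0),
    add = (\<lambda>f g a. f a + g a),
    smult = (\<lambda>c f a. c * f a)\<rparr>"

text \<open>The coefficient of \<open>x^(a)\<close> in \<open>\<partial>_i f\<close> is the coefficient of \<open>x^(a + \<epsilon>_i)\<close> in \<open>f\<close>.\<close>

definition dp_partial ::
  "nat \<Rightarrow> ((nat \<Rightarrow> nat) \<Rightarrow> 'f::field) \<Rightarrow> ((nat \<Rightarrow> nat) \<Rightarrow> 'f)"
  where "dp_partial i f = (\<lambda>a. f (a(i := a i + 1)))"

lemma finite_dp_index: "finite (dp_index p m n)"
proof (rule finite_subset)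
  show "dp_index p m n \<subseteq>
      {a. \<forall>i. (i \<in> {1..m} \<longrightarrow> a i \<in> (\<Union>i\<in>{1..m}. {..<p ^ n i})) \<and> (i \<notin> {1..m} \<longrightarrow> a i = 0)}"
    unfolding dp_index_def by blast
qed (rule finite_set_of_finite_funs; simp)

lemma dp_monomial_mult:
  assumes "a \<in> dp_index CHAR('f::field) m n" and "b \<in> dp_index CHAR('f) m n"
  shows "dp_monomial m n a \<otimes>\<^bsub>divided_power_algebra m n\<^esub> dp_monomial m n b =
    of_nat (\<Prod>i=1..m. (a i + b i) choose b i) \<odot>\<^bsub>divided_power_algebra m n\<^esub>
      (dp_monomial m n (\<lambda>i. a i + b i) :: (nat \<Rightarrow> nat) \<Rightarrow> 'f)"
proof
  fix c
  let ?I = "dp_index CHAR('f) m n"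
  let ?S = "{(a', b'). a' \<in> ?I \<and> b' \<in> ?I \<and> (\<lambda>i. a' i + b' i) = c}"
  have fin: "finite ?S"
    by (rule finite_subset[of _ "?I \<times> ?I"]) (auto simp: finite_dp_index)
  have "(\<Sum>(a', b')\<in>?S. of_nat (\<Prod>i=1..m. (a' i + b' i) choose b' i) *
          ((dp_monomial m n a a' :: 'f) * dp_monomial m n b b')) =
        (\<Sum>x\<in>?S. if x = (a, b) then of_nat (\<Prod>i=1..m. (a i + b i) choose b i) else 0)"
    using assms by (intro sum.cong) (auto simp: dp_monomial_def split: if_splits)
  also have "\<dots> = (if (a, b) \<in> ?S then of_nat (\<Prod>i=1..m. (a i + b i) choose b i) else 0)"
    using fin by simp
  finally show "(dp_monomial m n a \<otimes>\<^bsub>divided_power_algebra m n\<^esub> dp_monomial m n b) c =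
    (of_nat (\<Prod>i=1..m. (a i + b i) choose b i) \<odot>\<^bsub>divided_power_algebra m n\<^esub>
      (dp_monomial m n (\<lambda>i. a i + b i) :: (nat \<Rightarrow> nat) \<Rightarrow> 'f)) c"
    using assms by (auto simp: divided_power_algebra_def dp_monomial_def)
qed

lemma dp_partial_monomial:
  assumes "a \<in> dp_index CHAR('f::field) m n" and "i \<in> {1..m}"
  shows "dp_partial i (dp_monomial m n a :: (nat \<Rightarrow> nat) \<Rightarrow> 'f) =
    (if a i = 0 then (\<lambda>_. 0) else dp_monomial m n (a(i := a i - 1)))"
proof
  fix b
  have "a(i := a i - 1) \<in> dp_index CHAR('f) m n"
    using assms by (auto simp: dp_index_def less_imp_diff_less)
  moreover have "b(i := b i + 1) = a \<longleftrightarrow> a i \<noteq> 0 \<and> b = a(i := a i - 1)"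
    by (auto simp: fun_eq_iff)
  ultimately show "dp_partial i (dp_monomial m n a :: (nat \<Rightarrow> nat) \<Rightarrow> 'f) b =
    (if a i = 0 then (\<lambda>_. 0) else dp_monomial m n (a(i := a i - 1))) b"
    using assms by (auto simp: dp_partial_def dp_monomial_def)
qed


section \<open>Jacobson-Witt and Hamiltonian algebras\<close>

definition jacobson_witt ::
  "nat \<Rightarrow> (nat \<Rightarrow> nat) \<Rightarrow> ('f::field, ((nat \<Rightarrow> nat) \<Rightarrow> 'f) \<Rightarrow> ((nat \<Rightarrow> nat) \<Rightarrow> 'f)) lie_algebra"
  where "jacobson_witt m n = (let A = divided_power_algebra m n in
    (general_linear A)\<lparr>carrier :=
      {\<lambda>g\<in>carrier A. \<Oplus>\<^bsub>A\<^esub>i\<in>{1..m}. u i \<otimes>\<^bsub>A\<^esub> dp_partial i g | u. u \<in> {1..m} \<rightarrow> carrier A}\<rparr>)"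

definition ham_sign :: "nat \<Rightarrow> nat \<Rightarrow> 'f::field"
  where "ham_sign r i = (if i \<le> r then 1 else - 1)"

definition ham_conj :: "nat \<Rightarrow> nat \<Rightarrow> nat"
  where "ham_conj r i = (if i \<le> r then i + r else i - r)"

definition D_H ::
  "nat \<Rightarrow> (nat \<Rightarrow> nat) \<Rightarrow> ((nat \<Rightarrow> nat) \<Rightarrow> 'f::field) \<Rightarrow>
    (((nat \<Rightarrow> nat) \<Rightarrow> 'f) \<Rightarrow> ((nat \<Rightarrow> nat) \<Rightarrow> 'f))"
  where "D_H r n f = (let A = divided_power_algebra (2 * r) n in
    (\<lambda>g\<in>carrier A. \<Oplus>\<^bsub>A\<^esub>i\<in>{1..2 * r}.
      ham_sign r i \<odot>\<^bsub>A\<^esub> (dp_partial i f \<otimes>\<^bsub>A\<^esub> dp_partial (ham_conj r i) g)))"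

text \<open>
  The Lie algebra \<open>H(2r; n)^(2)\<close>: the linear span is the least submodule of the Jacobson-Witt
  algebra that contains the given elements, and \<open>\<tau>(n) = (p^n_1 - 1, \<dots>, p^n_m - 1)\<close> is the
  largest multi-index.
\<close>

definition dp_top :: "nat \<Rightarrow> nat \<Rightarrow> (nat \<Rightarrow> nat) \<Rightarrow> (nat \<Rightarrow> nat)"
  where "dp_top p m n = (\<lambda>i. if i \<in> {1..m} then p ^ n i - 1 else 0)"

definition hamiltonian ::
  "nat \<Rightarrow> (nat \<Rightarrow> nat) \<Rightarrow> ('f::field, ((nat \<Rightarrow> nat) \<Rightarrow> 'f) \<Rightarrow> ((nat \<Rightarrow> nat) \<Rightarrow> 'f)) lie_algebra"
  where "hamiltonian r n = (jacobson_witt (2 * r) n)\<lparr>carrier :=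
    (\<lambda>U. submodule U (ring_of_type_algebra :: 'f ring) (jacobson_witt (2 * r) n)) hull
      {D_H r n (dp_monomial (2 * r) n a) | a.
        a \<in> dp_index CHAR('f) (2 * r) n - {\<lambda>_. 0, dp_top CHAR('f) (2 * r) n}}\<rparr>"

end

theory Submission
  imports Defs "HOL-Algebra.Exponent"
begin

text \<open>
  Write a Hamiltonian function as \<open>f0 + f1 x + f2 x^(2)\<close> with \<open>fi\<close> in the divided powers of \<open>y\<close>.
  In characteristic 3 the Poisson bracket is symmetric in \<open>\<partial>f0\<close> and \<open>f2\<close>: the Hamiltonian algebra
  is \<open>W(1;n) \<oplus> V \<otimes> \<partial>O(1;n)\<close>, where \<open>V\<close> is the natural module of \<open>sl2\<close> and two elements of the
  second summand are multiplied by the symplectic form of \<open>V\<close>. This exhibits the outer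
  derivations: \<open>sl2\<close> acts on \<open>V\<close>, the missing elements \<open>V \<otimes> y^(3^n - 1)\<close> act by brackets, and
  the powers \<open>\<partial>^(3^i)\<close> with \<open>0 < i < n\<close> act on coefficients.

  Conversely, let \<open>D\<close> be a derivation. Subtracting brackets and an element of \<open>sl2\<close> makes \<open>D\<close>
  vanish on \<open>\<partial>\<close>, \<open>y \<partial>\<close> and \<open>V\<close>, in this order. If \<open>D\<close> vanishes in degrees below \<open>m\<close>, then
  \<open>D (y^(m) \<partial>)\<close> is constant, since \<open>D\<close> commutes with \<open>\<partial>\<close>. If \<open>m\<close> is a power of 3, then it is a multiple
  of \<open>\<partial>\<close>, since \<open>D\<close> preserves the eigenspaces of \<open>y \<partial>\<close>, and is removed by subtracting a multiple
  of \<open>\<partial>^m\<close>. Otherwise it vanishes: if \<open>m \<equiv> 1\<close> modulo 3, no constant has the eigenvalue of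
  \<open>y^(m) \<partial>\<close>; in the remaining cases some \<open>m choose i\<close> with \<open>2 \<le> i \<le> m - 2\<close> is prime to 3, so that
  \<open>y^(m) \<partial>\<close> is a multiple of a bracket of \<open>V \<otimes> y^(i)\<close> with \<open>V \<otimes> y^(m - i)\<close>.
\<close>

section \<open>Divided power series\<close>

text \<open>The symmetry has a geometric reading. Under w \<partial> the component f1 transforms as
  a vector field, while \<partial>f0 and f2 transform as 1-forms, a going to \<partial>(w a). A
  product of two 1-forms has density weight 2, a vector field has weight -1, and these agree modulo
  3. The outer components run through the exact forms; y^(3^n - 1) spans a complement of these in
  all forms, and this is where V(2) comes from. It commutes with the other outer summand F^(n-1)
  modulo inner derivations because powers of \<partial> send y^(3^n - 1) to exact forms. Likewise
  two elements outside the algebra already have their bracket inside it, so V(2) is abelian. The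
  powers \<partial>^(3^i) lie strictly between \<partial>, which is inner, and \<partial>^(3^n),
  which is zero. That the degrees 3^i are special is forced: \<partial>^(3^i) is a derivation that
  kills everything of lower degree but not y^(3^i) \<partial>, so this element is not generated from
  below.\<close>

text \<open>
  The series \<open>\<Sum>k. f k y^(k)\<close> in the divided powers of one variable. The product is fixed by
  the constant coefficients and the Leibniz rule for the shift, so ring identities are proved
  by induction on the coefficient.
\<close>

typedef 'a dps = "UNIV :: (nat \<Rightarrow> 'a) set"
  morphisms dps_nth Abs_dps by simp

setup_lifting type_definition_dps

lemma dps_eqI: "(\<And>k. dps_nth f k = dps_nth g k) \<Longrightarrow> f = g"
  by (simp add: dps_nth_inject[symmetric] fun_eq_iff)

lemma dps_nth_Abs [simp]: "dps_nth (Abs_dps f) k = f k"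
  by (simp add: Abs_dps_inverse)

instantiation dps :: (comm_ring_1) "{zero, one, plus, minus, uminus, times}"
begin
lift_definition zero_dps :: "'a dps" is "\<lambda>_. 0" .
lift_definition one_dps :: "'a dps" is "\<lambda>k. if k = 0 then 1 else 0" .
lift_definition plus_dps :: "'a dps \<Rightarrow> 'a dps \<Rightarrow> 'a dps" is "\<lambda>f g k. f k + g k" .
lift_definition minus_dps :: "'a dps \<Rightarrow> 'a dps \<Rightarrow> 'a dps" is "\<lambda>f g k. f k - g k" .
lift_definition uminus_dps :: "'a dps \<Rightarrow> 'a dps" is "\<lambda>f k. - f k" .
lift_definition times_dps :: "'a dps \<Rightarrow> 'a dps \<Rightarrow> 'a dps"
  is "\<lambda>f g k. \<Sum>i\<le>k. of_nat (k choose i) * (f i * g (k - i))" .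
instance ..
end

lift_definition dps_deriv :: "'a dps \<Rightarrow> 'a dps" is "\<lambda>f k. f (Suc k)" .

lemmas dps_nth_simps [simp] =
  zero_dps.rep_eq one_dps.rep_eq plus_dps.rep_eq minus_dps.rep_eq uminus_dps.rep_eq
  dps_deriv.rep_eq

lemma dps_nth_deriv_funpow [simp]: "dps_nth ((dps_deriv ^^ j) f) k = dps_nth f (k + j)"
  by (induction j arbitrary: k) simp_all

lemma dps_deriv_add: "dps_deriv (f + g) = dps_deriv f + dps_deriv g"
  by (rule dps_eqI) simp

lemma dps_deriv_diff: "dps_deriv (f - g) = dps_deriv f - dps_deriv g"
  by (rule dps_eqI) simp

lemma dps_deriv_minus: "dps_deriv (- f) = - dps_deriv f"
  by (rule dps_eqI) simp

lemma dps_deriv_zero [simp]: "dps_deriv 0 = 0"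
  by (rule dps_eqI) simp

lemma dps_deriv_one [simp]: "dps_deriv 1 = 0"
  by (rule dps_eqI) simp

lemma dps_nth_mult_0 [simp]: "dps_nth (f * g) 0 = dps_nth f 0 * dps_nth g 0"
  by (simp add: times_dps.rep_eq)

text \<open>Pascal's rule splits each binomial coefficient: the terms with \<open>k choose i\<close>
  are those in which \<open>f\<close> is shifted, the terms with \<open>k choose Suc i\<close> those
  in which \<open>g\<close> is.\<close>

lemma dps_nth_mult_Suc:
  "dps_nth (f * g) (Suc k) = dps_nth (dps_deriv f * g) k + dps_nth (f * dps_deriv g) k"
proof -
  let ?t = "\<lambda>i. dps_nth f i * dps_nth g (Suc k - i)"
  have "dps_nth (f * g) (Suc k) = ?t 0 + (\<Sum>i\<le>k. of_nat (Suc k choose Suc i) * ?t (Suc i))"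
    by (simp add: times_dps.rep_eq sum.atMost_Suc_shift del: sum.atMost_Suc)
  also have "\<dots> = (\<Sum>i\<le>k. of_nat (k choose i) * ?t (Suc i))
      + (?t 0 + (\<Sum>i\<le>k. of_nat (k choose Suc i) * ?t (Suc i)))"
    by (simp add: distrib_right sum.distrib algebra_simps)
  also have "?t 0 + (\<Sum>i\<le>k. of_nat (k choose Suc i) * ?t (Suc i)) =
      (\<Sum>i\<le>Suc k. of_nat (k choose i) * ?t i)"
    by (simp add: sum.atMost_Suc_shift del: sum.atMost_Suc)
  also have "\<dots> = (\<Sum>i\<le>k. of_nat (k choose i) * ?t i)"
    by (simp add: binomial_eq_0)
  also have "\<dots> = dps_nth (f * dps_deriv g) k"
    by (simp add: times_dps.rep_eq Suc_diff_le)
  also have "(\<Sum>i\<le>k. of_nat (k choose i) * ?t (Suc i)) = dps_nth (dps_deriv f * g) k"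
    by (simp add: times_dps.rep_eq)
  finally show ?thesis .
qed

lemma dps_deriv_mult: "dps_deriv (f * g) = dps_deriv f * g + f * dps_deriv g"
  by (rule dps_eqI) (simp add: dps_nth_mult_Suc)

instance dps :: (comm_ring_1) comm_ring_1
proof
  fix f g h :: "'a dps"
  have comm: "dps_nth (f * g) k = dps_nth (g * f) k" for k and f g :: "'a dps"
    by (induction k arbitrary: f g) (simp_all add: dps_nth_mult_Suc ac_simps)
  have distr: "dps_nth ((f + g) * h) k = dps_nth (f * h) k + dps_nth (g * h) k"
    for k and f g h :: "'a dps"
    by (simp add: times_dps.rep_eq algebra_simps sum.distrib)
  have distr': "dps_nth (h * (f + g)) k = dps_nth (h * f) k + dps_nth (h * g) k"
    for k and f g h :: "'a dps"
    by (simp add: times_dps.rep_eq algebra_simps sum.distrib)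
  have assoc: "dps_nth (f * g * h) k = dps_nth (f * (g * h)) k" for k and f g h :: "'a dps"
    by (induction k arbitrary: f g h)
      (simp_all add: dps_nth_mult_Suc dps_deriv_mult distr distr' ac_simps)
  have one: "dps_nth (1 * f) k = dps_nth f k" for k and f :: "'a dps"
  proof (induction k arbitrary: f)
    case (Suc k)
    have "dps_nth (0 * f) k = 0" for f :: "'a dps"
      by (simp add: times_dps.rep_eq)
    with Suc show ?case by (simp add: dps_nth_mult_Suc)
  qed simp
  show "f * g * h = f * (g * h)" by (rule dps_eqI) (rule assoc)
  show "f * g = g * f" by (rule dps_eqI) (rule comm)
  show "1 * f = f" by (rule dps_eqI) (rule one)
  show "(f + g) * h = f * h + g * h" by (rule dps_eqI) (simp add: distr)
  show "(0::'a dps) \<noteq> 1"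
    by (auto dest: arg_cong[where f = "\<lambda>f. dps_nth f 0"])
qed (auto intro!: dps_eqI)

definition dps_const :: "'a::comm_ring_1 \<Rightarrow> 'a dps"
  where "dps_const c = Abs_dps (\<lambda>k. if k = 0 then c else 0)"

definition dps_X :: "nat \<Rightarrow> 'a::comm_ring_1 dps"
  where "dps_X k = Abs_dps (\<lambda>i. if i = k then 1 else 0)"

lemma dps_nth_const [simp]: "dps_nth (dps_const c) k = (if k = 0 then c else 0)"
  by (simp add: dps_const_def)

lemma dps_nth_X [simp]: "dps_nth (dps_X k) i = (if i = k then 1 else 0)"
  by (simp add: dps_X_def)

lemma dps_deriv_const [simp]: "dps_deriv (dps_const c) = 0"
  by (rule dps_eqI) simp

lemma dps_const_0 [simp]: "dps_const 0 = 0" and dps_const_1 [simp]: "dps_const 1 = 1"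
  and dps_const_add: "dps_const (a + b) = dps_const a + dps_const b"
  and dps_const_minus: "dps_const (- a) = - dps_const a"
  and dps_const_diff: "dps_const (a - b) = dps_const a - dps_const b"
  by (auto intro!: dps_eqI)

lemma dps_nth_const_mult [simp]: "dps_nth (dps_const c * f) k = c * dps_nth f k"
  by (induction k arbitrary: f) (simp_all add: dps_nth_mult_Suc)

lemma dps_const_mult: "dps_const (a * b) = dps_const a * dps_const b"
  by (rule dps_eqI) simp

lemma dps_const_of_nat: "dps_const (of_nat k) = of_nat k"
  by (induction k) (simp_all add: dps_const_add)

lemma dps_nth_of_nat_mult [simp]: "dps_nth (of_nat c * f) k = of_nat c * dps_nth f k"
  unfolding dps_const_of_nat[symmetric] by simp

lemma dps_deriv_const_mult: "dps_deriv (dps_const c * f) = dps_const c * dps_deriv f"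
  by (simp add: dps_deriv_mult)

lemma dps_deriv_of_nat_mult: "dps_deriv (of_nat c * f) = of_nat c * dps_deriv f"
  unfolding dps_const_of_nat[symmetric] by (rule dps_deriv_const_mult)

text \<open>In divided powers \<partial> y^(k) = y^(k - 1) carries no factor k, so the kernel
  consists of the constants even in positive characteristic.\<close>

lemma dps_deriv_eq_0_iff: "dps_deriv f = 0 \<longleftrightarrow> f = dps_const (dps_nth f 0)"
proof
  assume *: "dps_deriv f = 0"
  have "dps_nth f k = dps_nth (dps_const (dps_nth f 0)) k" for k
    using arg_cong[OF *, of "\<lambda>f. dps_nth f (k - 1)"] by (cases k) auto
  then show "f = dps_const (dps_nth f 0)" by (rule dps_eqI)
next
  assume "f = dps_const (dps_nth f 0)"
  then show "dps_deriv f = 0" by (metis dps_deriv_const)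
qed

lemma dps_X_0 [simp]: "dps_X 0 = 1"
  by (rule dps_eqI) simp

lemma dps_deriv_X [simp]: "dps_deriv (dps_X (Suc k)) = dps_X k"
  by (rule dps_eqI) simp

lemma dps_deriv_X': "k > 0 \<Longrightarrow> dps_deriv (dps_X k) = dps_X (k - 1)"
  by (cases k) auto

lemma dps_X_mult: "(dps_X i * dps_X j :: 'a::comm_ring_1 dps) = of_nat ((i + j) choose i) * dps_X (i + j)"
proof (rule dps_eqI)
  fix k
  have "dps_nth (dps_X i * dps_X j :: 'a dps) k =
    (\<Sum>l\<le>k. if l = i then of_nat (k choose l) * (if k - l = j then 1 else 0) else (0::'a))"
    unfolding times_dps.rep_eq by (intro sum.cong) auto
  also have "\<dots> = dps_nth (of_nat ((i + j) choose i) * dps_X (i + j) :: 'a dps) k"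
    by (auto simp: sum.delta)
  finally show "dps_nth (dps_X i * dps_X j :: 'a dps) k =
    dps_nth (of_nat ((i + j) choose i) * dps_X (i + j) :: 'a dps) k" .
qed

section \<open>Derivations in characteristic 3\<close>

definition derivation :: "('a::comm_ring_1 \<Rightarrow> 'a) \<Rightarrow> bool"
  where "derivation d \<longleftrightarrow>
    (\<forall>x y. d (x + y) = d x + d y) \<and> (\<forall>x y. d (x * y) = d x * y + x * d y)"

lemma derivation_add: "derivation d \<Longrightarrow> d (x + y) = d x + d y"
  and derivation_mult: "derivation d \<Longrightarrow> d (x * y) = d x * y + x * d y"
  by (simp_all add: derivation_def)

lemma derivation_dps_deriv: "derivation dps_deriv"
  by (simp add: derivation_def dps_deriv_add dps_deriv_mult)

text \<open>The mixed terms of the Leibniz rule for the third iterate have coefficient 3.\<close>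

lemma derivation_funpow_3:
  assumes "(3::'a::comm_ring_1) = 0" and d: "derivation (d :: 'a \<Rightarrow> 'a)"
  shows "derivation (d ^^ 3)"
proof -
  have "d (d (d (x * y))) = d (d (d x)) * y + x * d (d (d y))
      + (d x * d (d y) + (d x * d (d y) + d x * d (d y)))
      + (d y * d (d x) + (d y * d (d x) + d y * d (d x)))" for x y
    by (simp only: derivation_add[OF d] derivation_mult[OF d] distrib_left distrib_right ac_simps)
  then show ?thesis
    unfolding derivation_def by (simp add: numeral_3_eq_3 derivation_add[OF d] assms(1))
qed

lemma derivation_funpow_3_power:
  assumes "(3::'a::comm_ring_1) = 0" and d: "derivation (d :: 'a \<Rightarrow> 'a)"
  shows "derivation (d ^^ (3 ^ k))"
proof (induction k)
  case (Suc k)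
  have "d ^^ (3 ^ Suc k) = (d ^^ (3 ^ k)) ^^ 3"
    by (simp add: funpow_mult mult.commute)
  with derivation_funpow_3[OF assms(1) Suc] show ?case by simp
qed (use d in simp)

lemma dps_three_eq_0: "(3::'a::comm_ring_1) = 0 \<Longrightarrow> (3::'a dps) = 0"
  using dps_const_of_nat[of 3, where 'a = 'a] by simp

section \<open>The Hamiltonian algebra as a graded Lie algebra\<close>

lemmas dps_deriv_simps = dps_deriv_add dps_deriv_diff dps_deriv_minus dps_deriv_mult

text \<open>\<open>dps_below (3 ^ n)\<close> stands for O(1;n), and
  \<open>dps_below (3 ^ n - 1)\<close> is its image under \<partial>.\<close>

definition dps_below :: "nat \<Rightarrow> 'f::comm_ring_1 dps set"
  where "dps_below q = {f. \<forall>k\<ge>q. dps_nth f k = 0}"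

lemma dps_below_iff: "f \<in> dps_below q \<longleftrightarrow> (dps_deriv ^^ q) f = 0"
proof
  assume *: "(dps_deriv ^^ q) f = 0"
  have "dps_nth f k = dps_nth ((dps_deriv ^^ q) f) (k - q)" if "k \<ge> q" for k
    using that by simp
  with * show "f \<in> dps_below q" by (simp add: dps_below_def)
qed (auto simp: dps_below_def intro: dps_eqI)

lemma dps_below_zero [simp]: "0 \<in> dps_below q"
  and dps_below_add: "f \<in> dps_below q \<Longrightarrow> g \<in> dps_below q \<Longrightarrow> f + g \<in> dps_below q"
  and dps_below_diff: "f \<in> dps_below q \<Longrightarrow> g \<in> dps_below q \<Longrightarrow> f - g \<in> dps_below q"
  and dps_below_minus: "f \<in> dps_below q \<Longrightarrow> - f \<in> dps_below q"
  and dps_below_const_mult: "f \<in> dps_below q \<Longrightarrow> dps_const c * f \<in> dps_below q"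
  and dps_below_deriv: "f \<in> dps_below q \<Longrightarrow> dps_deriv f \<in> dps_below (q - 1)"
  and dps_below_deriv': "f \<in> dps_below q \<Longrightarrow> dps_deriv f \<in> dps_below q"
  and dps_below_mono: "f \<in> dps_below q \<Longrightarrow> q \<le> q' \<Longrightarrow> f \<in> dps_below q'"
  and dps_below_X: "k < q \<Longrightarrow> dps_X k \<in> dps_below q"
  and dps_below_const: "0 < q \<Longrightarrow> dps_const c \<in> dps_below q"
  by (auto simp: dps_below_def)

lemmas dps_below_intros = dps_below_add dps_below_diff dps_below_minus dps_below_const_mult
  dps_below_deriv' dps_below_const

text \<open>The set is the kernel of \<partial>^(3^n), which is a derivation in characteristic 3,
  and kernels of derivations are closed under products. Hence the untruncated product of series
  restricts to O(1;n).\<close>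

lemma dps_below_mult:
  fixes f g :: "'f::comm_ring_1 dps"
  assumes "(3::'f) = 0" and "f \<in> dps_below (3 ^ n)" "g \<in> dps_below (3 ^ n)"
  shows "f * g \<in> dps_below (3 ^ n)"
  using assms(2,3) derivation_mult[OF derivation_funpow_3_power[OF dps_three_eq_0[OF assms(1)]
        derivation_dps_deriv], of n f g]
  by (simp add: dps_below_iff)

type_synonym 'f triple = "'f dps \<times> 'f dps \<times> 'f dps"

text \<open>
  The Hamiltonian function \<open>f0 + f1 x + f2 x^(2)\<close>, where the \<open>fi\<close> are series in \<open>y\<close>, is encoded
  as \<open>(\<partial>f0, f1, f2)\<close>; its constant term is thereby dropped. In characteristic 3 the Poisson
  bracket then takes a form in which the outer components play symmetric roles.
\<close>

definition ham_bracket :: "'f::comm_ring_1 triple \<Rightarrow> 'f triple \<Rightarrow> 'f triple"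
  where "ham_bracket = (\<lambda>(a, w, b) (a', w', b').
    (dps_deriv (w * a' - a * w'),
     w * dps_deriv w' - dps_deriv w * w' + (b * a' - a * b'),
     dps_deriv (w * b' - b * w')))"

definition triple_smult :: "'f::comm_ring_1 \<Rightarrow> 'f triple \<Rightarrow> 'f triple"
  where "triple_smult c = (\<lambda>(a, w, b). (dps_const c * a, dps_const c * w, dps_const c * b))"

definition ham_carrier :: "nat \<Rightarrow> 'f::comm_ring_1 triple set"
  where "ham_carrier n = dps_below (3 ^ n - 1) \<times> dps_below (3 ^ n) \<times> dps_below (3 ^ n - 1)"

definition ham_triples :: "nat \<Rightarrow> ('f::field, 'f triple) lie_algebra"
  where "ham_triples n = \<lparr>
    carrier = ham_carrier n,
    mult = undefined,
    one = undefined,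
    zero = 0,
    add = (+),
    smult = triple_smult,
    lie_bracket = ham_bracket\<rparr>"

lemma ham_triples_simps [simp]:
  "carrier (ham_triples n) = ham_carrier n"
  "zero (ham_triples n) = 0"
  "add (ham_triples n) = (+)"
  "Module.smult (ham_triples n) = triple_smult"
  "lie_bracket (ham_triples n) = ham_bracket"
  by (simp_all add: ham_triples_def)

lemma ham_bracket_simp [simp]: "ham_bracket (a, w, b) (a', w', b') =
    (dps_deriv (w * a' - a * w'),
     w * dps_deriv w' - dps_deriv w * w' + (b * a' - a * b'),
     dps_deriv (w * b' - b * w'))"
  by (simp add: ham_bracket_def)

lemma triple_smult_simp [simp]:
  "triple_smult c (a, w, b) = (dps_const c * a, dps_const c * w, dps_const c * b)"
  by (simp add: triple_smult_def)

lemma ham_carrier_iff [simp]: "(a, w, b) \<in> ham_carrier n \<longleftrightarrow>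
    a \<in> dps_below (3 ^ n - 1) \<and> w \<in> dps_below (3 ^ n) \<and> b \<in> dps_below (3 ^ n - 1)"
  by (auto simp: ham_carrier_def)

lemma zero_triple: "(0 :: 'f::comm_ring_1 triple) = (0, 0, 0)"
  by (simp add: zero_prod_def)

lemma ham_carrier_zero [simp]: "0 \<in> ham_carrier n"
  by (simp add: zero_triple)

lemma ham_carrier_add: "x \<in> ham_carrier n \<Longrightarrow> y \<in> ham_carrier n \<Longrightarrow> x + y \<in> ham_carrier n"
  and ham_carrier_diff: "x \<in> ham_carrier n \<Longrightarrow> y \<in> ham_carrier n \<Longrightarrow> x - y \<in> ham_carrier n"
  and ham_carrier_minus: "x \<in> ham_carrier n \<Longrightarrow> - x \<in> ham_carrier n"
  and ham_carrier_smult: "x \<in> ham_carrier n \<Longrightarrow> triple_smult c x \<in> ham_carrier n"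
  by (cases x; cases y; auto intro: dps_below_intros)+

lemma ham_bracket_add_left: "ham_bracket (x + y) z = ham_bracket x z + ham_bracket y z"
  and ham_bracket_add_right: "ham_bracket x (y + z) = ham_bracket x y + ham_bracket x z"
  and ham_bracket_diff_left: "ham_bracket (x - y) z = ham_bracket x z - ham_bracket y z"
  and ham_bracket_diff_right: "ham_bracket x (y - z) = ham_bracket x y - ham_bracket x z"
  and ham_bracket_minus_right: "ham_bracket x (- y) = - ham_bracket x y"
  and ham_bracket_smult_left: "ham_bracket (triple_smult c x) y = triple_smult c (ham_bracket x y)"
  and ham_bracket_smult_right: "ham_bracket x (triple_smult c y) = triple_smult c (ham_bracket x y)"
  and ham_bracket_self: "ham_bracket x x = 0"
  and ham_bracket_zero_left [simp]: "ham_bracket 0 x = 0"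
  and ham_bracket_zero_right [simp]: "ham_bracket x 0 = 0"
  and ham_bracket_commute: "ham_bracket x y = - ham_bracket y x"
  by (cases x; cases y; cases z; simp add: dps_deriv_simps zero_triple algebra_simps)+

lemma triple_smult_add: "triple_smult c (x + y) = triple_smult c x + triple_smult c y"
  and triple_smult_diff: "triple_smult c (x - y) = triple_smult c x - triple_smult c y"
  and triple_smult_add_left: "triple_smult (c + c') x = triple_smult c x + triple_smult c' x"
  and triple_smult_assoc: "triple_smult (c * c') x = triple_smult c (triple_smult c' x)"
  and triple_smult_one: "triple_smult 1 x = x"
  and triple_smult_zero_left: "triple_smult 0 x = 0"
  and triple_smult_zero [simp]: "triple_smult c 0 = 0"
  by (cases x; cases y; simp add: dps_const_add dps_const_mult zero_triple algebra_simps)+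

text \<open>Over an arbitrary commutative ring the bracket misses the Jacobi identity by a multiple
  of 3 in the middle component. Making the defect explicit turns the identity in characteristic 3
  into a substitution.\<close>

lemma ham_bracket_jacobi_defect:
  "ham_bracket (a1, w1, b1) (ham_bracket (a2, w2, b2) (a3, w3, b3)) =
    ham_bracket (ham_bracket (a1, w1, b1) (a2, w2, b2)) (a3, w3, b3) +
    ham_bracket (a2, w2, b2) (ham_bracket (a1, w1, b1) (a3, w3, b3)) +
    (0, 3 * (dps_deriv w1 * (a2 * b3 - a3 * b2) + dps_deriv w2 * (a3 * b1 - a1 * b3)
      + dps_deriv w3 * (a1 * b2 - a2 * b1)), 0)"
  by (simp add: dps_deriv_simps algebra_simps)

lemma ham_bracket_jacobi:
  assumes "(3::'f::comm_ring_1) = 0"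
  shows "ham_bracket x (ham_bracket y z) =
    ham_bracket (ham_bracket x y) z + ham_bracket y (ham_bracket x (z :: 'f triple))"
proof -
  obtain a1 w1 b1 a2 w2 b2 a3 w3 b3 where "x = (a1, w1, b1)" "y = (a2, w2, b2)" "z = (a3, w3, b3)"
    by (metis prod_cases3)
  then show ?thesis
    using ham_bracket_jacobi_defect[of a1 w1 b1 a2 w2 b2 a3 w3 b3]
    by (simp only: dps_three_eq_0[OF assms] mult_zero_left zero_triple[symmetric] add_0_right)
qed

text \<open>The outer components may here exceed the bound of \<open>ham_carrier n\<close> by one degree.\<close>

lemma ham_bracket_closed':
  assumes "(3::'f::comm_ring_1) = 0"
    and "x \<in> dps_below (3 ^ n) \<times> dps_below (3 ^ n) \<times> dps_below (3 ^ n)"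
    and "y \<in> dps_below (3 ^ n) \<times> dps_below (3 ^ n) \<times> (dps_below (3 ^ n) :: 'f dps set)"
  shows "ham_bracket x y \<in> ham_carrier n"
  using assms(2,3)
  by (cases x; cases y) (auto intro!: dps_below_deriv dps_below_add dps_below_diff
      dps_below_mult[OF assms(1)] intro: dps_below_deriv' simp del: One_nat_def)

lemma ham_carrier_subset:
  "ham_carrier n \<subseteq> dps_below (3 ^ n) \<times> dps_below (3 ^ n) \<times> dps_below (3 ^ n)"
  by (auto simp: ham_carrier_def intro: dps_below_mono)

lemma ham_bracket_closed:
  assumes "(3::'f::comm_ring_1) = 0" and "x \<in> ham_carrier n" "y \<in> (ham_carrier n :: 'f triple set)"
  shows "ham_bracket x y \<in> ham_carrier n"
  using ham_bracket_closed'[OF assms(1)] assms(2,3) ham_carrier_subset by blast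

text \<open>Induction over linear combinations of monomials. The proof peels off the coefficients of
  the highest degree; where a component has no monomial of that degree, its coefficient is
  0.\<close>

lemma ham_carrier_induct [consumes 1, case_names zero add smult left mid right]:
  fixes x :: "'f::comm_ring_1 triple"
  assumes "x \<in> ham_carrier n" and zero: "P 0"
    and add: "\<And>x y. x \<in> ham_carrier n \<Longrightarrow> y \<in> ham_carrier n \<Longrightarrow> P x \<Longrightarrow> P y \<Longrightarrow> P (x + y)"
    and smult: "\<And>c x. x \<in> ham_carrier n \<Longrightarrow> P x \<Longrightarrow> P (triple_smult c x)"
    and left: "\<And>j. j < 3 ^ n - 1 \<Longrightarrow> P (dps_X j, 0, 0)"
    and mid: "\<And>j. j < 3 ^ n \<Longrightarrow> P (0, dps_X j, 0)"
    and right: "\<And>j. j < 3 ^ n - 1 \<Longrightarrow> P (0, 0, dps_X j)"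
  shows "P x"
proof -
  have "P x" if "x \<in> ham_carrier n" "x \<in> dps_below j \<times> dps_below j \<times> dps_below j" for j x
    using that
  proof (induction j arbitrary: x)
    case 0
    then have "x = 0" by (auto simp: dps_below_iff zero_triple)
    with zero show ?case by simp
  next
    case (Suc j)
    obtain a w b where x: "x = (a, w, b)" by (cases x)
    let ?a = "triple_smult (dps_nth a j) (dps_X j, 0, 0)"
    let ?w = "triple_smult (dps_nth w j) (0, dps_X j, 0)"
    let ?b = "triple_smult (dps_nth b j) (0, 0, dps_X j)"
    define y where "y = x - ?a - ?w - ?b"
    have in_C: "?a \<in> ham_carrier n" "?w \<in> ham_carrier n" "?b \<in> ham_carrier n"
      using Suc.prems(1) unfolding x by (auto simp: dps_below_def)
    have y_in: "y \<in> ham_carrier n" unfolding y_def by (intro ham_carrier_diff in_C Suc.prems)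
    moreover have "y \<in> dps_below j \<times> dps_below j \<times> dps_below j"
      using Suc.prems(2) by (auto simp: y_def x dps_below_def not_less_eq_eq le_Suc_eq)
    ultimately have "P y" by (rule Suc.IH)
    moreover have "P ?a"
    proof (cases "j < 3 ^ n - 1")
      case True
      then show ?thesis by (intro smult left) (simp_all add: dps_below_X)
    next
      case False
      with Suc.prems(1) have "dps_nth a j = 0" by (simp add: x dps_below_def)
      with zero show ?thesis by (simp only: triple_smult_zero_left)
    qed
    moreover have "P ?b"
    proof (cases "j < 3 ^ n - 1")
      case True
      then show ?thesis by (intro smult right) (simp_all add: dps_below_X)
    next
      case False
      with Suc.prems(1) have "dps_nth b j = 0" by (simp add: x dps_below_def)
      with zero show ?thesis by (simp only: triple_smult_zero_left)
    qed
    moreover have "P ?w"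
    proof (cases "j < 3 ^ n")
      case True
      then show ?thesis by (intro smult mid) (simp_all add: dps_below_X)
    next
      case False
      with Suc.prems(1) have "dps_nth w j = 0" by (simp add: x dps_below_def)
      with zero show ?thesis by (simp only: triple_smult_zero_left)
    qed
    moreover have "x = y + ?a + ?w + ?b" by (simp add: y_def)
    ultimately show ?case
      using in_C y_in add ham_carrier_add by metis
  qed
  then show ?thesis using assms(1) ham_carrier_subset by blast
qed

lemma lie_algebra_ham_triples:
  assumes "(3::'f::field) = 0"
  shows "lie_algebra (ham_triples n :: ('f, 'f triple) lie_algebra)"
proof -
  have "abelian_group (ham_triples n :: ('f, 'f triple) lie_algebra)"
  proof (rule abelian_groupI)
    fix x :: "'f triple" assume "x \<in> carrier (ham_triples n)"
    then show "\<exists>y\<in>carrier (ham_triples n). y \<oplus>\<^bsub>ham_triples n\<^esub> x = \<zero>\<^bsub>ham_triples n\<^esub>"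
      by (intro bexI[of _ "- x"]) (auto intro: ham_carrier_minus)
  qed (auto intro: ham_carrier_add)
  then have "Module.module (ring_of_type_algebra :: 'f ring)
      (ham_triples n :: ('f, 'f triple) lie_algebra)"
    by (intro moduleI cring_from_type_algebra)
      (auto simp: ring_of_type_algebra_def triple_smult_add triple_smult_add_left
        triple_smult_assoc triple_smult_one intro: ham_carrier_smult)
  then show ?thesis
  proof (rule lie_algebra.intro, unfold_locales)
    fix x y z :: "'f triple"
    show "\<lbrakk>x, \<lbrakk>y, z\<rbrakk>\<^bsub>ham_triples n\<^esub>\<rbrakk>\<^bsub>ham_triples n\<^esub> \<oplus>\<^bsub>ham_triples n\<^esub>
        \<lbrakk>y, \<lbrakk>z, x\<rbrakk>\<^bsub>ham_triples n\<^esub>\<rbrakk>\<^bsub>ham_triples n\<^esub> \<oplus>\<^bsub>ham_triples n\<^esub>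
        \<lbrakk>z, \<lbrakk>x, y\<rbrakk>\<^bsub>ham_triples n\<^esub>\<rbrakk>\<^bsub>ham_triples n\<^esub> = \<zero>\<^bsub>ham_triples n\<^esub>"
      using ham_bracket_jacobi[OF assms, of x y z] ham_bracket_commute[of z x]
        ham_bracket_commute[of z "ham_bracket x y"]
      by (simp add: ham_bracket_minus_right)
  qed (auto simp: ham_bracket_closed[OF assms] ham_bracket_add_left ham_bracket_add_right
      ham_bracket_smult_left ham_bracket_smult_right ham_bracket_self)
qed

section \<open>Outer derivations\<close>

text \<open>Only values on \<open>ham_carrier n\<close> are constrained, so derivations can be added
  and subtracted without \<open>restrict\<close>; extensionality comes back in
  \<open>carrier_Der\<close>.\<close>

definition ham_derivation :: "nat \<Rightarrow> ('f::field triple \<Rightarrow> 'f triple) \<Rightarrow> bool"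
  where "ham_derivation n D \<longleftrightarrow>
    (\<forall>x\<in>ham_carrier n. D x \<in> ham_carrier n) \<and>
    (\<forall>x\<in>ham_carrier n. \<forall>y\<in>ham_carrier n. D (x + y) = D x + D y) \<and>
    (\<forall>c. \<forall>x\<in>ham_carrier n. D (triple_smult c x) = triple_smult c (D x)) \<and>
    (\<forall>x\<in>ham_carrier n. \<forall>y\<in>ham_carrier n.
      D (ham_bracket x y) = ham_bracket (D x) y + ham_bracket x (D y))"

section \<open>The explicit outer derivations\<close>

definition triple_map :: "('f::comm_ring_1 dps \<Rightarrow> 'f dps) \<Rightarrow> 'f triple \<Rightarrow> 'f triple"
  where "triple_map \<delta> = (\<lambda>(a, w, b). (\<delta> a, \<delta> w, \<delta> b))"

text \<open>The matrix acts on the factor V of V \<otimes> \<partial>O(1;n), with (a, b) as a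
  column, and by 0 on W(1;n).\<close>

definition triple_act :: "'f::comm_ring_1 ^ 2 ^ 2 \<Rightarrow> 'f triple \<Rightarrow> 'f triple"
  where "triple_act A = (\<lambda>(a, w, b). (dps_const (A $ 1 $ 1) * a + dps_const (A $ 1 $ 2) * b, 0,
    dps_const (A $ 2 $ 1) * a + dps_const (A $ 2 $ 2) * b))"

text \<open>The components \<open>y^(3^n - 1)\<close> are the ones missing from \<open>ham_carrier n\<close>.\<close>

definition triple_top :: "nat \<Rightarrow> 'f::comm_ring_1 ^ 2 \<Rightarrow> 'f triple"
  where "triple_top n v =
    (dps_const (v $ 1) * dps_X (3 ^ n - 1), 0, dps_const (v $ 2) * dps_X (3 ^ n - 1))"

text \<open>The exponents are 3, ..., 3^(n - 1): \<partial> is left out because it is the bracket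
  with \<open>(0, 1, 0)\<close>, and \<partial>^(3^n) vanishes on O(1;n). Hence the shift from
  \<open>s i\<close> to \<open>3 ^ Suc i\<close>.\<close>

definition dps_frob :: "nat \<Rightarrow> (nat \<Rightarrow> 'f::comm_ring_1) \<Rightarrow> 'f dps \<Rightarrow> 'f dps"
  where "dps_frob n s f = (\<Sum>i<n - 1. dps_const (s i) * (dps_deriv ^^ (3 ^ Suc i)) f)"

definition ham_outer ::
    "nat \<Rightarrow> (('f::comm_ring_1 ^ 2 ^ 2) \<times> ('f ^ 2)) \<times> (nat \<Rightarrow> 'f) \<Rightarrow> 'f triple \<Rightarrow> 'f triple"
  where "ham_outer n = (\<lambda>((A, v), s) x.
    triple_act A x + ham_bracket (triple_top n v) x + triple_map (dps_frob n s) x)"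

lemma triple_map_simp [simp]: "triple_map \<delta> (a, w, b) = (\<delta> a, \<delta> w, \<delta> b)"
  by (simp add: triple_map_def)

lemma triple_act_simp [simp]: "triple_act A (a, w, b) =
    (dps_const (A $ 1 $ 1) * a + dps_const (A $ 1 $ 2) * b, 0,
     dps_const (A $ 2 $ 1) * a + dps_const (A $ 2 $ 2) * b)"
  by (simp add: triple_act_def)

lemma ham_bracket_e0: "ham_bracket (0, 1, 0) x = triple_map dps_deriv x"
  by (cases x) simp

lemma ham_derivationD:
  assumes "ham_derivation n D" and "x \<in> ham_carrier n"
  shows "D x \<in> ham_carrier n" and "y \<in> ham_carrier n \<Longrightarrow> D (x + y) = D x + D y"
    and "D (triple_smult c x) = triple_smult c (D x)"
    and "y \<in> ham_carrier n \<Longrightarrow> D (ham_bracket x y) = ham_bracket (D x) y + ham_bracket x (D y)"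
  using assms by (auto simp: ham_derivation_def)

lemma ham_derivation_zero: "ham_derivation n D \<Longrightarrow> D 0 = 0"
  using ham_derivationD(3)[of n D 0 0] by (simp add: triple_smult_zero_left)

lemma ham_derivation_diff:
  assumes "ham_derivation n D" "ham_derivation n E"
  shows "ham_derivation n (\<lambda>x. D x - E x)"
  using ham_derivationD[OF assms(1)] ham_derivationD[OF assms(2)]
  by (simp add: ham_derivation_def ham_carrier_diff triple_smult_diff ham_bracket_diff_left
      ham_bracket_diff_right)

text \<open>The Jacobi identity holds for all triples, and \<open>ham_bracket_closed'\<close> leaves
  room for the degree 3^n - 1. So elements just outside the algebra still act on it by
  brackets.\<close>

lemma ham_derivation_bracket:
  assumes "(3::'f::field) = 0"
    and "z \<in> dps_below (3 ^ n) \<times> dps_below (3 ^ n) \<times> (dps_below (3 ^ n) :: 'f dps set)"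
  shows "ham_derivation n (ham_bracket z)"
  using ham_bracket_closed'[OF assms] ham_carrier_subset[of n] ham_bracket_jacobi[OF assms(1), of z]
  by (auto simp: ham_derivation_def ham_bracket_add_right ham_bracket_smult_right)

text \<open>The bracket is built from products, differences and \<partial>, with all of which
  \<delta> is compatible.\<close>

lemma triple_map_bracket:
  assumes "derivation \<delta>" and "\<And>f. \<delta> (dps_deriv f) = dps_deriv (\<delta> f)"
  shows "triple_map \<delta> (ham_bracket x y) =
    ham_bracket (triple_map \<delta> x) y + ham_bracket x (triple_map \<delta> y)"
proof -
  have diff: "\<delta> (f - g) = \<delta> f - \<delta> g" for f g
    using derivation_add[OF assms(1), of "f - g" g] by (simp add: algebra_simps)
  show ?thesis
    by (cases x; cases y) (simp add: assms(2) diff derivation_add[OF assms(1)]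
        derivation_mult[OF assms(1)] dps_deriv_simps algebra_simps)
qed

lemma ham_derivation_map:
  assumes "derivation \<delta>" and "\<And>c f. \<delta> (dps_const c * f) = dps_const c * \<delta> f"
    and "\<And>f. \<delta> (dps_deriv f) = dps_deriv (\<delta> f)"
    and "\<And>q f. f \<in> dps_below q \<Longrightarrow> \<delta> f \<in> dps_below q"
  shows "ham_derivation n (triple_map \<delta>)"
  unfolding ham_derivation_def
  by (auto simp: triple_map_bracket[OF assms(1,3)] assms(2) derivation_add[OF assms(1)] assms(4)
      simp del: ham_bracket_simp)

text \<open>In dimension 2, trace 0 means preserving the symplectic form infinitesimally, and b a' -
  a b' is that form. The other components of the bracket are linear in (a, b).\<close>

lemma triple_act_bracket:
  assumes "trace A = 0"
  shows "triple_act A (ham_bracket x y) =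
    ham_bracket (triple_act A x) y + ham_bracket x (triple_act A y)"
proof -
  have "A $ 2 $ 2 = - A $ 1 $ 1"
    using assms by (simp add: trace_def sum_2 eq_neg_iff_add_eq_0 add.commute)
  then have "dps_const (A $ 2 $ 2) = - dps_const (A $ 1 $ 1)"
    by (simp add: dps_const_minus)
  then show ?thesis
    by (cases x; cases y) (simp add: dps_deriv_simps algebra_simps)
qed

lemma triple_act_add: "triple_act A (x + y) = triple_act A x + triple_act A y"
  and triple_act_smult: "triple_act A (triple_smult c x) = triple_smult c (triple_act A x)"
  by (cases x; cases y; simp add: algebra_simps)+

lemma triple_act_closed: "x \<in> ham_carrier n \<Longrightarrow> triple_act A x \<in> ham_carrier n"
  by (cases x) (auto intro: dps_below_intros)

lemma ham_derivation_act: "trace A = 0 \<Longrightarrow> ham_derivation n (triple_act A)"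
  by (auto simp: ham_derivation_def triple_act_bracket triple_act_add triple_act_smult
      simp del: triple_act_simp ham_bracket_simp intro: triple_act_closed)

lemma dps_nth_sum: "dps_nth (sum f A) k = (\<Sum>i\<in>A. dps_nth (f i) k)"
  by (induction A rule: infinite_finite_induct) auto

lemma dps_nth_frob: "dps_nth (dps_frob n s f) k = (\<Sum>i<n - 1. s i * dps_nth f (k + 3 ^ Suc i))"
  by (simp add: dps_frob_def dps_nth_sum del: power_Suc)

lemma dps_frob_add: "dps_frob n s (f + g) = dps_frob n s f + dps_frob n s g"
  and dps_frob_zero [simp]: "dps_frob n s 0 = 0"
  and dps_frob_deriv: "dps_frob n s (dps_deriv f) = dps_deriv (dps_frob n s f)"
  and dps_frob_const_mult: "dps_frob n s (dps_const c * f) = dps_const c * dps_frob n s f"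
  by (rule dps_eqI;
      simp add: dps_nth_frob distrib_left sum.distrib sum_distrib_left mult.left_commute[of c])+

lemma dps_frob_commute: "dps_frob n s (dps_frob n t f) = dps_frob n t (dps_frob n s f)"
proof (rule dps_eqI)
  fix k
  show "dps_nth (dps_frob n s (dps_frob n t f)) k = dps_nth (dps_frob n t (dps_frob n s f)) k"
    unfolding dps_nth_frob sum_distrib_left by (subst sum.swap) (simp add: algebra_simps)
qed

lemma dps_frob_below: "f \<in> dps_below q \<Longrightarrow> dps_frob n s f \<in> dps_below q"
  by (auto simp: dps_below_def dps_nth_frob intro!: sum.neutral)

lemma derivation_frob:
  assumes "(3::'f::comm_ring_1) = 0"
  shows "derivation (dps_frob n s :: 'f dps \<Rightarrow> 'f dps)"
proof -
  have "derivation (dps_deriv ^^ (3 ^ k) :: 'f dps \<Rightarrow> 'f dps)" for k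
    by (rule derivation_funpow_3_power[OF dps_three_eq_0[OF assms] derivation_dps_deriv])
  from derivation_mult[OF this] show ?thesis
    unfolding derivation_def
    by (simp add: dps_frob_add)
      (simp add: dps_frob_def algebra_simps sum.distrib sum_distrib_left del: power_Suc)
qed

lemma dps_deriv_funpow_X:
  "(dps_deriv ^^ k) (dps_X j) = (if k \<le> j then dps_X (j - k) else 0)"
  by (rule dps_eqI) auto

lemma dps_frob_single:
  assumes "i < n - 1"
  shows "dps_frob n (\<lambda>l. if l = i then c else 0) f = dps_const c * (dps_deriv ^^ (3 ^ Suc i)) f"
proof (rule dps_eqI)
  fix k
  have "(\<Sum>l<n - 1. (if l = i then c else 0) * dps_nth f (k + 3 ^ Suc l)) =
      (\<Sum>l<n - 1. if l = i then c * dps_nth f (k + 3 ^ Suc i) else 0)"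
    by (rule sum.cong) auto
  then show "dps_nth (dps_frob n (\<lambda>l. if l = i then c else 0) f) k =
      dps_nth (dps_const c * (dps_deriv ^^ (3 ^ Suc i)) f) k"
    using assms by (simp add: dps_nth_frob del: power_Suc)
qed

lemma triple_act_zero [simp]: "triple_act 0 x = 0"
  by (cases x) (simp add: zero_triple)

lemma triple_top_zero [simp]: "triple_top n 0 = 0"
  by (simp add: triple_top_def zero_triple)

lemma triple_frob_zero [simp]: "triple_map (dps_frob n (\<lambda>_. 0)) x = 0"
  by (cases x) (simp add: dps_frob_def zero_triple)

lemma dps_frob_add_left: "dps_frob n (\<lambda>i. s i + t i) f = dps_frob n s f + dps_frob n t f"
  by (simp add: dps_frob_def dps_const_add distrib_right sum.distrib del: power_Suc)

lemma ham_outer_add_left: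
  "ham_outer n ((A + A', v + v'), \<lambda>i. s i + s' i) x =
    ham_outer n ((A, v), s) x + ham_outer n ((A', v'), s') x"
  by (cases x)
    (simp add: ham_outer_def triple_top_def dps_frob_add_left dps_const_add dps_deriv_simps
      algebra_simps)

text \<open>If m = 2 modulo 3, then i = 2 works, since m (m - 1) = 2 modulo 3. If 3 divides m, write
  m = 3^k t with t prime to 3; then i = 3^k works, because by \<open>const_p_fac\<close> the
  multiplicity of 3 in \<open>m choose 3 ^ k\<close> is that in t. As m is not a power of 3, t is at
  least 2, which leaves room for i + 2 \<le> m.\<close>

lemma exists_binomial_not_dvd_3:
  fixes m :: nat
  assumes "3 \<le> m" "m mod 3 \<noteq> 1" "\<And>k. m \<noteq> 3 ^ k"
  shows "\<exists>i. 2 \<le> i \<and> i + 2 \<le> m \<and> \<not> 3 dvd m choose i"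
proof (cases "m mod 3 = 2")
  case True
  then obtain r where r: "m = 3 * r + 2" by (metis mult_div_mod_eq)
  have "even (m * (m - 1))" by (cases m) auto
  then have "2 * (m choose 2) = m * (m - 1)"
    unfolding choose_two by (rule dvd_mult_div_cancel)
  then have "3 dvd m choose 2 \<Longrightarrow> 3 dvd m * (m - 1)" by (metis dvd_mult)
  moreover have "m * (m - 1) = 3 * (3 * r * r + 3 * r) + 2"
    by (simp add: r algebra_simps)
  then have "\<not> 3 dvd m * (m - 1)" by presburger
  ultimately have "\<not> 3 dvd m choose 2" by auto
  then show ?thesis using r assms(1) by (intro exI[of _ 2]) auto
next
  case False
  with assms(2) have "3 dvd m" by presburger
  obtain t where t: "m = 3 ^ multiplicity 3 m * t" "\<not> 3 dvd t"
    using multiplicity_decompose'[of m 3] assms(1) by auto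
  define k where "k = multiplicity 3 m"
  have m: "m = 3 ^ k * t" using t(1) k_def by simp
  have "k > 0" using \<open>3 dvd m\<close> t(2) m by (cases k) auto
  then have "3 \<le> (3::nat) ^ k" by (cases k) auto
  have "t > 1"
    using assms(1) assms(3)[of k] m by (cases t rule: nat.exhaust; cases "t - 1") auto
  have "multiplicity 3 (m choose 3 ^ k) = 0"
    using const_p_fac[of t 3 k] t(2) \<open>t > 1\<close> m by (simp add: not_dvd_imp_multiplicity_0)
  moreover have "3 ^ k \<le> m" using m \<open>t > 1\<close> by simp
  ultimately have "\<not> 3 dvd m choose 3 ^ k"
    using multiplicity_eq_zero_iff[of "m choose 3 ^ k" 3] by (simp add: binomial_eq_0_iff)
  moreover have "3 ^ k + 2 \<le> m"
  proof -
    have "3 ^ k * 2 \<le> m" using m \<open>t > 1\<close> by simp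
    with \<open>3 \<le> 3 ^ k\<close> show ?thesis by linarith
  qed
  ultimately show ?thesis
    using \<open>3 \<le> 3 ^ k\<close> by (intro exI[of _ "3 ^ k"]) auto
qed

section \<open>Decomposition of an arbitrary derivation\<close>

locale ham_outer_derivations =
  fixes n :: nat and ty :: "'f::field itself"
  assumes char3: "CHAR('f) = 3" and n: "n > 1"
begin

abbreviation C :: "'f triple set" where "C \<equiv> ham_carrier n"

lemma of_nat_eq_0: "of_nat m = (0::'f) \<longleftrightarrow> 3 dvd m"
  using of_nat_eq_0_iff_char_dvd[where 'a = 'f] char3 by simp

lemma three: "(3::'f) = 0"
  using of_nat_eq_0[of 3] by simp

lemma two: "(2::'f) \<noteq> 0"
  using of_nat_eq_0[of 2] by simp

lemma nine_le: "9 \<le> (3::nat) ^ n"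
  using power_increasing[of 2 n "3::nat"] n by simp

lemma e_in [simp]: "j < 3 ^ n \<Longrightarrow> (0, dps_X j, 0) \<in> C"
  and u1_in [simp]: "j < 3 ^ n - 1 \<Longrightarrow> (dps_X j, 0, 0) \<in> C"
  and u2_in [simp]: "j < 3 ^ n - 1 \<Longrightarrow> (0, 0, dps_X j) \<in> C"
  by (simp_all add: dps_below_X)

lemma e0_in [simp]: "(0, 1, 0) \<in> C"
  using e_in[of 0] by simp

lemma const_in [simp]: "(dps_const \<alpha>, dps_const \<gamma>, dps_const \<beta>) \<in> C"
  using nine_le by (simp add: dps_below_const)

definition outer_plus_inner :: "('f triple \<Rightarrow> 'f triple) \<Rightarrow> bool"
  where "outer_plus_inner D \<longleftrightarrow> (\<exists>A v s z. trace A = 0 \<and> (\<forall>i\<ge>n - 1. s i = 0) \<and> z \<in> C \<and>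
    (\<forall>x\<in>C. D x = ham_outer n ((A, v), s) x + ham_bracket z x))"

text \<open>The form in which each normalisation is applied: \<open>G\<close> is a known derivation
  chosen so that the difference vanishes on one more element.\<close>

lemma outer_plus_inner_diff:
  assumes "outer_plus_inner (\<lambda>x. D x - G x)" and "outer_plus_inner G"
  shows "outer_plus_inner D"
proof -
  obtain A v s z where 1: "trace A = 0" "\<forall>i\<ge>n - 1. s i = 0" "z \<in> C"
    "\<And>x. x \<in> C \<Longrightarrow> D x - G x = ham_outer n ((A, v), s) x + ham_bracket z x"
    using assms(1) unfolding outer_plus_inner_def by blast
  obtain A' v' s' z' where 2: "trace A' = 0" "\<forall>i\<ge>n - 1. s' i = 0" "z' \<in> C"
    "\<And>x. x \<in> C \<Longrightarrow> G x = ham_outer n ((A', v'), s') x + ham_bracket z' x"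
    using assms(2) unfolding outer_plus_inner_def by blast
  have "D x = ham_outer n ((A + A', v + v'), \<lambda>i. s i + s' i) x + ham_bracket (z + z') x"
    if "x \<in> C" for x
  proof -
    have "D x = D x - G x + G x" by simp
    with 1(4) 2(4) that show ?thesis
      by (simp add: ham_outer_add_left ham_bracket_add_left del: diff_add_cancel)
  qed
  moreover have "trace (A + A') = 0" using 1 2 by (simp add: trace_add)
  ultimately show ?thesis
    unfolding outer_plus_inner_def using 1 2 ham_carrier_add by (metis (no_types, lifting) add_0)
qed

lemma outer_plus_inner_intro:
  assumes "trace A = 0" "\<And>i. i \<ge> n - 1 \<Longrightarrow> s i = 0" "z \<in> C"
    "\<And>x. x \<in> C \<Longrightarrow>
      D x = triple_act A x + ham_bracket (triple_top n v) x + triple_map (dps_frob n s) x + ham_bracket z x"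
  shows "outer_plus_inner D"
  unfolding outer_plus_inner_def using assms by (intro exI[of _ A] exI[of _ v] exI[of _ s] exI[of _ z])
    (simp add: ham_outer_def)

lemma outer_plus_inner_zero: "(\<And>x. x \<in> C \<Longrightarrow> D x = 0) \<Longrightarrow> outer_plus_inner D"
  by (rule outer_plus_inner_intro[of 0 "\<lambda>_. 0" 0 _ 0]) (simp_all add: trace_def)

lemma outer_plus_inner_act: "trace A = 0 \<Longrightarrow> outer_plus_inner (triple_act A)"
  by (rule outer_plus_inner_intro[of A "\<lambda>_. 0" 0 _ 0]) simp_all

lemma outer_plus_inner_frob: "(\<And>i. i \<ge> n - 1 \<Longrightarrow> s i = 0) \<Longrightarrow> outer_plus_inner (triple_map (dps_frob n s))"
  by (rule outer_plus_inner_intro[of 0 s 0 _ 0]) (simp_all add: trace_def)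

text \<open>The coefficients of y^(3^n - 1) in the outer components form the vector v; removing them
  leaves an element of \<open>C\<close>, which acts as an inner derivation.\<close>

lemma outer_plus_inner_bracket:
  assumes "z \<in> dps_below (3 ^ n) \<times> dps_below (3 ^ n) \<times> dps_below (3 ^ n)"
  shows "outer_plus_inner (ham_bracket z)"
proof -
  obtain a w b where z: "z = (a, w, b)" by (cases z)
  define v :: "'f ^ 2" where "v = (\<chi> i. dps_nth (if i = 1 then a else b) (3 ^ n - 1))"
  have v: "v $ 1 = dps_nth a (3 ^ n - 1)" "v $ 2 = dps_nth b (3 ^ n - 1)"
    by (simp_all add: v_def)
  have "z - triple_top n v \<in> C"
    using assms by (auto simp: z triple_top_def v dps_below_def)
  moreover have "ham_bracket z x = ham_bracket (triple_top n v) x + ham_bracket (z - triple_top n v) x" for x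
    by (simp add: ham_bracket_diff_left)
  ultimately show ?thesis
    by (intro outer_plus_inner_intro[of 0 "\<lambda>_. 0" "z - triple_top n v" _ v]) (simp_all add: trace_def)
qed

text \<open>The outer components lag one degree behind because their y^(j) is the bracket of y^(j +
  1) \<partial> with a constant. At m = 3^n both bounds are those of
  \<open>ham_carrier n\<close>.\<close>

definition vanishes :: "nat \<Rightarrow> ('f triple \<Rightarrow> 'f triple) \<Rightarrow> bool"
  where "vanishes m D \<longleftrightarrow> (\<forall>j<m. D (0, dps_X j, 0) = 0) \<and>
    (\<forall>j<m - 1. D (dps_X j, 0, 0) = 0 \<and> D (0, 0, dps_X j) = 0)"

lemma vanishes_all:
  assumes D: "ham_derivation n D" and van: "vanishes (3 ^ n) D" and "x \<in> C"
  shows "D x = 0"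
  using assms(3)
proof (induction x rule: ham_carrier_induct)
  case zero
  show ?case by (rule ham_derivation_zero[OF D])
next
  case (add x y)
  then show ?case using ham_derivationD(2)[OF D] by simp
next
  case (smult c x)
  then show ?case using ham_derivationD(3)[OF D] by simp
qed (use van in \<open>simp_all add: vanishes_def\<close>)

lemma e1_in [simp]: "(0, dps_X 1, 0) \<in> C"
  using e_in[of 1] nine_le by simp

section \<open>Degree and weight constraints on derivations that kill \<partial>\<close>

lemma derivation_commutes_deriv:
  assumes "ham_derivation n D" "D (0, 1, 0) = 0" "x \<in> C"
  shows "D (triple_map dps_deriv x) = triple_map dps_deriv (D x)"
  using ham_derivationD(4)[OF assms(1) e0_in assms(3)] assms(2)
  by (simp add: ham_bracket_e0)

text \<open>\<open>D\<close> commutes with \<partial>, so \<partial> annihilates \<open>D x\<close>,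
  and the kernel of \<partial> consists of constants.\<close>

lemma derivation_const:
  assumes "ham_derivation n D" "D (0, 1, 0) = 0" "x \<in> C" "D (triple_map dps_deriv x) = 0"
  obtains \<alpha> \<gamma> \<beta> where "D x = (dps_const \<alpha>, dps_const \<gamma>, dps_const \<beta>)"
proof -
  obtain a w b where x: "D x = (a, w, b)" by (cases "D x")
  have "triple_map dps_deriv (D x) = 0"
    using derivation_commutes_deriv[OF assms(1-3)] assms(4) by simp
  then have "a = dps_const (dps_nth a 0)" "w = dps_const (dps_nth w 0)" "b = dps_const (dps_nth b 0)"
    by (simp_all add: x zero_triple dps_deriv_eq_0_iff[symmetric])
  with x that show ?thesis by metis
qed

lemma bracket_e1_const:
  "ham_bracket (0, dps_X 1, 0) (dps_const \<alpha>, dps_const \<gamma>, dps_const \<beta>) =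
    (dps_const \<alpha>, dps_const (- \<gamma>), dps_const \<beta> :: 'f dps)"
  by (simp add: dps_deriv_simps dps_const_minus)

lemma dps_const_eq_iff: "dps_const a = dps_const b \<longleftrightarrow> a = b" for a b :: 'f
  by (metis dps_nth_const)

text \<open>As \<open>D\<close> also kills y \<partial>, it commutes with the bracket by y
  \<partial> and preserves its eigenvalues. On constants these are 1 for the outer components and -1
  for the middle one.\<close>

lemma derivation_eigen:
  assumes D: "ham_derivation n D" "D (0, 1, 0) = 0" and e1: "D (0, dps_X 1, 0) = 0"
    and x: "x \<in> C" "D (triple_map dps_deriv x) = 0"
    and c: "ham_bracket (0, dps_X 1, 0) x = triple_smult c x"
  obtains \<alpha> \<gamma> \<beta> where "D x = (dps_const \<alpha>, dps_const \<gamma>, dps_const \<beta>)"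
    "c \<noteq> 1 \<Longrightarrow> \<alpha> = 0" "c \<noteq> - 1 \<Longrightarrow> \<gamma> = 0" "c \<noteq> 1 \<Longrightarrow> \<beta> = 0"
proof -
  obtain \<alpha> \<gamma> \<beta> where *: "D x = (dps_const \<alpha>, dps_const \<gamma>, dps_const \<beta>)"
    by (rule derivation_const[OF D x])
  have "ham_bracket (0, dps_X 1, 0) (D x) = triple_smult c (D x)"
    using ham_derivationD(4)[OF D(1) e1_in x(1)] ham_derivationD(3)[OF D(1) x(1), of c] e1 c
    by simp
  then have "\<alpha> = c * \<alpha>" "- \<gamma> = c * \<gamma>" "\<beta> = c * \<beta>"
    unfolding * bracket_e1_const triple_smult_simp dps_const_mult[symmetric] prod.inject
      dps_const_eq_iff by simp_all
  then have "(c - 1) * \<alpha> = 0" "(c + 1) * \<gamma> = 0" "(c - 1) * \<beta> = 0"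
    by (simp_all only: left_diff_distrib distrib_right mult_1_left) (metis add.left_inverse diff_self)+
  then have "c - 1 = 0 \<or> \<alpha> = 0" "c + 1 = 0 \<or> \<gamma> = 0" "c - 1 = 0 \<or> \<beta> = 0"
    by (simp_all only: mult_eq_0_iff)
  then show ?thesis
    by (intro that[OF *]) (auto simp: eq_neg_iff_add_eq_0)
qed

lemma bracket_e1_e:
  "j > 0 \<Longrightarrow> ham_bracket (0, dps_X 1, 0) (0, dps_X j, 0) =
    triple_smult (of_nat j - 1 :: 'f) (0, dps_X j, 0)"
  by (simp add: dps_deriv_X' dps_X_mult dps_const_diff dps_const_of_nat algebra_simps)

lemma bracket_e1_u1:
  "ham_bracket (0, dps_X 1, 0) (dps_X j, 0, 0) =
    triple_smult (of_nat (Suc j) :: 'f) (dps_X j, 0, 0)"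
  and bracket_e1_u2:
  "ham_bracket (0, dps_X 1, 0) (0, 0, dps_X j) =
    triple_smult (of_nat (Suc j) :: 'f) (0, 0, dps_X j)"
  by (simp_all add: dps_X_mult dps_const_of_nat dps_deriv_of_nat_mult del: of_nat_Suc)

text \<open>The bracket of y^(m) \<partial> with the constants of V gives V \<otimes> y^(m - 1), so
  the outer components follow once \<open>D\<close> kills y^(m) \<partial>.\<close>

lemma vanishes_Suc:
  assumes D: "ham_derivation n D" and van: "vanishes m D" and m: "3 \<le> m" "m < 3 ^ n"
    and em: "D (0, dps_X m, 0) = 0"
  shows "vanishes (Suc m) D"
proof -
  have "D (1, 0, 0) = 0" "D (0, 0, 1) = 0"
    using van m(1) unfolding vanishes_def by (force dest: spec[of _ "0::nat"])+
  moreover have "(1, 0, 0) \<in> C" "(0, 0, 1) \<in> C"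
    using u1_in[of 0] u2_in[of 0] nine_le by simp_all
  moreover have "ham_bracket (0, dps_X m, 0) (1, 0, 0) = (dps_X (m - 1), 0, 0)"
    "ham_bracket (0, dps_X m, 0) (0, 0, 1) = (0, 0, dps_X (m - 1))"
    using m by (simp_all add: dps_deriv_X')
  ultimately have "D (dps_X (m - 1), 0, 0) = 0" "D (0, 0, dps_X (m - 1)) = 0"
    using ham_derivationD(4)[OF D e_in[OF m(2)], of "(1, 0, 0)"]
      ham_derivationD(4)[OF D e_in[OF m(2)], of "(0, 0, 1)"] em
    by (metis add_0 ham_bracket_zero_left ham_bracket_zero_right)+
  with van em m(1) show ?thesis
    unfolding vanishes_def
    by (auto simp: less_Suc_eq)
      (metis Suc_pred less_Suc_eq less_Suc_eq_0_disj not_numeral_le_zero)+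
qed

lemma of_nat_minus_1_eq: "of_nat m - 1 = (1::'f) \<longleftrightarrow> 3 dvd m + 1"
  "of_nat m - 1 = (- 1 :: 'f) \<longleftrightarrow> 3 dvd m"
proof -
  have "of_nat m - 1 = (1::'f) \<longleftrightarrow> of_nat (m + 1) = (3::'f)"
    by (simp add: diff_eq_eq eq_diff_eq)
  then show "of_nat m - 1 = (1::'f) \<longleftrightarrow> 3 dvd m + 1"
    unfolding three of_nat_eq_0 .
  show "of_nat m - 1 = (- 1 :: 'f) \<longleftrightarrow> 3 dvd m"
    by (simp add: of_nat_eq_0[symmetric] diff_eq_eq)
qed

lemma vanishes_const:
  assumes D: "ham_derivation n D" and van: "vanishes m D" and m: "3 \<le> m" "m < 3 ^ n"
  obtains \<alpha> \<gamma> \<beta> where "D (0, dps_X m, 0) = (dps_const \<alpha>, dps_const \<gamma>, dps_const \<beta>)"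
    "\<not> 3 dvd m + 1 \<Longrightarrow> \<alpha> = 0" "\<not> 3 dvd m \<Longrightarrow> \<gamma> = 0" "\<not> 3 dvd m + 1 \<Longrightarrow> \<beta> = 0"
proof -
  have e0: "D (0, 1, 0) = 0" and e1: "D (0, dps_X 1, 0) = 0"
    using van m(1) unfolding vanishes_def
    by (force dest: spec[of _ "0::nat"], force dest: spec[of _ "1::nat"])
  have "D (triple_map dps_deriv (0, dps_X m, 0)) = 0"
    using van m(1) unfolding vanishes_def by (simp add: dps_deriv_X')
  moreover have "ham_bracket (0, dps_X 1, 0) (0, dps_X m, 0) =
      triple_smult (of_nat m - 1 :: 'f) (0, dps_X m, 0)"
    using m(1) by (intro bracket_e1_e) simp
  ultimately show ?thesis
  proof (rule derivation_eigen[OF D e0 e1 e_in[OF m(2)]])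
    fix \<alpha> \<gamma> \<beta>
    assume "D (0, dps_X m, 0) = (dps_const \<alpha>, dps_const \<gamma>, dps_const \<beta>)"
      "of_nat m - 1 \<noteq> (1::'f) \<Longrightarrow> \<alpha> = 0" "of_nat m - 1 \<noteq> (- 1 :: 'f) \<Longrightarrow> \<gamma> = 0"
      "of_nat m - 1 \<noteq> (1::'f) \<Longrightarrow> \<beta> = 0"
    then show ?thesis
      unfolding of_nat_minus_1_eq by (rule that)
  qed
qed

lemma vanishes_e:
  assumes D: "ham_derivation n D" and van: "vanishes m D" and m: "3 \<le> m" "m < 3 ^ n"
    "\<And>k. m \<noteq> 3 ^ k"
  shows "D (0, dps_X m, 0) = 0"
proof (cases "m mod 3 = 1")
  case True
  then have "\<not> 3 dvd m" "\<not> 3 dvd m + 1" by presburger+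
  then show ?thesis using vanishes_const[OF D van m(1,2)] by (metis dps_const_0 zero_triple)
next
  case False
  then obtain i where i: "2 \<le> i" "i + 2 \<le> m" "\<not> 3 dvd m choose i"
    using exists_binomial_not_dvd_3 m by metis
  \<comment> \<open>Both i and m - i are at most m - 2, which is the range that
    \<open>vanishes m\<close> covers in the outer components.\<close>
  have "D (dps_X (m - i), 0, 0) = 0" "D (0, 0, dps_X i) = 0"
    using van i m(1) unfolding vanishes_def by auto
  moreover have "(dps_X (m - i), 0, 0) \<in> C" "(0, 0, dps_X i) \<in> C"
    using i m(2) by (intro u1_in u2_in; linarith)+
  moreover have "ham_bracket (0, 0, dps_X i) (dps_X (m - i), 0, 0) =
      triple_smult (of_nat (m choose i) :: 'f) (0, dps_X m, 0)"
    using i by (simp add: dps_X_mult dps_const_of_nat)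
  ultimately have "triple_smult (of_nat (m choose i)) (D (0, dps_X m, 0)) = 0"
    using ham_derivationD(4)[OF D, of "(0, 0, dps_X i)" "(dps_X (m - i), 0, 0)"]
      ham_derivationD(3)[OF D e_in[OF m(2)]]
    by (simp del: ham_bracket_simp)
  then have "triple_smult (inverse (of_nat (m choose i))) (triple_smult (of_nat (m choose i)) (D (0, dps_X m, 0))) = 0"
    by simp
  then show ?thesis
    using i(3) of_nat_eq_0[of "m choose i"]
    by (simp add: triple_smult_assoc[symmetric] triple_smult_one)
qed

lemma ham_derivation_frob: "ham_derivation n (triple_map (dps_frob n (s :: nat \<Rightarrow> 'f)))"
  by (rule ham_derivation_map)
    (simp_all add: derivation_frob[OF three] dps_frob_const_mult dps_frob_deriv dps_frob_below)

lemma outer_plus_inner_if_vanishes: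
  assumes "3 \<le> m" "m \<le> 3 ^ n" and "ham_derivation n D" "vanishes m D"
  shows "outer_plus_inner D"
  using assms(2,1,3,4)
\<comment> \<open>Downward induction from 3^n: the claim for \<open>Suc m\<close> is applied to
  \<open>D\<close>, or to \<open>D\<close> after a correction in degree m.\<close>
proof (induction m arbitrary: D rule: inc_induct)
  case base
  then show ?case by (intro outer_plus_inner_zero vanishes_all)
next
  case (step m)
  show ?case
  proof (cases "\<exists>k. m = 3 ^ k")
    case False
    with step.prems step.hyps have "D (0, dps_X m, 0) = 0"
      by (intro vanishes_e) auto
    with step show ?thesis by (intro step.IH vanishes_Suc) auto
  next
    case True
    then obtain k where k: "m = 3 ^ k" ..
    with step.prems(1) have "k > 0" by (cases k) auto
    then obtain i where i: "k = Suc i" using gr0_implies_Suc by blast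
    \<comment> \<open>This puts i = k - 1 in the range of the parameters of
      \<open>dps_frob\<close>.\<close>
    have "k < n" using step.hyps k power_less_imp_less_exp[of "3::nat" k n] by simp
    have "3 dvd m" using k i by simp
    then have "\<not> 3 dvd m + 1" by presburger
    with vanishes_const[OF step.prems(2,3,1) step.hyps(2)]
    obtain \<gamma> where em: "D (0, dps_X m, 0) = (0, dps_const \<gamma>, 0)"
      by (metis dps_const_0)
    define G where "G = triple_map (dps_frob n (\<lambda>l. if l = i then \<gamma> else 0))"
    have G: "G (a, w, b) = (dps_const \<gamma> * (dps_deriv ^^ m) a, dps_const \<gamma> * (dps_deriv ^^ m) w,
        dps_const \<gamma> * (dps_deriv ^^ m) b)" for a w b
      using \<open>k < n\<close> i k by (simp add: G_def dps_frob_single del: power_Suc)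
    have "outer_plus_inner G" unfolding G_def using \<open>k < n\<close> i by (intro outer_plus_inner_frob) auto
    have der: "ham_derivation n (\<lambda>x. D x - G x)"
      unfolding G_def by (intro ham_derivation_diff step.prems ham_derivation_frob)
    have zero: "(dps_deriv ^^ m) (0 :: 'f dps) = 0" by (rule dps_eqI) simp
    \<comment> \<open>\<partial>^m annihilates y^(j) for all j < m, so the correction in degree m
      leaves the lower degrees alone.\<close>
    have "vanishes m (\<lambda>x. D x - G x)"
      using step.prems(3) unfolding vanishes_def
      by (auto simp: G dps_deriv_funpow_X zero zero_prod_def)
    moreover have "D (0, dps_X m, 0) - G (0, dps_X m, 0) = 0"
      by (simp add: em G dps_deriv_funpow_X zero zero_prod_def)
    ultimately have "outer_plus_inner (\<lambda>x. D x - G x)"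
      using step.prems(1) step.hyps der by (intro step.IH vanishes_Suc) auto
    then show ?thesis using \<open>outer_plus_inner G\<close> by (rule outer_plus_inner_diff)
  qed
qed

text \<open>To start the induction at degree 3, the elements V \<otimes> y and y^(2) \<partial>
  remain. The first have eigenvalue 2 = -1 and go to multiples of \<partial>, which the vanishing of
  the brackets of y with y^(2) in the same outer component rules out. The last has eigenvalue 1 and
  goes to V; bracketing it with V lands in V \<otimes> y, which \<open>D\<close> kills by
  then.\<close>

lemma outer_plus_inner_if_e0_e1_u:
  assumes D: "ham_derivation n D" and e0: "D (0, 1, 0) = 0" and e1: "D (0, dps_X 1, 0) = 0"
    and u: "D (1, 0, 0) = 0" "D (0, 0, 1) = 0"
  shows "outer_plus_inner D"
proof -
  have lt: "0 < 3 ^ n - (1::nat)" "1 < 3 ^ n - (1::nat)" "2 < 3 ^ n - (1::nat)" "2 < (3::nat) ^ n"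
    using nine_le by simp_all
  note in_C = u1_in[OF lt(1)] u1_in[OF lt(2)] u1_in[OF lt(3)]
    u2_in[OF lt(1)] u2_in[OF lt(2)] u2_in[OF lt(3)] e_in[OF lt(4)]
  have two_eq: "(2::'f) = - 1" using three by (simp add: eq_neg_iff_add_eq_0)
  have neq: "(2::'f) \<noteq> 1" "(0::'f) \<noteq> 1" "(0::'f) \<noteq> - 1" "(1::'f) \<noteq> - 1"
    using two by (simp_all add: eq_neg_iff_add_eq_0) (metis add_cancel_right_right one_add_one one_neq_zero)
  obtain l1 where d1: "D (dps_X 1, 0, 0) = (0, dps_const l1, 0)"
  proof (rule derivation_eigen[OF D e0 e1 in_C(2) _ bracket_e1_u1])
    show "D (triple_map dps_deriv (dps_X 1, 0, 0)) = 0" using u by simp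
  qed (use that two_eq neq in auto)
  obtain l2 where d2: "D (0, 0, dps_X 1) = (0, dps_const l2, 0)"
  proof (rule derivation_eigen[OF D e0 e1 in_C(5) _ bracket_e1_u2])
    show "D (triple_map dps_deriv (0, 0, dps_X 1)) = 0" using u by simp
  qed (use that two_eq neq in auto)
  \<comment> \<open>\<open>D x\<close> is an antiderivative of c \<partial>, so known up to
    constants; it has eigenvalue 0 under y \<partial>, while nonzero constants have eigenvalues 1
    and -1.\<close>
  have lift: "D x = triple_smult c (0, dps_X 1, 0)"
    if x: "x \<in> C" and eq: "D (triple_map dps_deriv x) = (0, dps_const c, 0)"
      "ham_bracket (0, dps_X 1, 0) x = 0" for x c
  proof -
    obtain a w b where Dx: "D x = (a, w, b)" by (cases "D x")
    have "triple_map dps_deriv (D x) = (0, dps_const c, 0)"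
      using derivation_commutes_deriv[OF D e0 x] eq(1) by simp
    then have d: "dps_deriv a = 0" "dps_deriv w = dps_const c" "dps_deriv b = 0"
      by (simp_all add: Dx)
    have "ham_bracket (0, dps_X 1, 0) (D x) = 0"
      using ham_derivationD(4)[OF D e1_in x] e1 eq(2) ham_derivation_zero[OF D] by simp
    then have "a = 0" "dps_X 1 * dps_const c - w = 0" "b = 0"
      using d by (simp_all add: Dx zero_prod_def dps_deriv_simps)
    then show ?thesis by (simp add: Dx mult.commute)
  qed
  have three': "triple_smult (of_nat (Suc 2)) x = 0" for x :: "'f triple"
    using three by (simp add: triple_smult_zero_left)
  have d12: "D (dps_X 2, 0, 0) = (0, dps_const l1 * dps_X 1, 0)"
  proof -
    have "D (dps_X 2, 0, 0) = triple_smult l1 (0, dps_X 1, 0)"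
    proof (rule lift[OF in_C(3)])
      show "D (triple_map dps_deriv (dps_X 2, 0, 0)) = (0, dps_const l1, 0)"
        using d1 by (simp add: dps_deriv_X')
    qed (simp only: bracket_e1_u1 three')
    then show ?thesis by simp
  qed
  have d22: "D (0, 0, dps_X 2) = (0, dps_const l2 * dps_X 1, 0)"
  proof -
    have "D (0, 0, dps_X 2) = triple_smult l2 (0, dps_X 1, 0)"
    proof (rule lift[OF in_C(6)])
      show "D (triple_map dps_deriv (0, 0, dps_X 2)) = (0, dps_const l2, 0)"
        using d2 by (simp add: dps_deriv_X')
    qed (simp only: bracket_e1_u2 three')
    then show ?thesis by simp
  qed
  \<comment> \<open>The element \<open>y^(2)\<close> exists in the outer components because \<open>n > 1\<close>; for \<open>n = 1\<close> the algebra has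
    more outer derivations.\<close>
  have "l1 = 0"
  proof -
    have "ham_bracket (dps_X 1, 0, 0) (dps_X 2, 0, 0) = (0 :: 'f triple)"
      by (simp add: zero_triple)
    then have "ham_bracket (0, dps_const l1, 0) (dps_X 2, 0, 0) +
        ham_bracket (dps_X 1, 0, 0) (0, dps_const l1 * dps_X 1, 0) = 0"
      using ham_derivationD(4)[OF D in_C(2) in_C(3)] d1 d12 ham_derivation_zero[OF D] by simp
    then have "dps_const l1 * dps_X 1 = 0"
      by (simp add: zero_prod_def dps_deriv_simps dps_deriv_X' algebra_simps)
    then have "dps_nth (dps_const l1 * dps_X 1) 1 = 0" by (metis zero_dps.rep_eq)
    then show ?thesis by simp
  qed
  have "l2 = 0"
  proof -
    have "ham_bracket (0, 0, dps_X 1) (0, 0, dps_X 2) = (0 :: 'f triple)"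
      by (simp add: zero_triple)
    then have "ham_bracket (0, dps_const l2, 0) (0, 0, dps_X 2) +
        ham_bracket (0, 0, dps_X 1) (0, dps_const l2 * dps_X 1, 0) = 0"
      using ham_derivationD(4)[OF D in_C(5) in_C(6)] d2 d22 ham_derivation_zero[OF D] by simp
    then have "dps_const l2 * dps_X 1 = 0"
      by (simp add: zero_prod_def dps_deriv_simps dps_deriv_X' algebra_simps)
    then have "dps_nth (dps_const l2 * dps_X 1) 1 = 0" by (metis zero_dps.rep_eq)
    then show ?thesis by simp
  qed
  obtain \<alpha> \<beta> where e2: "D (0, dps_X 2, 0) = (dps_const \<alpha>, 0, dps_const \<beta>)"
  proof (rule derivation_eigen[OF D e0 e1 in_C(7)])
    show "D (triple_map dps_deriv (0, dps_X 2, 0)) = 0" using e1 by (simp add: dps_deriv_X')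
    show "ham_bracket (0, dps_X 1, 0) (0, dps_X 2, 0) =
        triple_smult (of_nat 2 - 1 :: 'f) (0, dps_X 2, 0)"
      by (rule bracket_e1_e) simp
  qed (use that neq in auto)
  have "\<beta> = 0"
  proof -
    have "ham_bracket (0, dps_X 2, 0) (dps_X 0, 0, 0) = (dps_X 1, 0, 0)"
      by (simp add: dps_deriv_X')
    then have "ham_bracket (dps_const \<alpha>, 0, dps_const \<beta>) (1, 0, 0) = 0"
      using ham_derivationD(4)[OF D in_C(7) in_C(1)] e2 u d1 \<open>l1 = 0\<close>
      by (simp add: zero_triple dps_deriv_X')
    then show ?thesis
      by (simp add: zero_prod_def) (metis dps_const_0 dps_const_eq_iff)
  qed
  have "\<alpha> = 0"
  proof -
    have "ham_bracket (0, dps_X 2, 0) (0, 0, dps_X 0) = (0, 0, dps_X 1)"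
      by (simp add: dps_deriv_X')
    then have "ham_bracket (dps_const \<alpha>, 0, dps_const \<beta>) (0, 0, 1) = 0"
      using ham_derivationD(4)[OF D in_C(7) in_C(4)] e2 u d2 \<open>l2 = 0\<close>
      by (simp add: zero_triple dps_deriv_X')
    then show ?thesis
      by (simp add: zero_prod_def) (metis dps_const_0 dps_const_eq_iff)
  qed
  have "vanishes 3 D"
    unfolding vanishes_def
  proof (intro conjI allI impI)
    fix j :: nat
    show "D (0, dps_X j, 0) = 0" if "j < 3"
      using that e0 e1 e2 \<open>\<alpha> = 0\<close> \<open>\<beta> = 0\<close>
      by (auto simp: less_Suc_eq numeral_3_eq_3 numeral_2_eq_2 zero_triple)
    show "D (dps_X j, 0, 0) = 0" "D (0, 0, dps_X j) = 0" if "j < 3 - 1"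
      using that u d1 d2 \<open>l1 = 0\<close> \<open>l2 = 0\<close>
      by (auto simp: less_Suc_eq numeral_2_eq_2 zero_triple)
  qed
  then show ?thesis
    using nine_le by (intro outer_plus_inner_if_vanishes[OF _ _ D, of 3]) auto
qed

lemma outer_plus_inner_if_e0_e1:
  assumes D: "ham_derivation n D" and e0: "D (0, 1, 0) = 0" and e1: "D (0, dps_X 1, 0) = 0"
  shows "outer_plus_inner D"
proof -
  have lt: "0 < 3 ^ n - (1::nat)" using nine_le by simp
  note in_C = u1_in[OF lt] u2_in[OF lt]
  have neq: "(1::'f) \<noteq> - 1" using two by (simp add: eq_neg_iff_add_eq_0)
  obtain \<alpha>1 \<beta>1 where d1: "D (dps_X 0, 0, 0) = (dps_const \<alpha>1, 0, dps_const \<beta>1)"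
  proof (rule derivation_eigen[OF D e0 e1 in_C(1) _ bracket_e1_u1])
    show "D (triple_map dps_deriv (dps_X 0, 0, 0)) = 0"
      using ham_derivation_zero[OF D] by (simp add: zero_triple)
  qed (use that neq in auto)
  obtain \<alpha>2 \<beta>2 where d2: "D (0, 0, dps_X 0) = (dps_const \<alpha>2, 0, dps_const \<beta>2)"
  proof (rule derivation_eigen[OF D e0 e1 in_C(2) _ bracket_e1_u2])
    show "D (triple_map dps_deriv (0, 0, dps_X 0)) = 0"
      using ham_derivation_zero[OF D] by (simp add: zero_triple)
  qed (use that neq in auto)
  \<comment> \<open>The bracket of the two basis vectors of V is \<partial>, which \<open>D\<close>
    kills. This forces trace 0.\<close>
  have "ham_bracket (0, 0, dps_X 0) (dps_X 0, 0, 0) = (0, 1, 0 :: 'f dps)"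
    by simp
  then have "ham_bracket (dps_const \<alpha>2, 0, dps_const \<beta>2) (dps_X 0, 0, 0) +
      ham_bracket (0, 0, dps_X 0) (dps_const \<alpha>1, 0, dps_const \<beta>1) = 0"
    using ham_derivationD(4)[OF D in_C(2,1)] d1 d2 e0 by simp
  then have "dps_const (\<beta>2 + \<alpha>1) = dps_const 0"
    by (simp add: zero_prod_def dps_const_add)
  then have trace: "\<alpha>1 + \<beta>2 = 0" unfolding dps_const_eq_iff by (simp add: add.commute)
  \<comment> \<open>The columns are the images of the two basis vectors of V under
    \<open>D\<close>.\<close>
  define A :: "'f ^ 2 ^ 2" where "A = vector [vector [\<alpha>1, \<alpha>2], vector [\<beta>1, \<beta>2]]"
  have A: "A $ 1 $ 1 = \<alpha>1" "A $ 1 $ 2 = \<alpha>2" "A $ 2 $ 1 = \<beta>1" "A $ 2 $ 2 = \<beta>2"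
    by (simp_all add: A_def)
  have "trace A = 0" using trace by (simp add: trace_def sum_2 A)
  then have "outer_plus_inner (triple_act A)" "ham_derivation n (triple_act A)"
    by (rule outer_plus_inner_act, rule ham_derivation_act)
  moreover have "outer_plus_inner (\<lambda>x. D x - triple_act A x)"
    using e0 e1 d1 d2 by (intro outer_plus_inner_if_e0_e1_u ham_derivation_diff D \<open>ham_derivation n (triple_act A)\<close>)
      (simp_all add: A zero_triple)
  ultimately show ?thesis by (blast intro: outer_plus_inner_diff)
qed

lemma outer_plus_inner_if_e0:
  assumes D: "ham_derivation n D" and e0: "D (0, 1, 0) = 0"
  shows "outer_plus_inner D"
proof -
  obtain \<alpha> \<gamma> \<beta> where e1: "D (0, dps_X 1, 0) = (dps_const \<alpha>, dps_const \<gamma>, dps_const \<beta>)"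
  proof (rule derivation_const[OF D e0 e1_in])
    show "D (triple_map dps_deriv (0, dps_X 1, 0)) = 0"
      using e0 by (simp add: dps_deriv_X')
  qed
  \<comment> \<open>The bracket of a constant with y \<partial> multiplies its components by -1, 1,
    -1; these signs make it reproduce \<open>D\<close> on y \<partial>. Being constant, z commutes
    with \<partial>.\<close>
  define z where "z = (dps_const (- \<alpha>), dps_const \<gamma>, dps_const (- \<beta>))"
  have z: "z \<in> C" unfolding z_def by (rule const_in)
  then have der: "ham_derivation n (ham_bracket z)"
    using ham_derivation_bracket[OF three] ham_carrier_subset by blast
  have "outer_plus_inner (ham_bracket z)"
    using outer_plus_inner_bracket ham_carrier_subset z by blast
  moreover have "outer_plus_inner (\<lambda>x. D x - ham_bracket z x)"
    using e0 e1 by (intro outer_plus_inner_if_e0_e1 ham_derivation_diff D der)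
      (simp_all add: z_def dps_deriv_simps dps_deriv_X' dps_const_minus zero_triple)
  ultimately show ?thesis by (blast intro: outer_plus_inner_diff)
qed

lemma dps_nth_X1_mult: "dps_nth (dps_X 1 * f) (Suc k) = of_nat (Suc k) * dps_nth f k"
  for f :: "'f dps"
proof (induction k arbitrary: f)
  case (Suc k)
  have "dps_nth (dps_X 1 * f) (Suc (Suc k)) = dps_nth (dps_deriv (dps_X 1 * f)) (Suc k)"
    by simp
  also have "\<dots> = dps_nth f (Suc k) + dps_nth (dps_X 1 * dps_deriv f) (Suc k)"
    by (simp add: dps_deriv_mult del: dps_deriv.rep_eq)
  also have "\<dots> = of_nat (Suc (Suc k)) * dps_nth f (Suc k)"
    unfolding Suc.IH by (simp add: algebra_simps)
  finally show ?case .
qed (simp add: dps_nth_mult_Suc)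

lemma derivation_outer_plus_inner:
  assumes D: "ham_derivation n D"
  shows "outer_plus_inner D"
proof -
  obtain a w b where De0: "D (0, 1, 0) = (a, w, b)" by (cases "D (0, 1, 0)")
  obtain a1 w1 b1 where De1: "D (0, dps_X 1, 0) = (a1, w1, b1)" by (cases "D (0, dps_X 1, 0)")
  have in_C: "(a, w, b) \<in> C" "(a1, w1, b1) \<in> C"
    using ham_derivationD(1)[OF D e0_in] ham_derivationD(1)[OF D e1_in] De0 De1 by simp_all
  \<comment> \<open>Since \<open>[\<partial>, y \<partial>] = \<partial>\<close>, the top coefficient of \<open>w\<close> vanishes, so that \<open>w\<close> is a derivative.\<close>
  obtain q where q: "3 ^ n = Suc (Suc q)"
    using nine_le by (metis Suc_le_D numeral_nat(3) Suc_le_mono numeral_eq_Suc)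
  have "ham_bracket (0, 1, 0) (0, dps_X 1, 0) = (0, 1, 0 :: 'f dps)"
    by (simp add: dps_deriv_X')
  then have "w * dps_deriv (dps_X 1) - dps_deriv w * dps_X 1 + dps_deriv w1 = w"
    using ham_derivationD(4)[OF D e0_in e1_in] De0 De1 by simp
  then have "dps_X 1 * dps_deriv w = dps_deriv w1"
    by (simp add: dps_deriv_X' algebra_simps)
  \<comment> \<open>Degree \<open>Suc q\<close> is 3^n - 1, which is prime to 3; the coefficient of
    \<open>w1\<close> on the right is in degree 3^n and hence 0.\<close>
  then have "dps_nth (dps_X 1 * dps_deriv w) (Suc q) = dps_nth w1 (Suc (Suc q))"
    by simp
  then have "of_nat (Suc q) * dps_nth w (Suc q) = 0"
    using in_C(2) unfolding dps_nth_X1_mult by (simp add: dps_below_def q del: of_nat_Suc)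
  moreover have "\<not> 3 dvd Suc q"
  proof -
    have "3 dvd Suc (Suc q)" using q n by (metis dvd_power gr0I not_less_zero)
    then show ?thesis by presburger
  qed
  ultimately have top: "dps_nth w (Suc q) = 0"
    using of_nat_eq_0 by (metis mult_eq_0_iff)
  define int :: "'f dps \<Rightarrow> 'f dps"
    where "int f = Abs_dps (\<lambda>k. if k = 0 then 0 else dps_nth f (k - 1))" for f
  have deriv_int: "dps_deriv (int f) = f" for f
    by (rule dps_eqI) (simp add: int_def)
  have int_below: "int f \<in> dps_below (3 ^ n)" if "f \<in> dps_below (3 ^ n - 1)" for f
    using that unfolding dps_below_def q by (auto simp: int_def)
  have "w \<in> dps_below (3 ^ n - 1)"
    using in_C(1) top by (simp add: dps_below_def q) (metis Suc_leI le_neq_implies_less)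
  \<comment> \<open>The bracket of z with \<partial> is -\<partial>z, hence the signs. The integrals
    of a and b may have degree 3^n - 1 and so leave \<open>C\<close>; here \<open>triple_top\<close>
    enters.\<close>
  define z where "z = (- int a, - int w, - int b)"
  have z: "z \<in> dps_below (3 ^ n) \<times> dps_below (3 ^ n) \<times> dps_below (3 ^ n)"
    using in_C(1) \<open>w \<in> _\<close> int_below by (simp add: z_def dps_below_minus)
  have "outer_plus_inner (\<lambda>x. D x - ham_bracket z x)"
    by (intro outer_plus_inner_if_e0 ham_derivation_diff D ham_derivation_bracket[OF three z])
      (simp add: De0 z_def dps_deriv_minus deriv_int zero_triple)
  with outer_plus_inner_bracket[OF z] show ?thesis by (blast intro: outer_plus_inner_diff)
qed

end

section \<open>Closure, independence and commutators of the outer derivations\<close>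

lemma ham_derivation_add:
  assumes "ham_derivation n D" "ham_derivation n E"
  shows "ham_derivation n (\<lambda>x. D x + E x)"
  using ham_derivationD[OF assms(1)] ham_derivationD[OF assms(2)]
  by (simp add: ham_derivation_def ham_carrier_add triple_smult_add ham_bracket_add_left
      ham_bracket_add_right)

lemma ham_derivation_smult:
  assumes "ham_derivation n D"
  shows "ham_derivation n (\<lambda>x. triple_smult c (D x))"
  using ham_derivationD[OF assms]
  by (simp add: ham_derivation_def ham_carrier_smult triple_smult_add ham_bracket_smult_left
      ham_bracket_smult_right triple_smult_assoc[symmetric] mult.commute)

lemma ham_derivation_commutator:
  assumes "(3::'f::field) = 0"
    and D: "ham_derivation n (D :: 'f triple \<Rightarrow> 'f triple)" and E: "ham_derivation n E"
  shows "ham_derivation n (\<lambda>x. D (E x) - E (D x))"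
proof -
  note [simp] = ham_derivationD[OF D] ham_derivationD[OF E] ham_carrier_add ham_carrier_smult
    ham_carrier_diff ham_bracket_closed[OF assms(1)]
  show ?thesis
    unfolding ham_derivation_def
    by (simp add: triple_smult_diff ham_bracket_diff_left ham_bracket_diff_right)
qed

context ham_outer_derivations
begin

lemma bracket_closed: "x \<in> C \<Longrightarrow> y \<in> C \<Longrightarrow> ham_bracket x y \<in> C"
  by (rule ham_bracket_closed[OF three])

lemma triple_top_below: "triple_top n v \<in> dps_below (3 ^ n) \<times> dps_below (3 ^ n) \<times> dps_below (3 ^ n)"
  by (auto simp: triple_top_def intro!: dps_below_const_mult dps_below_X)

lemma ham_derivation_inner: "z \<in> C \<Longrightarrow> ham_derivation n (ham_bracket z)"
  using ham_derivation_bracket[OF three] ham_carrier_subset by blast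

lemma ham_derivation_outer:
  assumes "trace A = 0"
  shows "ham_derivation n (ham_outer n ((A, v), s :: nat \<Rightarrow> 'f))"
  unfolding ham_outer_def prod.case
  by (intro ham_derivation_add ham_derivation_act assms ham_derivation_frob
      ham_derivation_bracket[OF three triple_top_below])

lemma dps_frob_X_below:
  assumes "j < 3"
  shows "dps_frob n s (dps_X j) = 0"
proof (rule dps_eqI)
  fix k
  have "k + 3 ^ Suc i \<noteq> j" for i
    using assms one_le_power[of "3::nat" i] unfolding power_Suc by linarith
  then show "dps_nth (dps_frob n s (dps_X j)) k = dps_nth 0 k"
    unfolding dps_nth_frob by (simp del: power_Suc)
qed

lemma dps_nth_frob_X:
  assumes "i < n - 1"
  shows "dps_nth (dps_frob n s (dps_X (3 ^ Suc i))) 0 = s i"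
proof -
  have "dps_nth (dps_frob n s (dps_X (3 ^ Suc i))) 0 = (\<Sum>l<n - 1. if l = i then s l else 0)"
    unfolding dps_nth_frob by (intro sum.cong) (auto simp del: power_Suc simp: power_inject_exp)
  then show ?thesis using assms by simp
qed

text \<open>Evaluation in a suitable order separates the parameters. On \<partial> one obtains v = 0
  and z constant; on y \<partial> then z = 0, since 0 is not an eigenvalue on constants. After that
  V detects A, and y^(3^(i + 1)) \<partial> detects \<open>s i\<close>.\<close>

lemma outer_inner_zero:
  fixes A :: "'f ^ 2 ^ 2"
  assumes s: "\<And>i. i \<ge> n - 1 \<Longrightarrow> s i = 0" and z: "z \<in> C"
    and eq: "\<And>x. x \<in> C \<Longrightarrow> ham_outer n ((A, v), s) x = ham_bracket z x"
  shows "A = 0" and "v = 0" and "s = (\<lambda>_. 0)"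
proof -
  obtain a w b where z_eq: "z = (a, w, b)" by (cases z)
  have lt: "0 < 3 ^ n - (1::nat)" using nine_le by simp
  obtain q where q: "3 ^ n = Suc (Suc q)"
    using nine_le by (metis Suc_le_D numeral_nat(3) Suc_le_mono numeral_eq_Suc)
  have frob1: "dps_frob n s 1 = 0" using dps_frob_X_below[of 0 s] by simp
  have "dps_const (v $ 1) * dps_X q = dps_deriv a" "dps_deriv w = 0"
    "dps_const (v $ 2) * dps_X q = dps_deriv b"
    using eq[OF e0_in] frob1
    by (simp_all add: z_eq ham_outer_def triple_top_def q dps_deriv_simps)
  note d = this
  \<comment> \<open>Here q = 3^n - 2, so the right-hand sides are coefficients of a and b in degree
    3^n - 1, which \<open>ham_carrier n\<close> excludes.\<close>
  have "dps_nth (dps_const (v $ 1) * dps_X q) q = 0" "dps_nth (dps_const (v $ 2) * dps_X q) q = 0"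
    unfolding d using z by (simp_all add: z_eq q dps_below_def)
  then have v1: "v $ 1 = 0" "v $ 2 = 0" by simp_all
  then show v: "v = 0" by (simp add: vec_eq_iff forall_2)
  obtain \<alpha> \<gamma> \<beta> where abw: "a = dps_const \<alpha>" "w = dps_const \<gamma>" "b = dps_const \<beta>"
    using d v1 by (simp add: dps_deriv_eq_0_iff)
  have "ham_bracket z (0, dps_X 1, 0) = 0"
    using eq[OF e1_in] dps_frob_X_below[of 1 s] v
    by (simp add: ham_outer_def zero_triple[symmetric] del: ham_bracket_simp)
  then have "z = 0"
    by (simp add: z_eq abw zero_triple dps_deriv_simps)
  then have zero: "triple_act A x + triple_map (dps_frob n s) x = 0" if "x \<in> C" for x
    using eq[OF that] v by (simp add: ham_outer_def)
  have "A $ 1 $ 1 = 0" "A $ 2 $ 1 = 0" "A $ 1 $ 2 = 0" "A $ 2 $ 2 = 0"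
    using zero[OF u1_in[OF lt]] zero[OF u2_in[OF lt]] frob1
    by (simp_all add: zero_triple) (metis dps_const_0 dps_const_eq_iff)+
  then show "A = 0" by (simp add: vec_eq_iff forall_2)
  have "s i = 0" for i
  proof (cases "i < n - 1")
    case True
    then have "3 ^ Suc i < (3::nat) ^ n" by (intro power_strict_increasing) auto
    from zero[OF e_in[OF this]] have "dps_frob n s (dps_X (3 ^ Suc i)) = 0"
      by (simp add: zero_triple del: power_Suc)
    with dps_nth_frob_X[OF True, of s] show ?thesis by simp
  qed (use s in simp)
  then show "s = (\<lambda>_. 0)" by blast
qed

lemma triple_act_top: "triple_act A (triple_top n v) = triple_top n (A *v v)"
  by (simp add: triple_top_def matrix_vector_mult_def sum_2 dps_const_add dps_const_mult algebra_simps)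

lemma triple_act_map_frob:
  "triple_act A (triple_map (dps_frob n s) x) = triple_map (dps_frob n s) (triple_act A x)"
  by (cases x) (simp add: dps_frob_add dps_frob_const_mult)

lemma triple_map_frob_add:
  "triple_map (dps_frob n s) (x + y) = triple_map (dps_frob n s) x + triple_map (dps_frob n s) y"
  by (cases x; cases y) (simp add: dps_frob_add)

lemma triple_act_commutator:
  "triple_act A (triple_act B x) - triple_act B (triple_act A x) = triple_act (A ** B - B ** A) x"
  by (cases x) (simp add: matrix_matrix_mult_def sum_2 dps_const_add dps_const_mult dps_const_diff
      algebra_simps)

lemma triple_top_diff: "triple_top n (u - v) = triple_top n u - triple_top n v"
  by (simp add: triple_top_def dps_const_diff algebra_simps)

text \<open>The chosen representatives do not form a subalgebra; y is the inner error. It collects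
  the bracket of the two top elements and their images under the powers of \<partial>, all of which
  lie in \<open>C\<close>. The commutator of sl2 with the top elements gives the action on V
  exactly, and powers of \<partial> commute with each other and with sl2.\<close>

lemma ham_outer_commutator:
  assumes "trace A = 0" "trace B = 0"
  obtains y where "y \<in> C" "\<And>x. ham_outer n ((A, v), s) (ham_outer n ((B, u), r) x) -
      ham_outer n ((B, u), r) (ham_outer n ((A, v), s) x) =
    ham_outer n ((A ** B - B ** A, A *v u - B *v v), \<lambda>_. 0) x + ham_bracket y (x :: 'f triple)"
proof
  let ?y = "ham_bracket (triple_top n v) (triple_top n u) + triple_map (dps_frob n s) (triple_top n u)
    - triple_map (dps_frob n r) (triple_top n v)"
  \<comment> \<open>Each power of \<partial> occurring here lowers the degree by at least 3, so the
    forbidden degree 3^n - 1 does not survive.\<close>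
  have top: "dps_frob n s (dps_const c * dps_X (3 ^ n - 1)) \<in> dps_below (3 ^ n - 1)"
    for s and c :: 'f
  proof -
    have "k + 3 ^ Suc i \<noteq> 3 ^ n - 1" if "3 ^ n - 1 \<le> k" for i k :: nat
      using that zero_less_power[of "3::nat" "Suc i"] by linarith
    then show ?thesis
      by (auto simp: dps_below_def dps_nth_frob intro!: sum.neutral simp del: power_Suc One_nat_def)
  qed
  have "triple_map (dps_frob n s) (triple_top n u) \<in> C" for s and u :: "'f ^ 2"
    using top by (simp add: triple_top_def)
  then show "?y \<in> C"
    by (intro ham_carrier_add ham_carrier_diff ham_bracket_closed'[OF three] triple_top_below)
  fix x :: "'f triple"
  have frob: "derivation (dps_frob n s :: 'f dps \<Rightarrow> 'f dps)" for s
    by (rule derivation_frob[OF three])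
  have frob2: "triple_map (dps_frob n s) (triple_map (dps_frob n r) x) =
      triple_map (dps_frob n r) (triple_map (dps_frob n s) x)"
    by (cases x) (simp add: dps_frob_commute)
  have act2: "triple_act (A ** B - B ** A) x =
      triple_act A (triple_act B x) - triple_act B (triple_act A x)"
    by (simp add: triple_act_commutator)
  show "ham_outer n ((A, v), s) (ham_outer n ((B, u), r) x) -
      ham_outer n ((B, u), r) (ham_outer n ((A, v), s) x) =
    ham_outer n ((A ** B - B ** A, A *v u - B *v v), \<lambda>_. 0) x + ham_bracket ?y x"
    using ham_bracket_jacobi[OF three, of "triple_top n v" "triple_top n u" x]
    by (simp add: ham_outer_def triple_act_add ham_bracket_add_right triple_map_frob_add
        triple_act_bracket[OF assms(1)] triple_act_bracket[OF assms(2)] act2 frob2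
        triple_map_bracket[OF frob dps_frob_deriv] triple_act_map_frob triple_act_top
        triple_top_diff ham_bracket_diff_left ham_bracket_add_left)
qed

end

section \<open>Isomorphisms of Lie algebras\<close>

text \<open>
  Preservation of zero is a separate requirement because \<open>M\<close> is not assumed to be a Lie algebra.
\<close>

definition lie_iso ::
  "('v \<Rightarrow> 'w) \<Rightarrow> ('f::field, 'v, 'm) lie_algebra_scheme \<Rightarrow> ('f, 'w, 'k) lie_algebra_scheme \<Rightarrow> bool"
  where "lie_iso \<phi> L M \<longleftrightarrow>
    \<phi> \<in> lie_hom L M \<and> bij_betw \<phi> (carrier L) (carrier M) \<and> \<phi> \<zero>\<^bsub>L\<^esub> = \<zero>\<^bsub>M\<^esub>"

lemma lie_isoD:
  assumes "lie_iso \<phi> L M"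
  shows "bij_betw \<phi> (carrier L) (carrier M)" "\<phi> \<zero>\<^bsub>L\<^esub> = \<zero>\<^bsub>M\<^esub>"
    "x \<in> carrier L \<Longrightarrow> \<phi> x \<in> carrier M"
    "x \<in> carrier L \<Longrightarrow> y \<in> carrier L \<Longrightarrow> \<phi> (x \<oplus>\<^bsub>L\<^esub> y) = \<phi> x \<oplus>\<^bsub>M\<^esub> \<phi> y"
    "x \<in> carrier L \<Longrightarrow> \<phi> (c \<odot>\<^bsub>L\<^esub> x) = c \<odot>\<^bsub>M\<^esub> \<phi> x"
    "x \<in> carrier L \<Longrightarrow> y \<in> carrier L \<Longrightarrow> \<phi> (\<lbrakk>x, y\<rbrakk>\<^bsub>L\<^esub>) = \<lbrakk>\<phi> x, \<phi> y\<rbrakk>\<^bsub>M\<^esub>"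
  using assms unfolding lie_iso_def lie_hom_def by auto

lemma lie_iso_comp:
  assumes "lie_iso \<phi> L M" "lie_iso \<psi> M N"
  shows "lie_iso (\<psi> \<circ> \<phi>) L N"
  using lie_isoD[OF assms(1)] lie_isoD[OF assms(2)] bij_betw_trans[of \<phi> _ _ \<psi>]
  unfolding lie_iso_def lie_hom_def by auto

text \<open>All axioms pass through a surjection that respects the operations. In this way the
  Hamiltonian algebra inherits them from \<open>ham_triples\<close>, and its outer derivation
  algebra from the explicit target.\<close>

lemma lie_algebra_transfer:
  fixes L :: "('f::field, 'v, 'm) lie_algebra_scheme" and M :: "('f, 'w, 'k) lie_algebra_scheme"
  assumes L: "lie_algebra L" and iso: "lie_iso \<phi> L M"
  shows "lie_algebra M"
proof -
  interpret L: lie_algebra L by fact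
  have elem: "\<exists>x\<in>carrier L. \<phi> x = x'" if "x' \<in> carrier M" for x'
    using that lie_isoD(1)[OF iso] unfolding bij_betw_def by (metis imageE)
  have closed: "\<phi> x \<in> carrier M" if "x \<in> carrier L" for x
    using that by (rule lie_isoD(3)[OF iso])
  note hom = lie_isoD(4-6)[OF iso, symmetric] lie_isoD(2)[OF iso, symmetric]
  have "abelian_group M"
  proof (rule abelian_groupI)
    fix x' assume "x' \<in> carrier M"
    then obtain x where x: "x \<in> carrier L" "\<phi> x = x'" using elem by blast
    then show "\<exists>y\<in>carrier M. y \<oplus>\<^bsub>M\<^esub> x' = \<zero>\<^bsub>M\<^esub>"
      using L.M.a_inv_closed[OF x(1)] by (intro bexI[of _ "\<phi> (\<ominus>\<^bsub>L\<^esub> x)"])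
        (auto simp: hom L.M.l_neg closed)
    show "\<zero>\<^bsub>M\<^esub> \<oplus>\<^bsub>M\<^esub> x' = x'" using x by (auto simp: hom)
  next
    fix x' y' assume "x' \<in> carrier M" "y' \<in> carrier M"
    then obtain x y where xy: "x \<in> carrier L" "\<phi> x = x'" "y \<in> carrier L" "\<phi> y = y'"
      using elem by meson
    then show "x' \<oplus>\<^bsub>M\<^esub> y' \<in> carrier M" "x' \<oplus>\<^bsub>M\<^esub> y' = y' \<oplus>\<^bsub>M\<^esub> x'"
      using L.M.a_comm by (auto simp: hom closed)
    fix z' assume "z' \<in> carrier M"
    then obtain z where "z \<in> carrier L" "\<phi> z = z'" using elem by blast
    with xy show "x' \<oplus>\<^bsub>M\<^esub> y' \<oplus>\<^bsub>M\<^esub> z' = x' \<oplus>\<^bsub>M\<^esub> (y' \<oplus>\<^bsub>M\<^esub> z')"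
      using L.M.a_assoc by (auto simp: hom)
  qed (simp add: hom closed)
  then have "Module.module (ring_of_type_algebra :: 'f ring) M"
  proof (intro moduleI cring_from_type_algebra)
    have cd: "c \<in> carrier (ring_of_type_algebra :: 'f ring)" for c
      by (simp add: ring_of_type_algebra_def)
    fix c d :: 'f and x' assume "x' \<in> carrier M"
    then obtain x where x: "x \<in> carrier L" "\<phi> x = x'" using elem by blast
    then show "c \<odot>\<^bsub>M\<^esub> x' \<in> carrier M"
      and "(c \<oplus>\<^bsub>ring_of_type_algebra\<^esub> d) \<odot>\<^bsub>M\<^esub> x' = c \<odot>\<^bsub>M\<^esub> x' \<oplus>\<^bsub>M\<^esub> d \<odot>\<^bsub>M\<^esub> x'"
      and "(c \<otimes>\<^bsub>ring_of_type_algebra\<^esub> d) \<odot>\<^bsub>M\<^esub> x' = c \<odot>\<^bsub>M\<^esub> (d \<odot>\<^bsub>M\<^esub> x')"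
      and "\<one>\<^bsub>ring_of_type_algebra\<^esub> \<odot>\<^bsub>M\<^esub> x' = x'"
      using cd L.smult_l_distr L.smult_assoc1 L.smult_one L.smult_closed by (auto simp: hom closed)
    fix y' assume "y' \<in> carrier M"
    then obtain y where "y \<in> carrier L" "\<phi> y = y'" using elem by blast
    with x show "c \<odot>\<^bsub>M\<^esub> (x' \<oplus>\<^bsub>M\<^esub> y') = c \<odot>\<^bsub>M\<^esub> x' \<oplus>\<^bsub>M\<^esub> c \<odot>\<^bsub>M\<^esub> y'"
      using cd L.smult_r_distr L.smult_closed by (auto simp: hom)
  qed
  moreover have "lie_algebra_axioms M"
  proof
    fix x' y' and c :: 'f assume "x' \<in> carrier M" "y' \<in> carrier M"
    then obtain x y where xy: "x \<in> carrier L" "\<phi> x = x'" "y \<in> carrier L" "\<phi> y = y'"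
      using elem by meson
    have c: "c \<in> carrier (ring_of_type_algebra :: 'f ring)" by (simp add: ring_of_type_algebra_def)
    from xy show "\<lbrakk>x', y'\<rbrakk>\<^bsub>M\<^esub> \<in> carrier M" "\<lbrakk>c \<odot>\<^bsub>M\<^esub> x', y'\<rbrakk>\<^bsub>M\<^esub> = c \<odot>\<^bsub>M\<^esub> \<lbrakk>x', y'\<rbrakk>\<^bsub>M\<^esub>"
      "\<lbrakk>x', c \<odot>\<^bsub>M\<^esub> y'\<rbrakk>\<^bsub>M\<^esub> = c \<odot>\<^bsub>M\<^esub> \<lbrakk>x', y'\<rbrakk>\<^bsub>M\<^esub>" "\<lbrakk>x', x'\<rbrakk>\<^bsub>M\<^esub> = \<zero>\<^bsub>M\<^esub>"
      using L.bracket_closed L.bracket_smult_left L.bracket_smult_right L.bracket_alternating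
        L.smult_closed[OF c]
      by (auto simp: hom closed)
    fix z' assume "z' \<in> carrier M"
    then obtain z where "z \<in> carrier L" "\<phi> z = z'" using elem by blast
    with xy show "\<lbrakk>x' \<oplus>\<^bsub>M\<^esub> y', z'\<rbrakk>\<^bsub>M\<^esub> = \<lbrakk>x', z'\<rbrakk>\<^bsub>M\<^esub> \<oplus>\<^bsub>M\<^esub> \<lbrakk>y', z'\<rbrakk>\<^bsub>M\<^esub>"
      "\<lbrakk>x', y' \<oplus>\<^bsub>M\<^esub> z'\<rbrakk>\<^bsub>M\<^esub> = \<lbrakk>x', y'\<rbrakk>\<^bsub>M\<^esub> \<oplus>\<^bsub>M\<^esub> \<lbrakk>x', z'\<rbrakk>\<^bsub>M\<^esub>"
      "\<lbrakk>x', \<lbrakk>y', z'\<rbrakk>\<^bsub>M\<^esub>\<rbrakk>\<^bsub>M\<^esub> \<oplus>\<^bsub>M\<^esub> \<lbrakk>y', \<lbrakk>z', x'\<rbrakk>\<^bsub>M\<^esub>\<rbrakk>\<^bsub>M\<^esub> \<oplus>\<^bsub>M\<^esub> \<lbrakk>z', \<lbrakk>x', y'\<rbrakk>\<^bsub>M\<^esub>\<rbrakk>\<^bsub>M\<^esub> = \<zero>\<^bsub>M\<^esub>"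
      using L.bracket_closed L.bracket_add_left L.bracket_add_right L.jacobi
      by (auto simp: hom)
  qed
  ultimately show ?thesis by (rule lie_algebra.intro)
qed

lemma lie_iso_inv:
  assumes "lie_algebra L" and iso: "lie_iso \<phi> L M"
  shows "lie_iso (inv_into (carrier L) \<phi>) M L"
proof -
  define \<psi> where "\<psi> = inv_into (carrier L) \<phi>"
  note bij = lie_isoD(1)[OF iso]
  have inv: "\<psi> y \<in> carrier L" "\<phi> (\<psi> y) = y" if "y \<in> carrier M" for y
    using that bij unfolding \<psi>_def bij_betw_def by (auto intro: inv_into_into f_inv_into_f)
  have eq: "\<psi> y = x" if "x \<in> carrier L" "\<phi> x = y" for x y
    using that bij unfolding \<psi>_def bij_betw_def by auto
  interpret L: lie_algebra L by fact
  have "\<psi> \<in> lie_hom M L"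
    unfolding lie_hom_def
    by (auto simp: inv lie_isoD[OF iso] L.bracket_closed ring_of_type_algebra_def
        intro!: eq L.smult_closed)
  moreover have "bij_betw \<psi> (carrier M) (carrier L)"
    unfolding \<psi>_def by (rule bij_betw_inv_into[OF bij])
  moreover have "\<psi> \<zero>\<^bsub>M\<^esub> = \<zero>\<^bsub>L\<^esub>"
    using lie_isoD(2)[OF iso] by (intro eq) auto
  ultimately show ?thesis
    unfolding lie_iso_def \<psi>_def by blast
qed

lemma lie_isomorphicI:
  assumes "lie_algebra L" and "lie_iso \<phi> L M"
  shows "lie_isomorphic M L"
  using lie_iso_inv[OF assms] lie_algebra_transfer[OF assms] assms(1)
  unfolding lie_isomorphic_def lie_iso_def by blast

section \<open>Transport of outer derivation algebras\<close>

text \<open>Conjugation by \<phi>, made extensional on the image so that it lands in the carrier of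
  \<open>Der\<close>.\<close>

definition conj_map :: "('v \<Rightarrow> 'w) \<Rightarrow> 'v set \<Rightarrow> ('v \<Rightarrow> 'v) \<Rightarrow> ('w \<Rightarrow> 'w)"
  where "conj_map \<phi> A D = (\<lambda>y\<in>\<phi> ` A. \<phi> (D (inv_into A \<phi> y)))"

lemma lie_iso_minus:
  assumes "lie_algebra L" and iso: "lie_iso \<phi> L M" and x: "x \<in> carrier L" and y: "y \<in> carrier L"
  shows "\<phi> (x \<ominus>\<^bsub>L\<^esub> y) = \<phi> x \<ominus>\<^bsub>M\<^esub> \<phi> y"
proof -
  interpret L: lie_algebra L by fact
  interpret M: lie_algebra M by (rule lie_algebra_transfer[OF assms(1,2)])
  have "\<phi> (\<ominus>\<^bsub>L\<^esub> y) \<oplus>\<^bsub>M\<^esub> \<phi> y = \<zero>\<^bsub>M\<^esub>"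
    using lie_isoD(2,4)[OF iso] L.M.l_neg[OF y] L.M.a_inv_closed[OF y] y by metis
  then have "\<ominus>\<^bsub>M\<^esub> \<phi> y = \<phi> (\<ominus>\<^bsub>L\<^esub> y)"
    using M.M.minus_equality lie_isoD(3)[OF iso] y by simp
  then show ?thesis
    unfolding a_minus_def using lie_isoD(4)[OF iso] x y by simp
qed

lemma Der_simps:
  "carrier (Der L) = {D \<in> carrier L \<rightarrow>\<^sub>E carrier L.
    (\<forall>x\<in>carrier L. \<forall>y\<in>carrier L. D (x \<oplus>\<^bsub>L\<^esub> y) = D x \<oplus>\<^bsub>L\<^esub> D y) \<and>
    (\<forall>c. \<forall>x\<in>carrier L. D (c \<odot>\<^bsub>L\<^esub> x) = c \<odot>\<^bsub>L\<^esub> D x) \<and>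
    (\<forall>x\<in>carrier L. \<forall>y\<in>carrier L.
      D (\<lbrakk>x, y\<rbrakk>\<^bsub>L\<^esub>) = \<lbrakk>D x, y\<rbrakk>\<^bsub>L\<^esub> \<oplus>\<^bsub>L\<^esub> \<lbrakk>x, D y\<rbrakk>\<^bsub>L\<^esub>)}"
  "\<zero>\<^bsub>Der L\<^esub> = (\<lambda>x\<in>carrier L. \<zero>\<^bsub>L\<^esub>)"
  "D \<oplus>\<^bsub>Der L\<^esub> E = (\<lambda>x\<in>carrier L. D x \<oplus>\<^bsub>L\<^esub> E x)"
  "c \<odot>\<^bsub>Der L\<^esub> D = (\<lambda>x\<in>carrier L. c \<odot>\<^bsub>L\<^esub> D x)"
  "\<lbrakk>D, E\<rbrakk>\<^bsub>Der L\<^esub> = (\<lambda>x\<in>carrier L. D (E x) \<ominus>\<^bsub>L\<^esub> E (D x))"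
  by (auto simp: Der_def general_linear_def)

lemma conj_map_apply:
  "inj_on \<phi> A \<Longrightarrow> x \<in> A \<Longrightarrow> conj_map \<phi> A D (\<phi> x) = \<phi> (D x)"
  by (simp add: conj_map_def)

lemma conj_map_eqI:
  assumes "inj_on \<phi> A" "E \<in> extensional (\<phi> ` A)" "\<And>x. x \<in> A \<Longrightarrow> E (\<phi> x) = \<phi> (D x)"
  shows "conj_map \<phi> A D = E"
proof (rule extensionalityI[of _ "\<phi> ` A"])
  show "conj_map \<phi> A D \<in> extensional (\<phi> ` A)" by (simp add: conj_map_def)
qed (use assms conj_map_apply in auto)

lemma conj_map_Der:
  assumes iso: "lie_iso \<phi> L M" and D: "D \<in> carrier (Der L)"
    and L: "lie_algebra L"
  shows "conj_map \<phi> (carrier L) D \<in> carrier (Der M)"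
proof -
  interpret L: lie_algebra L by fact
  have img: "carrier M = \<phi> ` carrier L" and inj: "inj_on \<phi> (carrier L)"
    using lie_isoD(1)[OF iso] by (auto simp: bij_betw_def)
  note hom = lie_isoD(4-6)[OF iso, symmetric]
  have "conj_map \<phi> (carrier L) D \<in> extensional (carrier M)"
    by (simp add: conj_map_def img)
  moreover have [simp]: "D x \<in> carrier L" if "x \<in> carrier L" for x
    using that D unfolding Der_simps by auto
  moreover have [simp]: "c \<odot>\<^bsub>L\<^esub> x \<in> carrier L" if "x \<in> carrier L" for c x
    using L.smult_closed that by (simp add: ring_of_type_algebra_def)
  ultimately show ?thesis
    using D unfolding Der_simps img
    by (auto simp: PiE_def Pi_def hom conj_map_apply[OF inj] L.bracket_closed)
qed

lemma lie_iso_Der: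
  assumes L: "lie_algebra L" and iso: "lie_iso \<phi> L M"
  shows "lie_iso (conj_map \<phi> (carrier L)) (Der L) (Der M)"
proof -
  interpret L: lie_algebra L by fact
  have M: "lie_algebra M" by (rule lie_algebra_transfer[OF L iso])
  have img: "carrier M = \<phi> ` carrier L" and inj: "inj_on \<phi> (carrier L)"
    using lie_isoD(1)[OF iso] by (auto simp: bij_betw_def)
  have closed: "D x \<in> carrier L" if "D \<in> carrier (Der L)" "x \<in> carrier L" for x D
    using that unfolding Der_simps by auto
  let ?\<psi> = "inv_into (carrier L) \<phi>"
  have iso': "lie_iso ?\<psi> M L" by (rule lie_iso_inv[OF L iso])
  have inj': "inj_on ?\<psi> (carrier M)" and img': "carrier L = ?\<psi> ` carrier M"
    using lie_isoD(1)[OF iso'] by (auto simp: bij_betw_def)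
  have "bij_betw (conj_map \<phi> (carrier L)) (carrier (Der L)) (carrier (Der M))"
  proof (rule bij_betw_byWitness[where f' = "conj_map ?\<psi> (carrier M)"])
    show "\<forall>D\<in>carrier (Der L). conj_map ?\<psi> (carrier M) (conj_map \<phi> (carrier L) D) = D"
    proof (intro ballI conj_map_eqI inj')
      fix D assume D: "D \<in> carrier (Der L)"
      then show "D \<in> extensional (?\<psi> ` carrier M)"
        unfolding img'[symmetric] Der_simps by (auto simp: PiE_def)
      fix y assume "y \<in> carrier M"
      then obtain x where x: "x \<in> carrier L" "y = \<phi> x" unfolding img by blast
      show "D (?\<psi> y) = ?\<psi> (conj_map \<phi> (carrier L) D y)"
        unfolding x(2) conj_map_apply[OF inj x(1)] inv_into_f_f[OF inj x(1)]
          inv_into_f_f[OF inj closed[OF D x(1)]] ..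
    qed
    show "\<forall>E\<in>carrier (Der M). conj_map \<phi> (carrier L) (conj_map ?\<psi> (carrier M) E) = E"
    proof (intro ballI conj_map_eqI inj)
      fix E assume E: "E \<in> carrier (Der M)"
      then show "E \<in> extensional (\<phi> ` carrier L)"
        unfolding img[symmetric] Der_simps by (auto simp: PiE_def)
      fix x assume x: "x \<in> carrier L"
      have "E (\<phi> x) \<in> carrier M"
        using E lie_isoD(3)[OF iso x] by (auto simp: Der_simps(1) PiE_def)
      then have "\<phi> (?\<psi> (E (\<phi> x))) = E (\<phi> x)" by (simp add: img f_inv_into_f)
      then show "E (\<phi> x) = \<phi> (conj_map ?\<psi> (carrier M) E x)"
        using conj_map_apply[OF inj' lie_isoD(3)[OF iso x], of E]
        by (simp add: inv_into_f_f[OF inj x])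
    qed
    show "conj_map \<phi> (carrier L) ` carrier (Der L) \<subseteq> carrier (Der M)"
      using conj_map_Der[OF iso _ L] by blast
    show "conj_map ?\<psi> (carrier M) ` carrier (Der M) \<subseteq> carrier (Der L)"
      using conj_map_Der[OF iso' _ M] by blast
  qed
  moreover have "conj_map \<phi> (carrier L) \<in> lie_hom (Der L) (Der M)"
    unfolding lie_hom_def
  proof (intro CollectI conjI funcsetI ballI allI)
    fix D assume D: "D \<in> carrier (Der L)"
    show "conj_map \<phi> (carrier L) D \<in> carrier (Der M)" by (rule conj_map_Der[OF iso D L])
    show "conj_map \<phi> (carrier L) (c \<odot>\<^bsub>Der L\<^esub> D) = c \<odot>\<^bsub>Der M\<^esub> conj_map \<phi> (carrier L) D" for c
      using closed[OF D] lie_isoD(3,5)[OF iso]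
      by (intro conj_map_eqI[OF inj]) (auto simp: Der_simps img conj_map_apply[OF inj])
    fix E assume E: "E \<in> carrier (Der L)"
    show "conj_map \<phi> (carrier L) (D \<oplus>\<^bsub>Der L\<^esub> E) =
        conj_map \<phi> (carrier L) D \<oplus>\<^bsub>Der M\<^esub> conj_map \<phi> (carrier L) E"
      using closed[OF D] closed[OF E] lie_isoD(3,4)[OF iso]
      by (intro conj_map_eqI[OF inj]) (auto simp: Der_simps img conj_map_apply[OF inj])
    show "conj_map \<phi> (carrier L) (\<lbrakk>D, E\<rbrakk>\<^bsub>Der L\<^esub>) =
        \<lbrakk>conj_map \<phi> (carrier L) D, conj_map \<phi> (carrier L) E\<rbrakk>\<^bsub>Der M\<^esub>"
      using closed[OF D] closed[OF E] lie_isoD(3)[OF iso] lie_iso_minus[OF L iso]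
      by (intro conj_map_eqI[OF inj]) (auto simp: Der_simps img conj_map_apply[OF inj])
  qed
  moreover have "conj_map \<phi> (carrier L) \<zero>\<^bsub>Der L\<^esub> = \<zero>\<^bsub>Der M\<^esub>"
    using lie_isoD(2,3)[OF iso]
    by (intro conj_map_eqI[OF inj]) (auto simp: Der_simps img)
  ultimately show ?thesis unfolding lie_iso_def by blast
qed

lemma conj_map_ad:
  assumes L: "lie_algebra L" and iso: "lie_iso \<phi> L M"
  shows "conj_map \<phi> (carrier L) ` (ad L ` carrier L) = ad M ` carrier M"
proof -
  interpret L: lie_algebra L by fact
  have img: "carrier M = \<phi> ` carrier L" and inj: "inj_on \<phi> (carrier L)"
    using lie_isoD(1)[OF iso] by (auto simp: bij_betw_def)
  have "conj_map \<phi> (carrier L) (ad L x) = ad M (\<phi> x)" if "x \<in> carrier L" for x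
    using that lie_isoD(3,6)[OF iso]
    by (intro conj_map_eqI[OF inj]) (auto simp: ad_def img)
  then show ?thesis unfolding img image_image by simp
qed

text \<open>The operations of \<open>lie_quotient\<close> are unions over representatives, and
  images commute with unions and with cosets; so the claim reduces to single elements.\<close>

lemma lie_iso_quotient:
  assumes iso: "lie_iso \<phi> L M" and I: "I \<subseteq> carrier L"
    and closed: "\<And>x y. x \<in> carrier L \<Longrightarrow> y \<in> carrier L \<Longrightarrow> x \<oplus>\<^bsub>L\<^esub> y \<in> carrier L"
      "\<And>c x. x \<in> carrier L \<Longrightarrow> c \<odot>\<^bsub>L\<^esub> x \<in> carrier L"
      "\<And>x y. x \<in> carrier L \<Longrightarrow> y \<in> carrier L \<Longrightarrow> \<lbrakk>x, y\<rbrakk>\<^bsub>L\<^esub> \<in> carrier L"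
  shows "lie_iso (image \<phi>) (lie_quotient L I) (lie_quotient M (\<phi> ` I))"
proof -
  have img: "carrier M = \<phi> ` carrier L" and inj: "inj_on \<phi> (carrier L)"
    using lie_isoD(1)[OF iso] by (auto simp: bij_betw_def)
  have coset: "\<phi> ` (I +>\<^bsub>L\<^esub> x) = \<phi> ` I +>\<^bsub>M\<^esub> \<phi> x" if "x \<in> carrier L" for x
    using that I lie_isoD(4)[OF iso] unfolding a_r_coset_def' by (auto simp: image_UN subset_eq)
  have sub: "A \<subseteq> carrier L" if "A \<in> a_rcosets\<^bsub>L\<^esub> I" for A
    using that I closed(1) unfolding A_RCOSETS_def' a_r_coset_def' by auto
  have "image \<phi> ` (a_rcosets\<^bsub>L\<^esub> I) = (\<lambda>x. \<phi> ` (I +>\<^bsub>L\<^esub> x)) ` carrier L"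
    unfolding A_RCOSETS_def' UNION_singleton_eq_range image_image ..
  also have "\<dots> = (\<lambda>x. \<phi> ` I +>\<^bsub>M\<^esub> \<phi> x) ` carrier L"
    by (rule image_cong[OF refl coset])
  also have "\<dots> = a_rcosets\<^bsub>M\<^esub> (\<phi> ` I)"
    unfolding A_RCOSETS_def' UNION_singleton_eq_range img image_image ..
  finally have "image \<phi> ` (a_rcosets\<^bsub>L\<^esub> I) = a_rcosets\<^bsub>M\<^esub> (\<phi> ` I)" .
  moreover have "inj_on (image \<phi>) (a_rcosets\<^bsub>L\<^esub> I)"
    by (rule inj_on_subset[OF inj_on_image_Pow[OF inj]]) (use sub in blast)
  ultimately have bij: "bij_betw (image \<phi>) (a_rcosets\<^bsub>L\<^esub> I) (a_rcosets\<^bsub>M\<^esub> (\<phi> ` I))"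
    by (simp add: bij_betw_def)
  moreover have "image \<phi> \<in> lie_hom (lie_quotient L I) (lie_quotient M (\<phi> ` I))"
    unfolding lie_hom_def
  proof (intro CollectI conjI funcsetI ballI allI)
    fix A assume "A \<in> carrier (lie_quotient L I)"
    then have A: "A \<in> a_rcosets\<^bsub>L\<^esub> I" by (simp add: lie_quotient_def)
    then show "\<phi> ` A \<in> carrier (lie_quotient M (\<phi> ` I))"
      using bij by (auto simp: lie_quotient_def bij_betw_def)
    have A': "x \<in> carrier L" if "x \<in> A" for x using sub[OF A] that by blast
    show "\<phi> ` (c \<odot>\<^bsub>lie_quotient L I\<^esub> A) = c \<odot>\<^bsub>lie_quotient M (\<phi> ` I)\<^esub> \<phi> ` A" for c
      by (simp add: lie_quotient_def image_UN coset closed lie_isoD(5)[OF iso] A')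
    fix B assume "B \<in> carrier (lie_quotient L I)"
    then have "B \<in> a_rcosets\<^bsub>L\<^esub> I" by (simp add: lie_quotient_def)
    then have B': "x \<in> carrier L" if "x \<in> B" for x using sub that by blast
    show "\<phi> ` (A \<oplus>\<^bsub>lie_quotient L I\<^esub> B) = \<phi> ` A \<oplus>\<^bsub>lie_quotient M (\<phi> ` I)\<^esub> \<phi> ` B"
      by (simp add: lie_quotient_def set_add_def' image_UN lie_isoD(4)[OF iso] A' B')
    show "\<phi> ` (\<lbrakk>A, B\<rbrakk>\<^bsub>lie_quotient L I\<^esub>) = \<lbrakk>\<phi> ` A, \<phi> ` B\<rbrakk>\<^bsub>lie_quotient M (\<phi> ` I)\<^esub>"
      by (simp add: lie_quotient_def image_UN coset closed lie_isoD(6)[OF iso] A' B')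
  qed
  ultimately show ?thesis unfolding lie_iso_def by (simp add: lie_quotient_def)
qed

section \<open>The outer derivation algebra\<close>

text \<open>The class of \<open>ham_outer n t\<close> modulo inner derivations, written out as a set
  of operators. As a function of t it is the isomorphism onto \<open>Out\<close>.\<close>

definition ham_coset ::
    "nat \<Rightarrow> (('f::field ^ 2 ^ 2) \<times> ('f ^ 2)) \<times> (nat \<Rightarrow> 'f) \<Rightarrow> ('f triple \<Rightarrow> 'f triple) set"
  where "ham_coset n t =
    (\<lambda>z. \<lambda>x\<in>ham_carrier n. ham_bracket z x + ham_outer n t x) ` ham_carrier n"

abbreviation ham_target :: "nat \<Rightarrow> ('f::field, (('f ^ 2 ^ 2) \<times> ('f ^ 2)) \<times> (nat \<Rightarrow> 'f)) lie_algebra"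
  where "ham_target m \<equiv> lie_direct_sum sl2_semidirect_V2 (abelian_lie_algebra m)"

text \<open>Module subtraction goes through an inverse given by a description, hence the detour over
  \<open>abelian_group\<close>.\<close>

lemma column_space_minus: "u \<ominus>\<^bsub>column_space\<^esub> v = u - v"
proof -
  have "abelian_group column_space"
    by (rule abelian_groupI) (auto simp: column_space_def intro: exI[of _ "- x" for x])
  then have "\<ominus>\<^bsub>column_space\<^esub> v = - v"
    by (rule abelian_group.minus_equality) (auto simp: column_space_def)
  then show ?thesis by (simp add: a_minus_def column_space_def)
qed

lemma column_space_simps:
  "carrier column_space = UNIV" "\<zero>\<^bsub>column_space\<^esub> = 0"
  "v \<oplus>\<^bsub>column_space\<^esub> u = v + u" "c \<odot>\<^bsub>column_space\<^esub> v = c *s v"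
  by (simp_all add: column_space_def)

lemma ham_target_simps:
  "carrier (ham_target m) = {((A, v), s). trace A = 0 \<and> (\<forall>i\<ge>m. s i = 0)}"
  "\<zero>\<^bsub>ham_target m\<^esub> = ((0, 0), \<lambda>_. 0)"
  "((A, v), s) \<oplus>\<^bsub>ham_target m\<^esub> ((B, u), r) = ((A + B, v + u), \<lambda>i. s i + r i)"
  "c \<odot>\<^bsub>ham_target m\<^esub> ((A, v), s) = ((\<chi> i j. c * A $ i $ j, c *s v), \<lambda>i. c * s i)"
  "\<lbrakk>((A, v), s), ((B, u), r)\<rbrakk>\<^bsub>ham_target m\<^esub> = ((A ** B - B ** A, A *v u - B *v v), \<lambda>_. 0)"
proof -
  show "carrier (ham_target m) = {((A, v), s). trace A = 0 \<and> (\<forall>i\<ge>m. s i = 0)}"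
    by (simp add: sl2_semidirect_V2_def lie_direct_sum_def lie_semidirect_def column_space_simps
        special_linear_def abelian_lie_algebra_def set_eq_iff mem_Times_iff split_beta)
  show "\<zero>\<^bsub>ham_target m\<^esub> = ((0, 0), \<lambda>_. 0)"
    by (simp add: sl2_semidirect_V2_def lie_direct_sum_def lie_semidirect_def column_space_simps
        special_linear_def abelian_lie_algebra_def)
  show "((A, v), s) \<oplus>\<^bsub>ham_target m\<^esub> ((B, u), r) = ((A + B, v + u), \<lambda>i. s i + r i)"
    by (simp add: sl2_semidirect_V2_def lie_direct_sum_def lie_semidirect_def column_space_simps
        special_linear_def abelian_lie_algebra_def)
  show "c \<odot>\<^bsub>ham_target m\<^esub> ((A, v), s) = ((\<chi> i j. c * A $ i $ j, c *s v), \<lambda>i. c * s i)"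
    by (simp add: sl2_semidirect_V2_def lie_direct_sum_def lie_semidirect_def column_space_simps
        special_linear_def abelian_lie_algebra_def)
  show "\<lbrakk>((A, v), s), ((B, u), r)\<rbrakk>\<^bsub>ham_target m\<^esub> = ((A ** B - B ** A, A *v u - B *v v), \<lambda>_. 0)"
    by (simp add: sl2_semidirect_V2_def lie_direct_sum_def lie_semidirect_def column_space_minus
        special_linear_def abelian_lie_algebra_def)
qed

lemma trace_commutator: "trace (A ** B - B ** A) = (0 :: 'f::field)"
  unfolding trace_sub trace_mul_sym[of A B] by simp

lemma matrix_diff_ldistrib: "A ** (B - C) = A ** B - A ** (C :: 'a::ring_1 ^ 'n ^ 'm)"
  by (vector matrix_matrix_mult_def sum_subtractf[symmetric] algebra_simps)

lemma matrix_diff_rdistrib: "(A - B) ** C = A ** C - B ** (C :: 'a::ring_1 ^ 'n ^ 'm)"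
  by (vector matrix_matrix_mult_def sum_subtractf[symmetric] algebra_simps)

lemma lie_algebra_ham_target:
  "lie_algebra (ham_target m :: ('f::field, (('f ^ 2 ^ 2) \<times> ('f ^ 2)) \<times> (nat \<Rightarrow> 'f)) lie_algebra)"
  (is "lie_algebra ?T")
proof -
  note [simp] = ham_target_simps
  have "abelian_group ?T"
  proof (rule abelian_groupI)
    fix x assume "x \<in> carrier ?T"
    then obtain A v s where "x = ((A, v), s)" "trace A = 0" "\<forall>i\<ge>m. s i = 0" by auto
    then show "\<exists>y\<in>carrier ?T. y \<oplus>\<^bsub>?T\<^esub> x = \<zero>\<^bsub>?T\<^esub>"
      by (intro bexI[of _ "((- A, - v), \<lambda>i. - s i)"]) (auto simp: trace_def sum_negf)
  qed (auto simp: trace_add algebra_simps, simp add: trace_def)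
  then have "Module.module (ring_of_type_algebra :: 'f ring) ?T"
  proof (intro moduleI cring_from_type_algebra)
    show "c \<odot>\<^bsub>?T\<^esub> x \<in> carrier ?T" if "x \<in> carrier ?T" for c :: 'f and x
      using that by (auto simp: trace_def sum_distrib_left[symmetric])
  qed (auto simp: ring_of_type_algebra_def vec_eq_iff algebra_simps)
  moreover have "lie_algebra_axioms ?T"
  proof
    fix x y z and c :: 'f assume "x \<in> carrier ?T" "y \<in> carrier ?T"
    then obtain A v s B u r where xy: "x = ((A, v), s)" "y = ((B, u), r)" "trace A = 0" "trace B = 0"
      by auto
    show "\<lbrakk>x, y\<rbrakk>\<^bsub>?T\<^esub> \<in> carrier ?T" "\<lbrakk>x, x\<rbrakk>\<^bsub>?T\<^esub> = \<zero>\<^bsub>?T\<^esub>"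
      by (simp_all add: xy trace_commutator)
    show "\<lbrakk>c \<odot>\<^bsub>?T\<^esub> x, y\<rbrakk>\<^bsub>?T\<^esub> = c \<odot>\<^bsub>?T\<^esub> \<lbrakk>x, y\<rbrakk>\<^bsub>?T\<^esub>"
      "\<lbrakk>x, c \<odot>\<^bsub>?T\<^esub> y\<rbrakk>\<^bsub>?T\<^esub> = c \<odot>\<^bsub>?T\<^esub> \<lbrakk>x, y\<rbrakk>\<^bsub>?T\<^esub>"
      by (simp_all add: xy matrix_matrix_mult_def matrix_vector_mult_def vec_eq_iff sum_2 algebra_simps)
    assume "z \<in> carrier ?T"
    then obtain C w t where z: "z = ((C, w), t)" by auto
    show "\<lbrakk>x \<oplus>\<^bsub>?T\<^esub> y, z\<rbrakk>\<^bsub>?T\<^esub> = \<lbrakk>x, z\<rbrakk>\<^bsub>?T\<^esub> \<oplus>\<^bsub>?T\<^esub> \<lbrakk>y, z\<rbrakk>\<^bsub>?T\<^esub>"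
      "\<lbrakk>x, y \<oplus>\<^bsub>?T\<^esub> z\<rbrakk>\<^bsub>?T\<^esub> = \<lbrakk>x, y\<rbrakk>\<^bsub>?T\<^esub> \<oplus>\<^bsub>?T\<^esub> \<lbrakk>x, z\<rbrakk>\<^bsub>?T\<^esub>"
      by (simp_all add: xy z matrix_matrix_mult_def matrix_vector_mult_def vec_eq_iff sum_2 algebra_simps)
    show "\<lbrakk>x, \<lbrakk>y, z\<rbrakk>\<^bsub>?T\<^esub>\<rbrakk>\<^bsub>?T\<^esub> \<oplus>\<^bsub>?T\<^esub> \<lbrakk>y, \<lbrakk>z, x\<rbrakk>\<^bsub>?T\<^esub>\<rbrakk>\<^bsub>?T\<^esub> \<oplus>\<^bsub>?T\<^esub> \<lbrakk>z, \<lbrakk>x, y\<rbrakk>\<^bsub>?T\<^esub>\<rbrakk>\<^bsub>?T\<^esub> = \<zero>\<^bsub>?T\<^esub>"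
      by (simp add: xy z matrix_diff_ldistrib matrix_diff_rdistrib matrix_mul_assoc
          matrix_vector_mult_diff_distrib matrix_vector_mult_diff_rdistrib matrix_vector_mul_assoc)
  qed
  ultimately show ?thesis by (rule lie_algebra.intro)
qed

lemma ham_outer_smult_left:
  "ham_outer n ((\<chi> i j. c * A $ i $ j, c *s v), \<lambda>i. c * s i) x =
    triple_smult c (ham_outer n ((A, v), s) x)"
proof -
  have frob: "dps_frob n (\<lambda>i. c * s i) f = dps_const c * dps_frob n s f" for f
    by (simp add: dps_frob_def dps_const_mult sum_distrib_left mult.assoc del: power_Suc)
  have top: "triple_top n (c *s v) = triple_smult c (triple_top n v)"
    by (simp add: triple_top_def dps_const_mult mult.assoc)
  have "triple_map (dps_frob n (\<lambda>i. c * s i)) x = triple_smult c (triple_map (dps_frob n s) x)"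
    "triple_act (\<chi> i j. c * A $ i $ j) x = triple_smult c (triple_act A x)"
    by (cases x; simp add: frob dps_const_mult algebra_simps)+
  then show ?thesis
    by (simp add: ham_outer_def top ham_bracket_smult_left triple_smult_add)
qed

section \<open>Cosets of the inner derivations\<close>

context ham_outer_derivations
begin

abbreviation M :: "('f, 'f triple) lie_algebra" where "M \<equiv> ham_triples n"
abbreviation T :: "('f, (('f ^ 2 ^ 2) \<times> ('f ^ 2)) \<times> (nat \<Rightarrow> 'f)) lie_algebra"
  where "T \<equiv> ham_target (n - 1)"

lemma minus_M: "x \<in> C \<Longrightarrow> y \<in> C \<Longrightarrow> x \<ominus>\<^bsub>M\<^esub> y = x - y"
proof -
  interpret lie_algebra M by (rule lie_algebra_ham_triples[OF three])
  assume "y \<in> C"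
  then have "\<ominus>\<^bsub>M\<^esub> y = - y"
    using M.minus_equality[of "- y" y] by (simp add: ham_carrier_minus)
  then show ?thesis by (simp add: a_minus_def)
qed

lemma carrier_Der: "D \<in> carrier (Der M) \<longleftrightarrow> D \<in> extensional C \<and> ham_derivation n D"
  unfolding Der_simps ham_derivation_def by (auto simp: PiE_def)

lemma ham_derivation_restrict:
  assumes "ham_derivation n D"
  shows "ham_derivation n (restrict D C)"
  using ham_derivationD[OF assms]
  by (simp add: ham_derivation_def ham_carrier_add ham_carrier_smult bracket_closed)

lemma Der_closed:
  assumes "D \<in> carrier (Der M)" "E \<in> carrier (Der M)"
  shows "D \<oplus>\<^bsub>Der M\<^esub> E \<in> carrier (Der M)" "c \<odot>\<^bsub>Der M\<^esub> D \<in> carrier (Der M)"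
    "\<lbrakk>D, E\<rbrakk>\<^bsub>Der M\<^esub> \<in> carrier (Der M)"
proof -
  have D: "ham_derivation n D" and E: "ham_derivation n E" using assms carrier_Der by auto
  have bracket: "\<lbrakk>D, E\<rbrakk>\<^bsub>Der M\<^esub> = (\<lambda>x\<in>C. D (E x) - E (D x))"
    unfolding Der_simps ham_triples_simps by (rule restrict_ext)
      (simp add: minus_M ham_derivationD(1)[OF D] ham_derivationD(1)[OF E])
  show "D \<oplus>\<^bsub>Der M\<^esub> E \<in> carrier (Der M)" "c \<odot>\<^bsub>Der M\<^esub> D \<in> carrier (Der M)"
    unfolding carrier_Der Der_simps(3,4) ham_triples_simps
    by (intro conjI restrict_extensional ham_derivation_restrict ham_derivation_add
        ham_derivation_smult D E)+
  show "\<lbrakk>D, E\<rbrakk>\<^bsub>Der M\<^esub> \<in> carrier (Der M)"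
    unfolding carrier_Der bracket
    by (intro conjI restrict_extensional ham_derivation_restrict ham_derivation_commutator three D E)
qed

lemma inner_Der: "z \<in> C \<Longrightarrow> ad M z \<in> carrier (Der M)"
  unfolding carrier_Der ad_def ham_triples_simps
  by (intro conjI restrict_extensional ham_derivation_restrict ham_derivation_inner)

text \<open>Changing \<open>D\<close> by the bracket with z translates the index set
  \<open>C\<close> of the inner derivations by z, which permutes it.\<close>

lemma coset_eq:
  assumes "z \<in> C" "\<And>x. x \<in> C \<Longrightarrow> D x = ham_bracket z x + ham_outer n t x"
  shows "ad M ` carrier M +>\<^bsub>Der M\<^esub> D = ham_coset n t"
proof -
  let ?g = "\<lambda>z. \<lambda>x\<in>C. ham_bracket z x + ham_outer n t x"
  have "ad M ` carrier M +>\<^bsub>Der M\<^esub> D = (\<lambda>y. ad M y \<oplus>\<^bsub>Der M\<^esub> D) ` C"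
    unfolding a_r_coset_def' by auto
  also have "\<dots> = (\<lambda>y. ?g (y + z)) ` C"
  proof (rule image_cong[OF refl])
    fix y
    show "ad M y \<oplus>\<^bsub>Der M\<^esub> D = ?g (y + z)"
      unfolding Der_simps ham_triples_simps
      by (rule restrict_ext) (simp add: ad_def assms(2) ham_bracket_add_left add.assoc)
  qed
  also have "\<dots> = ?g ` (\<lambda>y. y + z) ` C" by (simp add: image_image)
  also have "(\<lambda>y. y + z) ` C = C"
  proof
    show "C \<subseteq> (\<lambda>y. y + z) ` C"
    proof
      fix y assume "y \<in> C"
      then show "y \<in> (\<lambda>y. y + z) ` C"
        using assms(1) by (intro image_eqI[of _ _ "y - z"] ham_carrier_diff) simp_all
    qed
  qed (intro image_subsetI ham_carrier_add assms(1))
  finally show ?thesis unfolding ham_coset_def .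
qed

lemma in_cosetD:
  assumes "D \<in> ham_coset n t"
  obtains z where "z \<in> C" "\<And>x. x \<in> C \<Longrightarrow> D x = ham_bracket z x + ham_outer n t x"
  using assms unfolding ham_coset_def by auto

lemma outer_in_coset: "restrict (ham_outer n t) C \<in> ham_coset n t"
  unfolding ham_coset_def by (intro image_eqI[of _ _ 0]) auto

lemma outer_Der: "((A, v), s) \<in> carrier T \<Longrightarrow> restrict (ham_outer n ((A, v), s)) C \<in> carrier (Der M)"
  unfolding carrier_Der ham_target_simps
  by (intro conjI restrict_extensional ham_derivation_restrict ham_derivation_outer) simp

lemma coset_outer:
  "ham_coset n t = ad M ` carrier M +>\<^bsub>Der M\<^esub> restrict (ham_outer n t) C"
  by (rule coset_eq[of 0, symmetric]) simp_all

lemma ham_coset_add: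
  "ham_coset n (((A, v), s) \<oplus>\<^bsub>T\<^esub> ((B, u), r)) =
    ham_coset n ((A, v), s) <+>\<^bsub>Der M\<^esub> ham_coset n ((B, u), r)" (is "?L = ?R")
proof
  let ?\<Phi> = "ham_outer n"
  show "?R \<subseteq> ?L"
  proof
    fix D assume "D \<in> ?R"
    then obtain z y where zy: "z \<in> C" "y \<in> C"
      "D = (\<lambda>x\<in>C. ham_bracket z x + ?\<Phi> ((A, v), s) x) \<oplus>\<^bsub>Der M\<^esub>
        (\<lambda>x\<in>C. ham_bracket y x + ?\<Phi> ((B, u), r) x)"
      unfolding set_add_def' ham_coset_def by auto
    have "D = (\<lambda>x\<in>C. ham_bracket (z + y) x + ?\<Phi> (((A, v), s) \<oplus>\<^bsub>T\<^esub> ((B, u), r)) x)"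
      unfolding zy(3) Der_simps ham_triples_simps ham_target_simps
      by (rule restrict_ext) (simp add: ham_bracket_add_left ham_outer_add_left)
    then show "D \<in> ?L"
      unfolding ham_coset_def using ham_carrier_add[OF zy(1,2)] by (rule image_eqI)
  qed
  show "?L \<subseteq> ?R"
  proof
    fix D assume "D \<in> ?L"
    then obtain z where z: "z \<in> C"
      "D = (\<lambda>x\<in>C. ham_bracket z x + ?\<Phi> (((A, v), s) \<oplus>\<^bsub>T\<^esub> ((B, u), r)) x)"
      unfolding ham_coset_def by auto
    have "D = (\<lambda>x\<in>C. ham_bracket z x + ?\<Phi> ((A, v), s) x) \<oplus>\<^bsub>Der M\<^esub>
        restrict (?\<Phi> ((B, u), r)) C"
      unfolding z(2) Der_simps ham_triples_simps ham_target_simps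
      by (rule restrict_ext) (simp add: ham_outer_add_left)
    moreover have "(\<lambda>x\<in>C. ham_bracket z x + ?\<Phi> ((A, v), s) x) \<in> ham_coset n ((A, v), s)"
      unfolding ham_coset_def using z(1) by blast
    ultimately show "D \<in> ?R"
      unfolding set_add_def' using outer_in_coset by blast
  qed
qed

text \<open>All members of the union are the same coset by \<open>coset_eq\<close>, and the index
  set is nonempty, so the union collapses.\<close>

lemma ham_coset_smult:
  "ham_coset n (c \<odot>\<^bsub>T\<^esub> ((A, v), s)) =
    (\<Union>D\<in>ham_coset n ((A, v), s). ad M ` carrier M +>\<^bsub>Der M\<^esub> (c \<odot>\<^bsub>Der M\<^esub> D))"
proof (rule sym, rule UN_constant_eq[OF outer_in_coset], rule ballI)
  fix D assume "D \<in> ham_coset n ((A, v), s)"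
  then obtain z where z: "z \<in> C" "\<And>x. x \<in> C \<Longrightarrow> D x = ham_bracket z x + ham_outer n ((A, v), s) x"
    by (rule in_cosetD) blast
  show "ad M ` carrier M +>\<^bsub>Der M\<^esub> (c \<odot>\<^bsub>Der M\<^esub> D) = ham_coset n (c \<odot>\<^bsub>T\<^esub> ((A, v), s))"
  proof (rule coset_eq)
    show "triple_smult c z \<in> C" using z(1) by (rule ham_carrier_smult)
    show "(c \<odot>\<^bsub>Der M\<^esub> D) x = ham_bracket (triple_smult c z) x + ham_outer n (c \<odot>\<^bsub>T\<^esub> ((A, v), s)) x"
      if "x \<in> C" for x
      using that by (simp add: Der_simps ham_target_simps z(2) ham_outer_smult_left
          ham_bracket_smult_left triple_smult_add)
  qed
qed

lemma ham_coset_bracket: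
  assumes "trace A = 0" "trace B = 0"
  shows "ham_coset n (\<lbrakk>((A, v), s), ((B, u), r)\<rbrakk>\<^bsub>T\<^esub>) =
    (\<Union>D\<in>ham_coset n ((A, v), s). \<Union>E\<in>ham_coset n ((B, u), r).
      ad M ` carrier M +>\<^bsub>Der M\<^esub> \<lbrakk>D, E\<rbrakk>\<^bsub>Der M\<^esub>)"
proof -
  let ?\<Phi> = "ham_outer n ((A, v), s)" and ?\<Psi> = "ham_outer n ((B, u), r)"
  have *: "ad M ` carrier M +>\<^bsub>Der M\<^esub> \<lbrakk>D, E\<rbrakk>\<^bsub>Der M\<^esub> = ham_coset n (\<lbrakk>((A, v), s), ((B, u), r)\<rbrakk>\<^bsub>T\<^esub>)"
    if "D \<in> ham_coset n ((A, v), s)" "E \<in> ham_coset n ((B, u), r)" for D E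
  proof -
    from that
    obtain z z' where z: "z \<in> C" "\<And>x. x \<in> C \<Longrightarrow> D x = ham_bracket z x + ?\<Phi> x"
      and z': "z' \<in> C" "\<And>x. x \<in> C \<Longrightarrow> E x = ham_bracket z' x + ?\<Psi> x"
      by (metis in_cosetD)
    obtain y where y: "y \<in> C" "\<And>x :: 'f triple. ?\<Phi> (?\<Psi> x) - ?\<Psi> (?\<Phi> x) =
        ham_outer n ((A ** B - B ** A, A *v u - B *v v), \<lambda>_. 0) x + ham_bracket y x"
      using ham_outer_commutator[OF assms] by metis
    note \<Phi> = ham_derivationD[OF ham_derivation_outer[OF assms(1)]]
    note \<Psi> = ham_derivationD[OF ham_derivation_outer[OF assms(2)]]
    show ?thesis
    proof (rule coset_eq)
      \<comment> \<open>From [ad z + \<Phi>, ad z' + \<Psi>] = ad [z, z'] + ad (\<Phi> z') - ad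
        (\<Psi> z) + [\<Phi>, \<Psi>]; y is the inner part of the last commutator.\<close>
      let ?w = "ham_bracket z z' + ?\<Phi> z' - ?\<Psi> z + y"
      show "?w \<in> C"
        by (intro ham_carrier_add ham_carrier_diff bracket_closed \<Phi>(1) \<Psi>(1) z(1) z'(1) y(1))
      fix x :: "'f triple" assume x: "x \<in> C"
      have in_C: "ham_bracket z x \<in> C" "ham_bracket z' x \<in> C" "?\<Phi> x \<in> C" "?\<Psi> x \<in> C"
        using x z(1) z'(1) by (auto intro: bracket_closed \<Phi>(1) \<Psi>(1) simp del: ham_carrier_iff)
      have DE: "D (E x) = ham_bracket z (ham_bracket z' x) + ham_bracket z (?\<Psi> x) +
          (ham_bracket (?\<Phi> z') x + ham_bracket z' (?\<Phi> x)) + ?\<Phi> (?\<Psi> x)"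
        using x in_C z(1) z'(1) \<Phi>(2)[OF in_C(2,4)] \<Phi>(4)[OF z'(1) x]
        by (simp add: z(2) z'(2) ham_carrier_add ham_bracket_add_right)
      have ED: "E (D x) = ham_bracket z' (ham_bracket z x) + ham_bracket z' (?\<Phi> x) +
          (ham_bracket (?\<Psi> z) x + ham_bracket z (?\<Psi> x)) + ?\<Psi> (?\<Phi> x)"
        using x in_C z(1) z'(1) \<Psi>(2)[OF in_C(1,3)] \<Psi>(4)[OF z(1) x]
        by (simp add: z(2) z'(2) ham_carrier_add ham_bracket_add_right)
      have "\<lbrakk>D, E\<rbrakk>\<^bsub>Der M\<^esub> x = D (E x) - E (D x)"
      proof -
        have "D (E x) \<in> C" "E (D x) \<in> C"
          using in_C z(1) z'(1) x
          by (simp_all add: z(2) z'(2) ham_carrier_add bracket_closed \<Phi>(1) \<Psi>(1))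
        then show ?thesis using x by (simp add: Der_simps minus_M)
      qed
      also have "\<dots> =
          (ham_bracket z (ham_bracket z' x) - ham_bracket z' (ham_bracket z x)) +
          ham_bracket (?\<Phi> z') x - ham_bracket (?\<Psi> z) x + (?\<Phi> (?\<Psi> x) - ?\<Psi> (?\<Phi> x))"
        unfolding DE ED by (simp add: algebra_simps)
      also have "ham_bracket z (ham_bracket z' x) - ham_bracket z' (ham_bracket z x) =
          ham_bracket (ham_bracket z z') x"
        unfolding ham_bracket_jacobi[OF three, of z z' x] by (rule add_diff_cancel_right')
      finally show "\<lbrakk>D, E\<rbrakk>\<^bsub>Der M\<^esub> x =
          ham_bracket ?w x + ham_outer n (\<lbrakk>((A, v), s), ((B, u), r)\<rbrakk>\<^bsub>T\<^esub>) x"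
        unfolding y(2) ham_target_simps ham_bracket_add_left ham_bracket_diff_left
        by (simp add: algebra_simps)
    qed
  qed
  have "(\<Union>E\<in>ham_coset n ((B, u), r). ad M ` carrier M +>\<^bsub>Der M\<^esub> \<lbrakk>D, E\<rbrakk>\<^bsub>Der M\<^esub>) =
      ham_coset n (\<lbrakk>((A, v), s), ((B, u), r)\<rbrakk>\<^bsub>T\<^esub>)" if "D \<in> ham_coset n ((A, v), s)" for D
    by (rule UN_constant_eq[OF outer_in_coset ballI[OF *[OF that]]])
  from UN_constant_eq[OF outer_in_coset ballI[OF this], symmetric] show ?thesis .
qed

lemma lie_iso_Out_ham_triples: "lie_iso (ham_coset n) T (Out M)"
  unfolding lie_iso_def
proof (intro conjI)
  have coset_in: "ham_coset n t \<in> a_rcosets\<^bsub>Der M\<^esub> (ad M ` carrier M)" if "t \<in> carrier T" for t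
  proof -
    obtain A v s where "t = ((A, v), s)" by (metis prod.collapse)
    with that outer_Der show ?thesis
      unfolding coset_outer A_RCOSETS_def' by blast
  qed
  show "ham_coset n \<in> lie_hom T (Out M)"
    unfolding lie_hom_def
  proof (intro CollectI conjI funcsetI ballI allI)
    fix t assume t: "t \<in> carrier T"
    then obtain A v s where t_eq: "t = ((A, v), s)" "trace A = 0"
      by (auto simp: ham_target_simps(1))
    show "ham_coset n t \<in> carrier (Out M)"
      using coset_in[OF t] by (simp add: Out_def lie_quotient_def)
    show "ham_coset n (c \<odot>\<^bsub>T\<^esub> t) = c \<odot>\<^bsub>Out M\<^esub> ham_coset n t" for c
      unfolding t_eq ham_coset_smult by (simp add: Out_def lie_quotient_def)
    fix t' assume "t' \<in> carrier T"
    then obtain B u r where t'_eq: "t' = ((B, u), r)" "trace B = 0"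
      by (auto simp: ham_target_simps(1))
    show "ham_coset n (t \<oplus>\<^bsub>T\<^esub> t') = ham_coset n t \<oplus>\<^bsub>Out M\<^esub> ham_coset n t'"
      unfolding t_eq t'_eq ham_coset_add by (simp add: Out_def lie_quotient_def)
    show "ham_coset n (\<lbrakk>t, t'\<rbrakk>\<^bsub>T\<^esub>) = \<lbrakk>ham_coset n t, ham_coset n t'\<rbrakk>\<^bsub>Out M\<^esub>"
      unfolding t_eq(1) t'_eq(1) ham_coset_bracket[OF t_eq(2) t'_eq(2)]
      by (simp add: Out_def lie_quotient_def)
  qed
  show "bij_betw (ham_coset n) (carrier T) (carrier (Out M))"
    unfolding bij_betw_def
  proof
    show "inj_on (ham_coset n) (carrier T)"
    proof (rule inj_onI)
      fix t t' assume "t \<in> carrier T" "t' \<in> carrier T" and eq: "ham_coset n t = ham_coset n t'"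
      then obtain A v s B u r where t: "t = ((A, v), s)" "\<And>i. i \<ge> n - 1 \<Longrightarrow> s i = 0"
        and t': "t' = ((B, u), r)" "\<And>i. i \<ge> n - 1 \<Longrightarrow> r i = 0"
        unfolding ham_target_simps by auto
      obtain z where z: "z \<in> C"
        "\<And>x. x \<in> C \<Longrightarrow> restrict (ham_outer n t) C x = ham_bracket z x + ham_outer n t' x"
        using outer_in_coset[of t] unfolding eq by (rule in_cosetD) blast
      have "ham_outer n ((A - B, v - u), \<lambda>i. s i - r i) x = ham_bracket z x" if "x \<in> C" for x
        using z(2)[OF that] that ham_outer_add_left[of n "A - B" B "v - u" u "\<lambda>i. s i - r i" r x]
        by (simp add: t(1) t'(1))
      note * = outer_inner_zero[OF _ z(1) this]
      have "A - B = 0" "v - u = 0" "(\<lambda>i. s i - r i) = (\<lambda>_. 0)"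
        by (rule *; simp add: t(2) t'(2))+
      then show "t = t'" unfolding t(1) t'(1) by (simp add: fun_eq_iff)
    qed
    have "a_rcosets\<^bsub>Der M\<^esub> (ad M ` carrier M) \<subseteq> ham_coset n ` carrier T"
    proof
      fix S assume "S \<in> a_rcosets\<^bsub>Der M\<^esub> (ad M ` carrier M)"
      then obtain D where D: "D \<in> carrier (Der M)" "S = ad M ` carrier M +>\<^bsub>Der M\<^esub> D"
        unfolding A_RCOSETS_def' by auto
      then have "outer_plus_inner D" using derivation_outer_plus_inner carrier_Der by blast
      then obtain A v s z where *: "trace A = 0" "\<forall>i\<ge>n - 1. s i = 0" "z \<in> C"
        "\<And>x. x \<in> C \<Longrightarrow> D x = ham_outer n ((A, v), s) x + ham_bracket z x"
        unfolding outer_plus_inner_def by blast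
      have "S = ham_coset n ((A, v), s)"
        unfolding D(2) by (rule coset_eq[OF *(3)]) (simp add: *(4) add.commute)
      moreover have "((A, v), s) \<in> carrier T" unfolding ham_target_simps using * by simp
      ultimately show "S \<in> ham_coset n ` carrier T" by blast
    qed
    with coset_in show "ham_coset n ` carrier T = carrier (Out M)"
      by (auto simp: Out_def lie_quotient_def)
  qed
  show "ham_coset n \<zero>\<^bsub>T\<^esub> = \<zero>\<^bsub>Out M\<^esub>"
    unfolding ham_target_simps ham_coset_def
    by (simp add: Out_def lie_quotient_def ham_outer_def ad_def)
qed

end

lemma lie_isomorphic_OutI:
  fixes H :: "('f::field, 'v, 'm) lie_algebra_scheme"
  assumes "CHAR('f) = 3" "n > 1" and iso: "lie_iso \<phi> (ham_triples n) H"
  shows "lie_isomorphic (Out H) (ham_target (n - 1))"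
proof -
  interpret ham_outer_derivations n "TYPE('f)" by unfold_locales (use assms in auto)
  have M: "lie_algebra M" by (rule lie_algebra_ham_triples[OF three])
  have "lie_iso (image (conj_map \<phi> (carrier M))) (Out M) (Out H)"
    unfolding Out_def conj_map_ad[OF M iso, symmetric]
  proof (rule lie_iso_quotient[OF lie_iso_Der[OF M iso] _ Der_closed])
    show "ad M ` carrier M \<subseteq> carrier (Der M)"
      by (rule image_subsetI, rule inner_Der) simp
  qed
  from lie_iso_comp[OF lie_iso_Out_ham_triples this] show ?thesis
    by (rule lie_isomorphicI[OF lie_algebra_ham_target])
qed

section \<open>Divided power series in two variables\<close>

text \<open>In \<open>'f dps dps\<close> the outer index is the exponent of x and the inner one that
  of y: \<open>dps_deriv\<close> is the derivative in x, this one the derivative in y.\<close>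

definition dps_inner_deriv :: "'f::comm_ring_1 dps dps \<Rightarrow> 'f dps dps"
  where "dps_inner_deriv F = Abs_dps (\<lambda>i. dps_deriv (dps_nth F i))"

definition poisson :: "'f::comm_ring_1 dps dps \<Rightarrow> 'f dps dps \<Rightarrow> 'f dps dps"
  where "poisson F G = dps_deriv F * dps_inner_deriv G - dps_inner_deriv F * dps_deriv G"

definition dps_box :: "nat \<Rightarrow> nat \<Rightarrow> 'f::comm_ring_1 dps dps set"
  where "dps_box p q = {F. F \<in> dps_below p \<and> (\<forall>i. dps_nth F i \<in> dps_below q)}"

lemma dps_nth_inner_deriv [simp]: "dps_nth (dps_inner_deriv F) i = dps_deriv (dps_nth F i)"
  by (simp add: dps_inner_deriv_def)

lemma dps_deriv_of_nat [simp]: "dps_deriv (of_nat c) = 0"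
  unfolding dps_const_of_nat[symmetric] by simp

lemma dps_deriv_sum: "dps_deriv (sum f A) = (\<Sum>i\<in>A. dps_deriv (f i))"
  by (induction A rule: infinite_finite_induct) (simp_all add: dps_deriv_add)

lemma dps_inner_deriv_simps:
  "dps_inner_deriv (F + G) = dps_inner_deriv F + dps_inner_deriv G"
  "dps_inner_deriv (F - G) = dps_inner_deriv F - dps_inner_deriv G"
  "dps_inner_deriv (F * G) = dps_inner_deriv F * G + F * dps_inner_deriv G"
  by (rule dps_eqI; simp add: dps_deriv_add dps_deriv_diff times_dps.rep_eq dps_deriv_sum
      dps_deriv_mult sum.distrib distrib_left)+

lemma dps_inner_deriv_deriv: "dps_inner_deriv (dps_deriv F) = dps_deriv (dps_inner_deriv F)"
  by (rule dps_eqI) simp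

lemma poisson_jacobi:
  "poisson F (poisson G H) - poisson G (poisson F H) = poisson (poisson F G) H"
  by (simp add: poisson_def dps_deriv_simps dps_inner_deriv_simps dps_inner_deriv_deriv algebra_simps)

lemma dps_below_sum: "(\<And>i. i \<in> A \<Longrightarrow> f i \<in> dps_below q) \<Longrightarrow> sum f A \<in> dps_below q"
  by (induction A rule: infinite_finite_induct) (simp_all add: dps_below_add)

lemma dps_box_diff: "F \<in> dps_box p q \<Longrightarrow> G \<in> dps_box p q \<Longrightarrow> F - G \<in> dps_box p q"
  and dps_box_deriv: "F \<in> dps_box p q \<Longrightarrow> dps_deriv F \<in> dps_box p q"
  and dps_box_inner_deriv: "F \<in> dps_box p q \<Longrightarrow> dps_inner_deriv F \<in> dps_box p q"
  by (auto simp: dps_box_def dps_below_def)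

text \<open>Both bounds are powers of 3, so \<open>dps_below_mult\<close> applies twice: in x, with
  exponent 1 and coefficient ring \<open>'f dps\<close>, and in y to each coefficient of the
  product.\<close>

lemma dps_box_mult:
  assumes three: "(3::'f::comm_ring_1) = 0"
    and F: "F \<in> dps_box 3 (3 ^ n)" and G: "G \<in> (dps_box 3 (3 ^ n) :: 'f dps dps set)"
  shows "F * G \<in> dps_box 3 (3 ^ n)"
proof -
  have "F * G \<in> dps_below (3 ^ 1)"
    using F G by (intro dps_below_mult[OF dps_three_eq_0[OF three]]) (auto simp: dps_box_def)
  moreover have "dps_nth (F * G) i \<in> dps_below (3 ^ n)" for i
  proof -
    have "of_nat c * f \<in> dps_below q" if "f \<in> dps_below q" for c q and f :: "'f dps"
      using that by (simp add: dps_below_def)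
    then show ?thesis
      unfolding times_dps.rep_eq using F G
      by (intro dps_below_sum) (simp add: dps_box_def dps_below_mult[OF three])
  qed
  ultimately show ?thesis by (simp add: dps_box_def)
qed

lemma poisson_box:
  assumes "(3::'f::comm_ring_1) = 0"
    and "F \<in> dps_box 3 (3 ^ n)" "G \<in> (dps_box 3 (3 ^ n) :: 'f dps dps set)"
  shows "poisson F G \<in> dps_box 3 (3 ^ n)"
  unfolding poisson_def
  by (intro dps_box_diff dps_box_mult dps_box_deriv dps_box_inner_deriv assms)

definition index2 :: "nat \<Rightarrow> nat \<Rightarrow> nat \<Rightarrow> nat"
  where "index2 i j = (\<lambda>k. if k = 1 then i else if k = 2 then j else 0)"

definition dp_series :: "((nat \<Rightarrow> nat) \<Rightarrow> 'f) \<Rightarrow> 'f dps dps"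
  where "dp_series f = Abs_dps (\<lambda>i. Abs_dps (\<lambda>j. f (index2 i j)))"

text \<open>The test on a says that a vanishes outside {1, 2}. Beyond the box the coefficient is 0
  because F is.\<close>

definition of_dp_series :: "'f::zero dps dps \<Rightarrow> ((nat \<Rightarrow> nat) \<Rightarrow> 'f)"
  where "of_dp_series F = (\<lambda>a. if index2 (a 1) (a 2) = a then dps_nth (dps_nth F (a 1)) (a 2) else 0)"

lemma index2_simps [simp]: "index2 i j 1 = i" "index2 i j (Suc 0) = i" "index2 i j 2 = j"
  "k \<notin> {1..2} \<Longrightarrow> index2 i j k = 0"
  by (auto simp: index2_def)

lemma index2_eq_iff [simp]: "index2 i j = index2 k l \<longleftrightarrow> i = k \<and> j = l"
  by (metis index2_simps(1,3))

lemma index2_upd: "(index2 i j)(1 := k) = index2 k j" "(index2 i j)(2 := k) = index2 i k"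
  by (auto simp: index2_def)

lemma index2_add: "(\<lambda>k. index2 i j k + index2 i' j' k) = index2 (i + i') (j + j')"
  by (auto simp: index2_def)

lemma index2I: "(\<And>k. k \<notin> {1..2} \<Longrightarrow> a k = 0) \<Longrightarrow> index2 (a 1) (a 2) = a"
  by (rule ext) (force simp: index2_def)

lemma dps_nth_dp_series [simp]: "dps_nth (dps_nth (dp_series f) i) j = f (index2 i j)"
  by (simp add: dp_series_def)

lemma dp_series_of_dp_series [simp]: "dp_series (of_dp_series F) = F"
  by (rule dps_eqI, rule dps_eqI) (simp add: of_dp_series_def)

lemma dp_series_partial:
  "dp_series (dp_partial 1 f) = dps_deriv (dp_series f)"
  "dp_series (dp_partial 2 f) = dps_inner_deriv (dp_series f)"
  by (rule dps_eqI, rule dps_eqI, simp add: dp_partial_def index2_upd[simplified])+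

text \<open>The heights (1, n), with the value n also outside {1, 2} so as to agree literally with
  the function in the theorem.\<close>

definition dp_heights :: "nat \<Rightarrow> nat \<Rightarrow> nat"
  where "dp_heights n = (\<lambda>i. if i = 1 then 1 else n)"

lemma dp_heights_simps [simp]: "dp_heights n (Suc 0) = 1" "dp_heights n 2 = n"
  by (simp_all add: dp_heights_def)

section \<open>The divided power algebra as a box of double series\<close>

context ham_outer_derivations
begin

abbreviation \<nu> :: "nat \<Rightarrow> nat" where "\<nu> \<equiv> dp_heights n"
abbreviation A :: "('f, (nat \<Rightarrow> nat) \<Rightarrow> 'f) module" where "A \<equiv> divided_power_algebra 2 \<nu>"
abbreviation box :: "'f dps dps set" where "box \<equiv> dps_box 3 (3 ^ n)"

lemma dp_index_iff: "a \<in> dp_index 3 2 \<nu> \<longleftrightarrow> index2 (a 1) (a 2) = a \<and> a 1 < 3 \<and> a 2 < 3 ^ n"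
proof -
  have "{1..2} = {1, 2::nat}" by auto
  then have "a \<in> dp_index 3 2 \<nu> \<longleftrightarrow> (\<forall>i. i \<notin> {1..2} \<longrightarrow> a i = 0) \<and> a 1 < 3 \<and> a 2 < 3 ^ n"
    unfolding dp_index_def by (simp add: conj_commute conj_left_commute)
  moreover have "(\<forall>i. i \<notin> {1..2} \<longrightarrow> a i = 0) \<longleftrightarrow> index2 (a 1) (a 2) = a"
    using index2I index2_simps(4) by metis
  ultimately show ?thesis by simp
qed

lemma A_simps:
  "carrier A = {f. \<forall>a. a \<notin> dp_index 3 2 \<nu> \<longrightarrow> f a = 0}"
  "\<zero>\<^bsub>A\<^esub> = (\<lambda>_. 0)" "f \<oplus>\<^bsub>A\<^esub> g = (\<lambda>a. f a + g a)" "c \<odot>\<^bsub>A\<^esub> f = (\<lambda>a. c * f a)"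
  by (simp_all add: divided_power_algebra_def char3)

lemma dp_series_box: "f \<in> carrier A \<Longrightarrow> dp_series f \<in> box"
  unfolding dps_box_def dps_below_def A_simps dp_index_iff
  by (auto intro!: dps_eqI)

lemma of_dp_series_carrier: "F \<in> box \<Longrightarrow> of_dp_series F \<in> carrier A"
  unfolding dps_box_def dps_below_def A_simps dp_index_iff
  by (auto simp: of_dp_series_def not_less)

lemma dp_series_inject:
  assumes "f \<in> carrier A" "g \<in> carrier A" "dp_series f = dp_series g"
  shows "f = g"
proof
  fix a
  show "f a = g a"
  proof (cases "a \<in> dp_index 3 2 \<nu>")
    case True
    then have "index2 (a 1) (a 2) = a" by (simp add: dp_index_iff)
    then show ?thesis using arg_cong[OF assms(3), of "\<lambda>F. dps_nth (dps_nth F (a 1)) (a 2)"] by simp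
  next
    case False
    then show ?thesis using assms(1,2) by (simp add: A_simps)
  qed
qed

lemma dp_series_linear:
  "dp_series (f \<oplus>\<^bsub>A\<^esub> g) = dp_series f + dp_series g"
  "dp_series (c \<odot>\<^bsub>A\<^esub> f) = dps_const (dps_const c) * dp_series f"
  "dp_series \<zero>\<^bsub>A\<^esub> = 0"
  by (rule dps_eqI, rule dps_eqI, simp add: A_simps)+

lemma abelian_group_A: "abelian_group A"
proof (rule abelian_groupI)
  fix f assume "f \<in> carrier A"
  then show "\<exists>g\<in>carrier A. g \<oplus>\<^bsub>A\<^esub> f = \<zero>\<^bsub>A\<^esub>"
    by (intro bexI[of _ "\<lambda>a. - f a"]) (auto simp: A_simps)
qed (auto simp: A_simps add.assoc add.commute)

lemma A_mult_closed: "f \<otimes>\<^bsub>A\<^esub> g \<in> carrier A"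
  by (simp add: divided_power_algebra_def)

text \<open>The divided power algebra discards monomials outside the index box. Double series
  discard nothing, but by \<open>dps_box_mult\<close> their product vanishes there by itself. Inside
  the box the summands are matched by the exponents of the first factor.\<close>

lemma dp_series_mult:
  assumes f: "f \<in> carrier A" and g: "g \<in> carrier A"
  shows "dp_series (f \<otimes>\<^bsub>A\<^esub> g) = dp_series f * dp_series g"
proof (rule dps_eqI, rule dps_eqI)
  fix k l
  let ?I = "dp_index 3 2 \<nu>"
  show "dps_nth (dps_nth (dp_series (f \<otimes>\<^bsub>A\<^esub> g)) k) l = dps_nth (dps_nth (dp_series f * dp_series g) k) l"
  proof (cases "k < 3 \<and> l < 3 ^ n")
    case False
    have "dp_series f * dp_series g \<in> box"
      by (intro dps_box_mult three dp_series_box f g)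
    with False have "dps_nth (dps_nth (dp_series f * dp_series g) k) l = 0"
      by (auto simp: dps_box_def dps_below_def not_less)
    moreover have "(f \<otimes>\<^bsub>A\<^esub> g) (index2 k l) = 0"
      using False A_mult_closed[of f g] by (simp add: A_simps dp_index_iff)
    ultimately show ?thesis by simp
  next
    case True
    let ?S = "{(a, b). a \<in> ?I \<and> b \<in> ?I \<and> (\<lambda>i. a i + b i) = index2 k l}"
    let ?t = "\<lambda>(a, b). of_nat (\<Prod>i=1..2. (a i + b i) choose b i) * (f a * g b)"
    have "(f \<otimes>\<^bsub>A\<^esub> g) (index2 k l) = sum ?t ?S"
      using True by (simp add: divided_power_algebra_def char3 dp_index_iff)
    also have "\<dots> = (\<Sum>(i, j)\<in>{..k} \<times> {..l}. of_nat (k choose i) *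
        (of_nat (l choose j) * (f (index2 i j) * g (index2 (k - i) (l - j)))))"
    proof (rule sum.reindex_bij_witness[where
          i = "\<lambda>(i, j). (index2 i j, index2 (k - i) (l - j))" and j = "\<lambda>(a, b). (a 1, a 2)"])
      fix x assume x: "x \<in> ?S"
      then obtain a b where ab: "x = (a, b)" "index2 (a 1) (a 2) = a" "index2 (b 1) (b 2) = b"
        "(\<lambda>i. a i + b i) = index2 k l"
        by (auto simp: dp_index_iff)
      have kl: "k = a 1 + b 1" "l = a 2 + b 2"
        using fun_cong[OF ab(4), of 1] fun_cong[OF ab(4), of 2] by simp_all
      show "(case (case x of (a, b) \<Rightarrow> (a 1, a 2)) of
          (i, j) \<Rightarrow> (index2 i j, index2 (k - i) (l - j))) = x"
        using ab(2,3) by (simp add: ab(1) kl)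
      show "(case x of (a, b) \<Rightarrow> (a 1, a 2)) \<in> {..k} \<times> {..l}"
        by (simp add: ab(1) kl)
      \<comment> \<open>One product takes binomial coefficients over the exponents of the second
        factor, the other over those of the first.\<close>
      have "(\<Prod>i=1..2. (a i + b i) choose b i) = (k choose a 1) * (l choose a 2)"
        using binomial_symmetric[of "a 1" k] binomial_symmetric[of "a 2" l]
        by (simp add: kl numeral_2_eq_2)
      then show "(case case x of (a, b) \<Rightarrow> (a 1, a 2) of (i, j) \<Rightarrow> of_nat (k choose i) *
          (of_nat (l choose j) * (f (index2 i j) * g (index2 (k - i) (l - j))))) = ?t x"
        using ab(2,3) by (simp add: ab(1) kl mult.assoc del: of_nat_prod)
    next
      fix x assume "x \<in> {..k} \<times> {..l}"
      then obtain i j where ij: "x = (i, j)" "i \<le> k" "j \<le> l" by auto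
      show "(case case x of (i, j) \<Rightarrow> (index2 i j, index2 (k - i) (l - j)) of (a, b) \<Rightarrow> (a 1, a 2)) = x"
        by (simp add: ij)
      show "(case x of (i, j) \<Rightarrow> (index2 i j, index2 (k - i) (l - j))) \<in> ?S"
        using ij True by (auto simp: dp_index_iff index2_add)
    qed
    also have "\<dots> = (\<Sum>i\<le>k. \<Sum>j\<le>l. of_nat (k choose i) *
        (of_nat (l choose j) * (f (index2 i j) * g (index2 (k - i) (l - j)))))"
      by (rule sum.cartesian_product[symmetric])
    also have "\<dots> = dps_nth (dps_nth (dp_series f * dp_series g) k) l"
      by (simp add: times_dps.rep_eq[of "dp_series f"] dps_nth_sum sum_distrib_left)
        (simp add: times_dps.rep_eq sum_distrib_left)
    finally show ?thesis by simp
  qed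
qed

end

text \<open>Undoes the encoding: the first component is integrated with constant term 0, and so
  represents its Hamiltonian function modulo constants.\<close>

definition ham_series :: "'f::comm_ring_1 triple \<Rightarrow> 'f dps dps"
  where "ham_series = (\<lambda>(a, w, b). Abs_dps (\<lambda>i.
    if i = 0 then Abs_dps (\<lambda>j. if j = 0 then 0 else dps_nth a (j - 1))
    else if i = 1 then w else if i = 2 then b else 0))"

lemma dps_nth_ham_series:
  "dps_nth (ham_series (a, w, b)) i =
    (if i = 0 then Abs_dps (\<lambda>j. if j = 0 then 0 else dps_nth a (j - 1))
    else if i = 1 then w else if i = 2 then b else 0)"
  by (simp add: ham_series_def)

lemma ham_series_linear:
  "ham_series (x + y) = ham_series x + ham_series y"
  "ham_series (triple_smult c x) = dps_const (dps_const c) * ham_series x"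
  "ham_series 0 = 0"
  by (cases x; cases y; rule dps_eqI; rule dps_eqI;
      simp add: dps_nth_ham_series zero_triple)+

lemma dps_deriv_int: "dps_deriv (Abs_dps (\<lambda>j. if j = 0 then 0 else dps_nth a (j - 1))) = a"
  by (rule dps_eqI) simp

lemma dps_nth_mult_less_3:
  "dps_nth (F * G) 0 = dps_nth F 0 * dps_nth G 0"
  "dps_nth (F * G) 1 = dps_nth F 0 * dps_nth G 1 + dps_nth F 1 * dps_nth G 0"
  "dps_nth (F * G) 2 = dps_nth F 0 * dps_nth G 2 + 2 * (dps_nth F 1 * dps_nth G 1)
    + dps_nth F 2 * dps_nth G 0"
  by (simp_all add: times_dps.rep_eq numeral_2_eq_2)

lemma dps_nth_deriv_ham_series:
  "dps_nth (dps_deriv (ham_series (a, w, b))) 0 = w"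
  "dps_nth (dps_deriv (ham_series (a, w, b))) 1 = b"
  "dps_nth (dps_deriv (ham_series (a, w, b))) 2 = 0"
  "dps_nth (dps_inner_deriv (ham_series (a, w, b))) 0 = a"
  "dps_nth (dps_inner_deriv (ham_series (a, w, b))) 1 = dps_deriv w"
  "dps_nth (dps_inner_deriv (ham_series (a, w, b))) 2 = dps_deriv b"
  by (simp_all add: dps_nth_ham_series dps_deriv_int)

text \<open>\<open>ham_bracket\<close> is the Poisson bracket read off in components. Triples forget
  the constant term, whence c; it disappears in operators because the Poisson bracket with a
  constant is 0.\<close>

lemma poisson_ham_series:
  assumes three: "(3::'f::comm_ring_1) = 0"
    and box: "ham_series x \<in> dps_box 3 (3 ^ n)" "ham_series y \<in> dps_box 3 (3 ^ n)"
  shows "\<exists>c :: 'f. poisson (ham_series x) (ham_series y) =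
    ham_series (ham_bracket x y) + dps_const (dps_const c)"
proof -
  obtain a w b a' w' b' where xy: "x = (a, w, b)" "y = (a', w', b')" by (metis prod_cases3)
  have two: "(2 :: 'f dps) = - 1"
    using dps_three_eq_0[OF three] by (simp add: eq_neg_iff_add_eq_0)
  let ?P = "poisson (ham_series x) (ham_series y)" and ?h = "w * a' - a * w'"
  have P0: "dps_nth ?P 0 = ?h"
    unfolding poisson_def xy minus_dps.rep_eq dps_nth_mult_less_3
      dps_nth_deriv_ham_series ..
  have P1: "dps_nth ?P 1 = w * dps_deriv w' - dps_deriv w * w' + (b * a' - a * b')"
    unfolding poisson_def xy minus_dps.rep_eq dps_nth_mult_less_3
      dps_nth_deriv_ham_series by (simp add: algebra_simps)
  \<comment> \<open>The binomial coefficients 2 in this degree become -1, which turns the expression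
    into a derivative.\<close>
  have P2: "dps_nth ?P 2 = dps_deriv (w * b' - b * w')"
    unfolding poisson_def xy minus_dps.rep_eq dps_nth_mult_less_3
      dps_nth_deriv_ham_series two
    by (simp add: dps_deriv_simps algebra_simps)
  have P3: "dps_nth ?P i = 0" if "i \<ge> 3" for i
    using poisson_box[OF three box] that by (simp add: dps_box_def dps_below_def)
  have int: "?h = Abs_dps (\<lambda>j. if j = 0 then 0 else dps_nth (dps_deriv ?h) (j - 1))
      + dps_const (dps_nth ?h 0)"
  proof (rule dps_eqI)
    fix k show "dps_nth ?h k = dps_nth (Abs_dps (\<lambda>j. if j = 0 then 0 else
        dps_nth (dps_deriv ?h) (j - 1)) + dps_const (dps_nth ?h 0)) k"
      by (cases k) simp_all
  qed
  have "?P = ham_series (ham_bracket x y) + dps_const (dps_const (dps_nth ?h 0))"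
  proof (rule dps_eqI)
    fix i :: nat
    consider "i = 0" | "i = 1" | "i = 2" | "i \<ge> 3" by linarith
    then show "dps_nth ?P i = dps_nth (ham_series (ham_bracket x y) +
        dps_const (dps_const (dps_nth ?h 0))) i"
    proof cases
      case 1
      have "dps_nth (ham_series (ham_bracket x y)) 0 =
          Abs_dps (\<lambda>j. if j = 0 then 0 else dps_nth (dps_deriv ?h) (j - 1))"
        by (simp add: xy dps_nth_ham_series)
      then show ?thesis
        unfolding 1 P0 plus_dps.rep_eq by (simp only: dps_nth_const if_True int[symmetric] refl)
    next
      case 2
      then show ?thesis using P1 by (simp add: xy dps_nth_ham_series)
    next
      case 3
      then show ?thesis using P2 by (simp add: xy dps_nth_ham_series)
    next
      case 4
      then show ?thesis using P3 by (simp add: xy dps_nth_ham_series)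
    qed
  qed
  then show ?thesis by blast
qed

section \<open>Hamiltonian operators as Poisson brackets\<close>

context ham_outer_derivations
begin

definition ham_op :: "((nat \<Rightarrow> nat) \<Rightarrow> 'f) \<Rightarrow> ((nat \<Rightarrow> nat) \<Rightarrow> 'f) \<Rightarrow> ((nat \<Rightarrow> nat) \<Rightarrow> 'f)"
  where "ham_op = D_H 1 \<nu>"
abbreviation W :: "('f, ((nat \<Rightarrow> nat) \<Rightarrow> 'f) \<Rightarrow> ((nat \<Rightarrow> nat) \<Rightarrow> 'f)) lie_algebra"
  where "W \<equiv> jacobson_witt 2 \<nu>"

lemma dp_index_downward:
  assumes "a \<in> dp_index p m \<mu>" and "\<And>k. b k \<le> a k"
  shows "b \<in> dp_index p m \<mu>"
  using assms unfolding dp_index_def by (auto intro: le_less_trans) (metis le_zero_eq)+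

lemma dp_partial_closed:
  assumes f: "f \<in> carrier A"
  shows "dp_partial i f \<in> carrier A"
proof -
  have "f (a(i := a i + 1)) = 0" if "a \<notin> dp_index 3 2 \<nu>" for a
  proof -
    have "a \<in> dp_index 3 2 \<nu>" if "a(i := a i + 1) \<in> dp_index 3 2 \<nu>"
      using that by (rule dp_index_downward) simp
    with that have "a(i := a i + 1) \<notin> dp_index 3 2 \<nu>" by blast
    with f show ?thesis unfolding A_simps by blast
  qed
  then show ?thesis unfolding A_simps dp_partial_def by blast
qed

lemma finsum_2:
  assumes "h 1 \<in> carrier A" "h 2 \<in> carrier A"
  shows "(\<Oplus>\<^bsub>A\<^esub>i\<in>{1..2}. h i) = h 1 \<oplus>\<^bsub>A\<^esub> h (2::nat)"
proof -
  interpret abelian_group A by (rule abelian_group_A)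
  have "{1..2} = {1, 2::nat}" by auto
  then show ?thesis using assms by (simp add: Pi_def)
qed

lemma ham_op_apply:
  assumes f: "f \<in> carrier A" and g: "g \<in> carrier A"
  shows "ham_op f g \<in> carrier A" and "dp_series (ham_op f g) = poisson (dp_series f) (dp_series g)"
proof -
  interpret abelian_group A by (rule abelian_group_A)
  have smult: "c \<odot>\<^bsub>A\<^esub> h \<in> carrier A" if "h \<in> carrier A" for c h
    using that by (simp add: A_simps)
  have Dfg: "ham_op f g = (1 \<odot>\<^bsub>A\<^esub> (dp_partial 1 f \<otimes>\<^bsub>A\<^esub> dp_partial 2 g)) \<oplus>\<^bsub>A\<^esub>
      ((- 1) \<odot>\<^bsub>A\<^esub> (dp_partial 2 f \<otimes>\<^bsub>A\<^esub> dp_partial 1 g))"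
  proof -
    have conj: "ham_sign 1 1 = (1::'f)" "ham_sign 1 2 = (- 1 :: 'f)" "ham_conj 1 1 = 2" "ham_conj 1 2 = 1"
      by (simp_all add: ham_sign_def ham_conj_def)
    have "ham_op f g = (\<Oplus>\<^bsub>A\<^esub>i\<in>{1..2}. ham_sign 1 i \<odot>\<^bsub>A\<^esub> (dp_partial i f \<otimes>\<^bsub>A\<^esub> dp_partial (ham_conj 1 i) g))"
      unfolding ham_op_def D_H_def Let_def mult_1_right using g by (simp only: restrict_apply if_True)
    then show ?thesis
      by (subst (asm) finsum_2) (simp_all only: smult A_mult_closed conj)
  qed
  show "ham_op f g \<in> carrier A"
    unfolding Dfg by (intro a_closed smult A_mult_closed)
  show "dp_series (ham_op f g) = poisson (dp_series f) (dp_series g)"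
    unfolding Dfg dp_series_linear
    by (simp add: dp_series_mult dp_partial_closed f g dp_series_partial poisson_def dps_const_minus
        del: One_nat_def)
qed

end

lemma dps_inner_deriv_const [simp]: "dps_inner_deriv (dps_const f) = dps_const (dps_deriv f)"
  by (rule dps_eqI) simp

lemma poisson_linear:
  "poisson (F + F') G = poisson F G + poisson F' G"
  "poisson (dps_const (dps_const c) * F) G = dps_const (dps_const c) * poisson F G"
  "poisson 0 G = 0" "poisson (dps_const (dps_const c)) G = 0"
proof -
  have "dps_inner_deriv 0 = (0 :: 'a dps dps)" by (rule dps_eqI) simp
  then show "poisson 0 G = 0" by (simp add: poisson_def)
qed (simp_all add: poisson_def dps_deriv_simps dps_inner_deriv_simps algebra_simps)

lemma ham_series_box: "z \<in> ham_carrier n \<Longrightarrow> ham_series z \<in> dps_box 3 (3 ^ n)"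
  by (cases z) (auto simp: dps_box_def dps_below_def dps_nth_ham_series)

section \<open>The Hamiltonian algebra in terms of triples\<close>

context ham_outer_derivations
begin

abbreviation H :: "('f, ((nat \<Rightarrow> nat) \<Rightarrow> 'f) \<Rightarrow> ((nat \<Rightarrow> nat) \<Rightarrow> 'f)) lie_algebra"
  where "H \<equiv> hamiltonian 1 \<nu>"

definition ham_fun :: "'f triple \<Rightarrow> ((nat \<Rightarrow> nat) \<Rightarrow> 'f)"
  where "ham_fun z = of_dp_series (ham_series z)"

lemma dp_series_ham_fun [simp]: "dp_series (ham_fun z) = ham_series z"
  by (simp add: ham_fun_def)

lemma ham_fun_carrier: "z \<in> C \<Longrightarrow> ham_fun z \<in> carrier A"
  unfolding ham_fun_def by (intro of_dp_series_carrier ham_series_box)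

text \<open>Moves an identity of operators to one of Poisson brackets of double series, where the
  ring laws are available; \<open>dp_series\<close> is injective on the carrier.\<close>

lemma ham_op_eqI:
  assumes "f \<in> carrier A" "E \<in> extensional (carrier A)"
    and "\<And>g. g \<in> carrier A \<Longrightarrow> E g \<in> carrier A"
    and "\<And>g. g \<in> carrier A \<Longrightarrow> dp_series (E g) = poisson (dp_series f) (dp_series g)"
  shows "ham_op f = E"
proof (rule extensionalityI[of _ "carrier A"])
  show "ham_op f \<in> extensional (carrier A)"
    unfolding ham_op_def D_H_def Let_def mult_1_right by simp
  show "ham_op f g = E g" if "g \<in> carrier A" for g
    using that assms by (intro dp_series_inject) (simp_all add: ham_op_apply)
qed (rule assms)

lemma W_simps:
  "carrier W = {\<lambda>g\<in>carrier A. \<Oplus>\<^bsub>A\<^esub>i\<in>{1..2}. u i \<otimes>\<^bsub>A\<^esub> dp_partial i g | u. u \<in> {1..2} \<rightarrow> carrier A}"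
  "\<zero>\<^bsub>W\<^esub> = (\<lambda>g\<in>carrier A. \<zero>\<^bsub>A\<^esub>)"
  "E \<oplus>\<^bsub>W\<^esub> E' = (\<lambda>g\<in>carrier A. E g \<oplus>\<^bsub>A\<^esub> E' g)"
  "c \<odot>\<^bsub>W\<^esub> E = (\<lambda>g\<in>carrier A. c \<odot>\<^bsub>A\<^esub> E g)"
  "\<lbrakk>E, E'\<rbrakk>\<^bsub>W\<^esub> = (\<lambda>g\<in>carrier A. E (E' g) \<ominus>\<^bsub>A\<^esub> E' (E g))"
  by (simp_all add: jacobson_witt_def Let_def general_linear_def)

lemma H_simps:
  "\<zero>\<^bsub>H\<^esub> = \<zero>\<^bsub>W\<^esub>" "E \<oplus>\<^bsub>H\<^esub> E' = E \<oplus>\<^bsub>W\<^esub> E'" "c \<odot>\<^bsub>H\<^esub> E = c \<odot>\<^bsub>W\<^esub> E" "\<lbrakk>E, E'\<rbrakk>\<^bsub>H\<^esub> = \<lbrakk>E, E'\<rbrakk>\<^bsub>W\<^esub>"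
  by (simp_all add: hamiltonian_def)

lemma A_closed:
  assumes "f \<in> carrier A" "g \<in> carrier A"
  shows "f \<oplus>\<^bsub>A\<^esub> g \<in> carrier A" "c \<odot>\<^bsub>A\<^esub> f \<in> carrier A" "f \<ominus>\<^bsub>A\<^esub> g \<in> carrier A"
    and dp_series_minus: "dp_series (f \<ominus>\<^bsub>A\<^esub> g) = dp_series f - dp_series g"
proof -
  interpret abelian_group A by (rule abelian_group_A)
  show "f \<oplus>\<^bsub>A\<^esub> g \<in> carrier A" "c \<odot>\<^bsub>A\<^esub> f \<in> carrier A" and *: "f \<ominus>\<^bsub>A\<^esub> g \<in> carrier A"
    using assms by (simp_all) (simp add: A_simps)
  have "(f \<ominus>\<^bsub>A\<^esub> g) \<oplus>\<^bsub>A\<^esub> g = f"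
    using assms by (simp add: minus_eq a_assoc l_neg)
  then have "dp_series (f \<ominus>\<^bsub>A\<^esub> g) + dp_series g = dp_series f"
    by (metis dp_series_linear(1))
  then show "dp_series (f \<ominus>\<^bsub>A\<^esub> g) = dp_series f - dp_series g"
    by (simp add: eq_diff_eq)
qed

lemma zero_A: "\<zero>\<^bsub>A\<^esub> \<in> carrier A"
  by (simp add: A_simps)

lemma ham_op_add:
  "x \<in> C \<Longrightarrow> y \<in> C \<Longrightarrow> ham_op (ham_fun (x + y)) = ham_op (ham_fun x) \<oplus>\<^bsub>W\<^esub> ham_op (ham_fun y)"
  unfolding W_simps
  by (rule ham_op_eqI) (simp_all add: ham_fun_carrier ham_carrier_add A_closed ham_op_apply dp_series_linear
      ham_series_linear poisson_linear del: ham_carrier_iff)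

lemma ham_op_smult:
  "x \<in> C \<Longrightarrow> ham_op (ham_fun (triple_smult c x)) = c \<odot>\<^bsub>W\<^esub> ham_op (ham_fun x)"
  unfolding W_simps
  by (rule ham_op_eqI) (simp_all add: ham_fun_carrier ham_carrier_smult A_closed ham_op_apply dp_series_linear
      ham_series_linear poisson_linear del: ham_carrier_iff)

lemma ham_op_zero: "ham_op (ham_fun 0) = \<zero>\<^bsub>W\<^esub>"
  unfolding W_simps
  by (rule ham_op_eqI) (simp_all add: ham_fun_carrier zero_A dp_series_linear ham_series_linear
      poisson_linear)

lemma ham_op_bracket:
  assumes x: "x \<in> C" and y: "y \<in> C"
  shows "ham_op (ham_fun (ham_bracket x y)) = \<lbrakk>ham_op (ham_fun x), ham_op (ham_fun y)\<rbrakk>\<^bsub>W\<^esub>"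
  unfolding W_simps
proof (rule ham_op_eqI)
  show "ham_fun (ham_bracket x y) \<in> carrier A"
    by (intro ham_fun_carrier bracket_closed x y)
  fix g assume g: "g \<in> carrier A"
  note fx = ham_fun_carrier[OF x] and fy = ham_fun_carrier[OF y]
  obtain c where "poisson (ham_series x) (ham_series y) =
      ham_series (ham_bracket x y) + dps_const (dps_const c)"
    using poisson_ham_series[OF three ham_series_box[OF x] ham_series_box[OF y]] by blast
  then have "poisson (poisson (ham_series x) (ham_series y)) (dp_series g) =
      poisson (ham_series (ham_bracket x y)) (dp_series g)"
    by (simp add: poisson_linear)
  then show "dp_series ((\<lambda>g\<in>carrier A. ham_op (ham_fun x) (ham_op (ham_fun y) g) \<ominus>\<^bsub>A\<^esub>
      ham_op (ham_fun y) (ham_op (ham_fun x) g)) g) =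
    poisson (dp_series (ham_fun (ham_bracket x y))) (dp_series g)"
    using g fx fy by (simp add: ham_op_apply dp_series_minus poisson_jacobi)
  show "(\<lambda>g\<in>carrier A. ham_op (ham_fun x) (ham_op (ham_fun y) g) \<ominus>\<^bsub>A\<^esub>
      ham_op (ham_fun y) (ham_op (ham_fun x) g)) g \<in> carrier A"
    using g fx fy by (simp add: ham_op_apply A_closed)
qed simp

text \<open>The operator is tested on the coordinates: on x it gives minus the y-derivative of the
  Hamiltonian function, on y the x-derivative, and these contain all three entries of the
  triple.\<close>

lemma ham_op_inj: "inj_on (\<lambda>z. ham_op (ham_fun z)) C"
proof (rule inj_onI)
  fix x y assume x: "x \<in> C" and y: "y \<in> C" and eq: "ham_op (ham_fun x) = ham_op (ham_fun y)"
  have "(dps_X 1 :: 'f dps dps) \<in> box" "dps_const (dps_X 1 :: 'f dps) \<in> box"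
    using nine_le by (auto simp: dps_box_def dps_below_def)
  then have "poisson (ham_series x) G = poisson (ham_series y) G"
    if "G = dps_X 1 \<or> G = dps_const (dps_X 1)" for G
    using that ham_op_apply(2)[OF ham_fun_carrier[OF x] of_dp_series_carrier[of G]]
      ham_op_apply(2)[OF ham_fun_carrier[OF y] of_dp_series_carrier[of G]] eq
    by (metis dp_series_of_dp_series dp_series_ham_fun)
  from this[of "dps_X 1"] this[of "dps_const (dps_X 1)"]
  have "poisson (ham_series x) (dps_X 1) = poisson (ham_series y) (dps_X 1)"
    "poisson (ham_series x) (dps_const (dps_X 1)) = poisson (ham_series y) (dps_const (dps_X 1))"
    by blast+
  moreover have "dps_inner_deriv (dps_X 1) = (0 :: 'f dps dps)" by (rule dps_eqI) simp
  ultimately have "dps_inner_deriv (ham_series x) = dps_inner_deriv (ham_series y)"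
    "dps_deriv (ham_series x) = dps_deriv (ham_series y)"
    by (simp_all add: poisson_def dps_deriv_X')
  note eqs = this
  obtain a w b a' w' b' where xy: "x = (a, w, b)" "y = (a', w', b')" by (metis prod_cases3)
  have "a = a'" "w = w'" "b = b'"
    using arg_cong[OF eqs(1), of "\<lambda>F. dps_nth F 0"] arg_cong[OF eqs(2), of "\<lambda>F. dps_nth F 0"]
      arg_cong[OF eqs(2), of "\<lambda>F. dps_nth F 1"]
    unfolding xy dps_nth_deriv_ham_series .
  then show "x = y" by (simp add: xy)
qed

lemma ham_op_W: "z \<in> C \<Longrightarrow> ham_op (ham_fun z) \<in> carrier W"
proof -
  assume z: "z \<in> C"
  \<comment> \<open>The coefficients of D_H(f) as a vector field: minus the second partial
    derivative of f at the first coordinate, the first partial derivative at the second.\<close>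
  define u where "u = (\<lambda>i::nat. if i = 1 then (- 1) \<odot>\<^bsub>A\<^esub> dp_partial 2 (ham_fun z) else dp_partial 1 (ham_fun z))"
  have f: "ham_fun z \<in> carrier A" by (rule ham_fun_carrier[OF z])
  then have u: "u i \<in> carrier A" for i
    unfolding u_def by (simp add: dp_partial_closed A_closed)
  have "ham_op (ham_fun z) = (\<lambda>g\<in>carrier A. \<Oplus>\<^bsub>A\<^esub>i\<in>{1..2}. u i \<otimes>\<^bsub>A\<^esub> dp_partial i g)"
  proof (rule ham_op_eqI[OF f])
    fix g assume g: "g \<in> carrier A"
    have *: "(\<lambda>g\<in>carrier A. \<Oplus>\<^bsub>A\<^esub>i\<in>{1..2}. u i \<otimes>\<^bsub>A\<^esub> dp_partial i g) g =
        (u 1 \<otimes>\<^bsub>A\<^esub> dp_partial 1 g) \<oplus>\<^bsub>A\<^esub> (u 2 \<otimes>\<^bsub>A\<^esub> dp_partial 2 g)"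
      using g by (simp only: restrict_apply if_True finsum_2 A_mult_closed)
    show "(\<lambda>g\<in>carrier A. \<Oplus>\<^bsub>A\<^esub>i\<in>{1..2}. u i \<otimes>\<^bsub>A\<^esub> dp_partial i g) g \<in> carrier A"
      unfolding * by (intro A_closed A_mult_closed)
    have u12: "dp_series (u 1) = - dps_inner_deriv (ham_series z)"
      "dp_series (u 2) = dps_deriv (ham_series z)"
      by (simp_all add: u_def dp_series_linear dp_series_partial dps_const_minus del: One_nat_def)
    show "dp_series ((\<lambda>g\<in>carrier A. \<Oplus>\<^bsub>A\<^esub>i\<in>{1..2}. u i \<otimes>\<^bsub>A\<^esub> dp_partial i g) g) =
        poisson (dp_series (ham_fun z)) (dp_series g)"
      unfolding * dp_series_linear
      by (simp add: dp_series_mult u dp_partial_closed g u12 dp_series_partial poisson_def del: One_nat_def)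
  qed simp
  then show ?thesis unfolding W_simps using u by blast
qed

lemma W_closed:
  assumes "E \<in> carrier W"
  shows "E \<in> extensional (carrier A)" "g \<in> carrier A \<Longrightarrow> E g \<in> carrier A"
proof -
  obtain u where E: "E = (\<lambda>g\<in>carrier A. \<Oplus>\<^bsub>A\<^esub>i\<in>{1..2}. u i \<otimes>\<^bsub>A\<^esub> dp_partial i g)"
    using assms unfolding W_simps by blast
  show "E \<in> extensional (carrier A)" by (simp add: E)
  assume "g \<in> carrier A"
  then have "E g = (u 1 \<otimes>\<^bsub>A\<^esub> dp_partial 1 g) \<oplus>\<^bsub>A\<^esub> (u 2 \<otimes>\<^bsub>A\<^esub> dp_partial 2 g)"
    unfolding E by (simp only: restrict_apply if_True finsum_2 A_mult_closed)
  then show "E g \<in> carrier A" by (simp only: A_closed A_mult_closed)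
qed

lemma submodule_ham:
  "submodule ((\<lambda>z. ham_op (ham_fun z)) ` C) (ring_of_type_algebra :: 'f ring) W"
proof (intro submodule.intro subgroup.intro submodule_axioms.intro)
  show "(\<lambda>z. ham_op (ham_fun z)) ` C \<subseteq> carrier (add_monoid W)"
    using ham_op_W by auto
  show "\<one>\<^bsub>add_monoid W\<^esub> \<in> (\<lambda>z. ham_op (ham_fun z)) ` C"
    using ham_op_zero by (auto intro!: image_eqI[of _ _ 0])
  fix E assume "E \<in> (\<lambda>z. ham_op (ham_fun z)) ` C"
  then obtain x where x: "x \<in> C" "E = ham_op (ham_fun x)" by blast
  show "c \<odot>\<^bsub>W\<^esub> E \<in> (\<lambda>z. ham_op (ham_fun z)) ` C" for c
    unfolding x(2) ham_op_smult[OF x(1), symmetric] using ham_carrier_smult[OF x(1)] by blast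
  have neg: "- x \<in> C" by (rule ham_carrier_minus[OF x(1)])
  \<comment> \<open>The inverse is a definite description. Its uniqueness is checked on each g,
    where addition is that of the divided power algebra.\<close>
  have "inv\<^bsub>add_monoid W\<^esub> E = ham_op (ham_fun (- x))"
    unfolding m_inv_def
  proof (rule the_equality)
    show "ham_op (ham_fun (- x)) \<in> carrier (add_monoid W) \<and>
        E \<otimes>\<^bsub>add_monoid W\<^esub> ham_op (ham_fun (- x)) = \<one>\<^bsub>add_monoid W\<^esub> \<and>
        ham_op (ham_fun (- x)) \<otimes>\<^bsub>add_monoid W\<^esub> E = \<one>\<^bsub>add_monoid W\<^esub>"
      using ham_op_W[OF neg] ham_op_add[OF x(1) neg] ham_op_add[OF neg x(1)] ham_op_zero
      by (simp add: x(2))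
    fix E' assume "E' \<in> carrier (add_monoid W) \<and> E \<otimes>\<^bsub>add_monoid W\<^esub> E' = \<one>\<^bsub>add_monoid W\<^esub> \<and>
        E' \<otimes>\<^bsub>add_monoid W\<^esub> E = \<one>\<^bsub>add_monoid W\<^esub>"
    then have E': "E' \<in> carrier W" "E' \<oplus>\<^bsub>W\<^esub> E = \<zero>\<^bsub>W\<^esub>" by simp_all
    have "ham_op (ham_fun (- x)) = E'"
    proof (rule ham_op_eqI[OF ham_fun_carrier[OF neg] W_closed(1,2)[OF E'(1)]])
      fix g assume g: "g \<in> carrier A"
      have "E' g \<oplus>\<^bsub>A\<^esub> E g = \<zero>\<^bsub>A\<^esub>"
        using fun_cong[OF E'(2), of g] g unfolding W_simps by simp
      then have "dp_series (E' g) + dp_series (E g) = 0"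
        by (metis dp_series_linear(1,3))
      moreover have "ham_series (- x) + ham_series x = 0"
        using ham_series_linear(1)[of "- x" x] by (simp add: ham_series_linear(3))
      then have "poisson (ham_series (- x)) (dp_series g) + poisson (ham_series x) (dp_series g) = 0"
        by (metis poisson_linear(1,3))
      ultimately show "dp_series (E' g) = poisson (dp_series (ham_fun (- x))) (dp_series g)"
        using ham_op_apply(2)[OF ham_fun_carrier[OF x(1)] g] x(2) by (simp add: eq_neg_iff_add_eq_0[symmetric])
    qed
    then show "E' = ham_op (ham_fun (- x))" ..
  qed
  with neg show "inv\<^bsub>add_monoid W\<^esub> E \<in> (\<lambda>z. ham_op (ham_fun z)) ` C" by blast
  fix E' assume "E' \<in> (\<lambda>z. ham_op (ham_fun z)) ` C"
  then obtain y where y: "y \<in> C" "E' = ham_op (ham_fun y)" by blast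
  show "E \<otimes>\<^bsub>add_monoid W\<^esub> E' \<in> (\<lambda>z. ham_op (ham_fun z)) ` C"
    using ham_carrier_add[OF x(1) y(1)]
    by (intro image_eqI[of _ _ "x + y"]) (simp_all add: x(2) y(2) ham_op_add[OF x(1) y(1)])
qed

lemma ham_fun_eq_monomial:
  assumes "i < 3" "j < 3 ^ n" "z \<in> C"
    and "\<And>k. dps_nth (ham_series z) k = (if k = i then dps_X j else 0)"
  shows "ham_fun z = dp_monomial 2 \<nu> (index2 i j)"
proof (rule dp_series_inject[OF ham_fun_carrier[OF assms(3)]])
  show "dp_monomial 2 \<nu> (index2 i j) \<in> carrier A"
    by (simp add: A_simps dp_monomial_def char3)
  show "dp_series (ham_fun z) = dp_series (dp_monomial 2 \<nu> (index2 i j))"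
    by (rule dps_eqI, rule dps_eqI)
      (simp add: assms(1,2,4) dp_monomial_def char3 dp_index_iff)
qed

text \<open>Monomial triples correspond exactly to the generators. The integration shifts j to
  \<open>Suc j\<close> and so omits the constant 1; the bound 3^n - 1 in the third line omits the
  top monomial.\<close>

lemma monomials:
  "j < 3 ^ n - 1 \<Longrightarrow> ham_fun (dps_X j, 0, 0) = dp_monomial 2 \<nu> (index2 0 (Suc j))"
  "j < 3 ^ n \<Longrightarrow> ham_fun (0, dps_X j, 0) = dp_monomial 2 \<nu> (index2 1 j)"
  "j < 3 ^ n - 1 \<Longrightarrow> ham_fun (0, 0, dps_X j) = dp_monomial 2 \<nu> (index2 2 j)"
proof -
  have int: "Abs_dps (\<lambda>k. if k = 0 then 0 else dps_nth (dps_X j) (k - 1)) = (dps_X (Suc j) :: 'f dps)" for j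
  proof (rule dps_eqI)
    show "dps_nth (Abs_dps (\<lambda>k. if k = 0 then 0 else dps_nth (dps_X j) (k - 1))) i =
        dps_nth (dps_X (Suc j) :: 'f dps) i" for i
      by (cases i) auto
  qed
  have int0: "Abs_dps (\<lambda>k. if k = 0 then 0 else dps_nth 0 (k - 1)) = (0 :: 'f dps)"
    by (rule dps_eqI) simp
  show "j < 3 ^ n - 1 \<Longrightarrow> ham_fun (dps_X j, 0, 0) = dp_monomial 2 \<nu> (index2 0 (Suc j))"
    by (rule ham_fun_eq_monomial[OF _ _ u1_in]) (simp_all only: dps_nth_ham_series int, auto)
  show "j < 3 ^ n \<Longrightarrow> ham_fun (0, dps_X j, 0) = dp_monomial 2 \<nu> (index2 1 j)"
    by (rule ham_fun_eq_monomial[OF _ _ e_in]) (simp_all only: dps_nth_ham_series int0, auto)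
  show "j < 3 ^ n - 1 \<Longrightarrow> ham_fun (0, 0, dps_X j) = dp_monomial 2 \<nu> (index2 2 j)"
    by (rule ham_fun_eq_monomial[OF _ _ u2_in]) (simp_all only: dps_nth_ham_series int0, auto)
qed

lemma dp_top_eq: "dp_top 3 2 \<nu> = index2 2 (3 ^ n - 1)" "(\<lambda>_. 0) = index2 0 0"
  by (auto simp: dp_top_def index2_def dp_heights_def fun_eq_iff)

text \<open>One inclusion is minimality of the hull, since the image of the triples is a submodule
  containing the generators; the other is induction over monomials inside an arbitrary submodule U
  containing them.\<close>

lemma carrier_H: "carrier H = (\<lambda>z. ham_op (ham_fun z)) ` C"
proof -
  let ?G = "{ham_op (dp_monomial 2 \<nu> a) | a. a \<in> dp_index 3 2 \<nu> - {\<lambda>_. 0, dp_top 3 2 \<nu>}}"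
  let ?S = "\<lambda>U. submodule U (ring_of_type_algebra :: 'f ring) W"
  have "carrier H = ?S hull ?G"
    by (simp add: hamiltonian_def char3 ham_op_def)
  also have "\<dots> = (\<lambda>z. ham_op (ham_fun z)) ` C"
  proof
    show "?S hull ?G \<subseteq> (\<lambda>z. ham_op (ham_fun z)) ` C"
    proof (rule hull_minimal[where S = ?S, OF _ submodule_ham], rule subsetI)
      fix E assume "E \<in> ?G"
      then obtain a where a: "E = ham_op (dp_monomial 2 \<nu> a)" "a \<in> dp_index 3 2 \<nu>"
        "a \<noteq> index2 0 0" "a \<noteq> index2 2 (3 ^ n - 1)"
        unfolding dp_top_eq by blast
      define i j where "i = a 1" and "j = a 2"
      have ij: "a = index2 i j" "i < 3" "j < 3 ^ n"
        using a(2) unfolding dp_index_iff i_def j_def by simp_all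
      consider "i = 0" "j \<noteq> 0" | "i = 1" | "i = 2" "j \<noteq> 3 ^ n - 1"
        using ij a(3,4) by (auto simp: less_Suc_eq numeral_3_eq_3 numeral_2_eq_2)
      then show "E \<in> (\<lambda>z. ham_op (ham_fun z)) ` C"
      proof cases
        case 1
        then have "j - 1 < 3 ^ n - 1" "Suc (j - 1) = j" using ij by auto
        with 1 show ?thesis
          unfolding a(1) ij(1) using monomials(1)[of "j - 1"] u1_in[of "j - 1"]
          by (intro image_eqI[of _ _ "(dps_X (j - 1), 0, 0)"]) (simp_all only:)
      next
        case 2
        with ij show ?thesis
          unfolding a(1) ij(1) using monomials(2)[of j] e_in[of j]
          by (intro image_eqI[of _ _ "(0, dps_X j, 0)"]) (simp_all only:)
      next
        case 3
        then have "j < 3 ^ n - 1" using ij by auto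
        with 3 show ?thesis
          unfolding a(1) ij(1) using monomials(3)[of j] u2_in[of j]
          by (intro image_eqI[of _ _ "(0, 0, dps_X j)"]) (simp_all only:)
      qed
    qed
    show "(\<lambda>z. ham_op (ham_fun z)) ` C \<subseteq> ?S hull ?G"
      unfolding hull_def
    proof (intro image_subsetI InterI)
      fix z U assume z: "z \<in> C" and "U \<in> {t. ?S t \<and> ?G \<subseteq> t}"
      then have U: "?S U" and G: "?G \<subseteq> U" by auto
      interpret submodule U "ring_of_type_algebra :: 'f ring" W by (rule U)
      have gen: "ham_op (dp_monomial 2 \<nu> (index2 i j)) \<in> U"
        if "i < 3" "j < 3 ^ n" "(i, j) \<noteq> (0, 0)" "(i, j) \<noteq> (2, 3 ^ n - 1)" for i j
      proof -
        have "index2 i j \<in> dp_index 3 2 \<nu> - {\<lambda>_. 0, dp_top 3 2 \<nu>}"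
          using that unfolding dp_top_eq by (simp add: dp_index_iff)
        with G show ?thesis by blast
      qed
      from z show "ham_op (ham_fun z) \<in> U"
      proof (induction z rule: ham_carrier_induct)
        case zero
        \<comment> \<open>\<open>one_closed\<close> and \<open>m_closed\<close> come from the
          additive group: they concern zero and addition.\<close>
        show ?case using one_closed by (simp add: ham_op_zero)
      next
        case (add x y)
        then show ?case using m_closed by (simp add: ham_op_add)
      next
        case (smult c x)
        then show ?case using smult_closed[of c] by (simp add: ham_op_smult ring_of_type_algebra_def)
      next
        case (left j)
        then show ?case by (simp only: monomials) (rule gen, auto)
      next
        case (mid j)
        then show ?case by (simp only: monomials) (rule gen, auto)
      next
        case (right j)
        then show ?case by (simp only: monomials) (rule gen, auto)
      qed
    qed
  qed
  finally show ?thesis .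
qed

lemma lie_iso_hamiltonian: "lie_iso (\<lambda>z. ham_op (ham_fun z)) M H"
  unfolding lie_iso_def lie_hom_def bij_betw_def carrier_H H_simps ham_triples_simps
  using ham_op_inj ham_op_add ham_op_smult ham_op_bracket ham_op_zero by blast

end

theorem theorem3p5:
  fixes n :: nat
  assumes "CHAR('f::field) = 3"
    and "n > 1"
  shows "lie_isomorphic
    (Out (hamiltonian 1 (\<lambda>i. if i = 1 then 1 else n) ::
      ('f, ((nat \<Rightarrow> nat) \<Rightarrow> 'f) \<Rightarrow> ((nat \<Rightarrow> nat) \<Rightarrow> 'f)) lie_algebra))
    (lie_direct_sum sl2_semidirect_V2 (abelian_lie_algebra (n - 1)))"
proof -
  interpret ham_outer_derivations n "TYPE('f)" by unfold_locales (use assms in auto)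
  show ?thesis
    using lie_isomorphic_OutI[OF assms lie_iso_hamiltonian] unfolding dp_heights_def .
qed

end
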